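(* Let $d\ge2$ and let $E\subset[0,1]^d$ be the fractal percolation set with integer parameter $M\ge2$ and retention probabilities $\{p_{\mathbf A}\}_{\mathbf A\in\mathcal A_1}$, $0<p_{\mathbf A}<1$. (1) Let $k=d-1$ and suppose that Condition $A(\alpha)$ holds for every orthonormal $k$-tuple $\alpha$ in $\mathbb R^d$ such that $S_\alpha$ is not a coordinate plane. Then for almost all realizations of $E$ such that $E\ne\emptyset$, simultaneously for all $t\in\mathbb R^d$, the radial projection $\mathrm{Proj}_t(E)$ has nonempty interior (in $S^{d-1}$). (2) Let $k=1$ and suppose that Condition $A(\alpha)$ holds for every orthonormal $k$-tuple $\alpha$ in $\mathbb R^d$ (i.e. every unit vector) such that $S_\alpha$ is not a coordinate plane. Then for almost all realizations of $E$ such that $E\neq\emptyset$, simultaneously for all $t\in\mathbb R^d$, the co-radial projection $\mathrm{CProj}_t(E)$ has nonempty interior (in $\mathbb R_+$).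
   Context: **Notation.** $[d]=\{1,\dots,d\}$, $K=[0,1]^d$, $\mathcal A_n=\{0,\dots,M-1\}^{d\times n}$ (so elements of $\mathcal A_1$ are column vectors of length $d$). For $\mathbf A\in\mathcal A_n$ let $\varphi_{\mathbf A}(\mathbf x)=M^{-n}\mathbf x+\mathbf A\,(M^{-1},\dots,M^{-n})^T$ and $K_{\mathbf A}=\varphi_{\mathbf A}(K)$, a level-$n$ cube of side $M^{-n}$. **Fractal percolation.** $K$ itself is retained at level $0$. If $K_{\mathbf A}$, $\mathbf A\in\mathcal A_n$, is not retained then no $K_{(\mathbf A|\mathbf C)}$, $\mathbf C\in\mathcal A_1$, is retained; if $K_{\mathbf A}$ is retained then each $K_{(\mathbf A|\mathbf C)}$ is retained with probability $p_{\mathbf C}$, all choices being independent. Here $(\mathbf A|\mathbf C)\in\mathcal A_{n+1}$ is $\mathbf A$ with the column $\mathbf C$ appended. Let $\mathcal E_n\subseteq\mathcal A_n$ be the random set of indices of retained level-$n$ cubes, $E_n=\bigcup_{\mathbf A\in\mathcal E_n}K_{\mathbf A}$, and $E=\bigcap_{n\ge1}E_n$. **Radial and co-radial projections.** For $t\in\mathbb R^d$, $\mathrm{Proj}_t(E)\subset S^{d-1}$ is the set of unit vectors under which points of $E\setminus\{t\}$ are visible from $t$, i.e. $\{(x-t)/|x-t| : x\in E\setminus\{t\}\}$; and $\mathrm{CProj}_t(E)\subset\mathbb R_+$ is the set of distances $\{|x-t|:x\in E\}$. **Directions and projections.** Let $1\le k\le d-1$. $\alpha=\{\mathbf a^{(1)},\dots,\mathbf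 a^{(k)}\}$ denotes an orthonormal set of vectors in $\mathbb R^d$ and $S_\alpha=\mathrm{span}(\alpha)$. Let $\mathbf e^{(i)}$ be the $i$-th standard unit vector. $S_\alpha$ is a coordinate plane if $S_\alpha=\mathrm{span}\{\mathbf e^{(j_1)},\dots,\mathbf e^{(j_k)}\}$ for some distinct $j_1,\dots,j_k\in[d]$. Let $\mathbf c^{(1)},\dots,\mathbf c^{(d-k)}$ be an orthonormal basis of $S_\alpha^\perp$ and let $C$ be the $d\times(d-k)$ matrix with these columns. Choose a $k$-element set $\mathcal I\subset[d]$ such that the $(d-k)\times(d-k)$ submatrix of $C$ formed by the rows with indices in $[d]\setminus\mathcal I$ has determinant of absolute value greater than $\frac{1}{2\sqrt{\binom dk}}$ (such $\mathcal I$ exists). Let $\Pi_\alpha$ be the linear projection of $\mathbb R^d$ onto $S_{\mathcal I}=\mathrm{span}\{\mathbf e^{(i)}:i\in\mathcal I\}$ along $S_\alpha^\perp$, i.e. $\Pi_\alpha(\mathbf x)$ is the unique point of $(\mathbf x+S_\alpha^\perp)\cap S_{\mathcal I}$. **Condition $A(\alpha)$.** Let $\Delta_\alpha=\Pi_\alpha(K)\subset S_{\mathcal I}$. For $\mathbf A\in\mathcal A_n$ let $\psi_{\alpha,\mathbf A}:\Pi_\alpha(K_{\mathbf A})\to\Delta_\alpha$ be the inverse of the homothety $\Delta_\alpha\to\Pi_\alpha(K_{\mathbf A})$, $\Pi_\alpha(\mathbf x)\mapsto\Pi_\alpha(\varphi_{\mathbf A}(\mathbf x))$ $(\mathbf x\in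 K)$. For functions $f:\Delta_\alpha\to[0,\infty)$ vanishing on the boundary of $\Delta_\alpha$ put $$F_\alpha f(x)=\sum_{\mathbf A\in\mathcal A_1:\ x\in\Pi_\alpha(K_{\mathbf A})}p_{\mathbf A}\, f(\psi_{\alpha,\mathbf A}(x)),\qquad x\in\Delta_\alpha,$$ and let $F_\alpha^r$ be its $r$-th iterate. Interiors of subsets of $\Delta_\alpha$ are taken in $S_{\mathcal I}$. Condition $A(\alpha)$ holds if there exist $I_1^\alpha,I_2^\alpha\subset\Delta_\alpha$, homothetic copies of $\Delta_\alpha$ under homotheties centred at the centre of $\Delta_\alpha$, and a positive integer $r=r_\alpha$ such that (i) $I_1^\alpha\subset\mathrm{int}\,I_2^\alpha$ and $I_2^\alpha\subset\mathrm{int}\,\Delta_\alpha$; (ii) $F_\alpha^r\mathbf 1_{I_1^\alpha}\ge 2\cdot\mathbf 1_{I_2^\alpha}$ pointwise on $\Delta_\alpha$. *)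

theory Defs
  imports
    "Jordan_Normal_Form.Determinant"
    "HOL-Probability.Probability"
begin

no_notation vec_index (infixl \<open>$\<close> 100)

section \<open>M-adic cubes\<close>

type_synonym 'd word = "(nat ^ 'd) list"

definition digits :: "nat \<Rightarrow> (nat ^ 'd::finite) set"
  where "digits M = {C. \<forall>i. C $ i < M}"

text \<open>A \<open>d \<times> n\<close> matrix with entries below \<open>M\<close> is the list of its \<open>n\<close> columns, so that
  \<open>(A|C)\<close> is \<open>A @ [C]\<close>, and columns are numbered from \<open>0\<close>.\<close>

definition words :: "nat \<Rightarrow> nat \<Rightarrow> ('d::finite) word set"
  where "words M n = {A. length A = n \<and> set A \<subseteq> digits M}"

definition unit_cube :: "(real ^ 'd::finite) set"
  where "unit_cube = {x. \<forall>i. 0 \<le> x $ i \<and> x $ i \<le> 1}"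

definition cube_map :: "nat \<Rightarrow> ('d::finite) word \<Rightarrow> real ^ 'd \<Rightarrow> real ^ 'd"
  where "cube_map M A x =
    (1 / real M ^ length A) *\<^sub>R x + (\<chi> i. \<Sum>j<length A. real ((A ! j) $ i) / real M ^ Suc j)"

definition cube :: "nat \<Rightarrow> ('d::finite) word \<Rightarrow> (real ^ 'd) set"
  where "cube M A = cube_map M A ` unit_cube"

section \<open>Fractal percolation\<close>

text \<open>\<open>c (A @ [C]) \<omega>\<close> is the outcome of the choice whether the cube with index \<open>A @ [C]\<close> is
  kept when its parent \<open>A\<close> is retained. The choices are realised for all nonempty words;
  the outcomes below a non-retained cube are never consulted.\<close>

definition percolation_choices ::
  "'w measure \<Rightarrow> nat \<Rightarrow> (nat ^ 'd::finite \<Rightarrow> real) \<Rightarrow> ('d word \<Rightarrow> 'w \<Rightarrow> bool) \<Rightarrow> bool"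
  where "percolation_choices P M p c \<longleftrightarrow>
    prob_space P \<and>
    prob_space.indep_vars P (\<lambda>_. count_space UNIV) c (\<Union>n\<in>{1..}. words M n) \<and>
    (\<forall>n. \<forall>A\<in>words M n. \<forall>C\<in>digits M. measure P {\<omega> \<in> space P. c (A @ [C]) \<omega>} = p C)"

fun retained :: "nat \<Rightarrow> (('d::finite) word \<Rightarrow> 'w \<Rightarrow> bool) \<Rightarrow> nat \<Rightarrow> 'w \<Rightarrow> 'd word set"
  where
    "retained M c 0 \<omega> = {[]}"
  | "retained M c (Suc n) \<omega> = {A @ [C] | A C. A \<in> retained M c n \<omega> \<and> C \<in> digits M \<and> c (A @ [C]) \<omega>}"

definition level_set :: "nat \<Rightarrow> (('d::finite) word \<Rightarrow> 'w \<Rightarrow> bool) \<Rightarrow> nat \<Rightarrow> 'w \<Rightarrow> (real ^ 'd) set"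
  where "level_set M c n \<omega> = (\<Union>A\<in>retained M c n \<omega>. cube M A)"

definition percolation_set :: "nat \<Rightarrow> (('d::finite) word \<Rightarrow> 'w \<Rightarrow> bool) \<Rightarrow> 'w \<Rightarrow> (real ^ 'd) set"
  where "percolation_set M c \<omega> = (\<Inter>n\<in>{1..}. level_set M c n \<omega>)"

section \<open>Radial and co-radial projections\<close>

definition radial_proj :: "real ^ 'd \<Rightarrow> (real ^ 'd::finite) set \<Rightarrow> (real ^ 'd) set"
  where "radial_proj t E = {(x - t) /\<^sub>R norm (x - t) | x. x \<in> E - {t}}"

definition coradial_proj :: "real ^ 'd \<Rightarrow> (real ^ 'd::finite) set \<Rightarrow> real set"
  where "coradial_proj t E = {norm (x - t) | x. x \<in> E}"

section \<open>Directions and projections\<close>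

definition orthonormal_set :: "(real ^ 'd::finite) set \<Rightarrow> bool"
  where "orthonormal_set \<alpha> \<longleftrightarrow> pairwise orthogonal \<alpha> \<and> (\<forall>a\<in>\<alpha>. norm a = 1)"

definition coord_span :: "'d::finite set \<Rightarrow> (real ^ 'd::finite) set"
  where "coord_span J = span ((\<lambda>i. axis i 1) ` J)"

definition coordinate_plane :: "(real ^ 'd::finite) set \<Rightarrow> bool"
  where "coordinate_plane \<alpha> \<longleftrightarrow> (\<exists>J. card J = card \<alpha> \<and> span \<alpha> = coord_span J)"

text \<open>\<open>cs\<close> lists the columns of the matrix \<open>C\<close> and \<open>js\<close> enumerates the rows outside \<open>J\<close>. The
  absolute value of the determinant depends neither on the enumeration nor on the choice of the
  orthonormal basis. The determinant is the one for matrices whose size is a number.\<close>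

definition admissible_coords :: "(real ^ 'd::finite) set \<Rightarrow> 'd set \<Rightarrow> bool"
  where "admissible_coords \<alpha> J \<longleftrightarrow>
    card J = card \<alpha> \<and>
    (\<exists>cs js.
      distinct cs \<and> orthonormal_set (set cs) \<and> span (set cs) = (span \<alpha>)\<^sup>\<bottom> \<and>
      distinct js \<and> set js = UNIV - J \<and>
      (let m = CARD('d) - card \<alpha> in
        \<bar>Determinant.det (Matrix.mat m m (\<lambda>(r, s). (cs ! s) $ (js ! r)))\<bar>
          > 1 / (2 * sqrt (real (CARD('d) choose card \<alpha>)))))"

definition plane_proj :: "(real ^ 'd::finite) set \<Rightarrow> 'd set \<Rightarrow> real ^ 'd \<Rightarrow> real ^ 'd"
  where "plane_proj \<alpha> J x = (THE y. y \<in> ((\<lambda>v. x + v) ` ((span \<alpha>)\<^sup>\<bottom>)) \<inter> coord_span J)"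

section \<open>Condition A\<close>

definition shadow :: "(real ^ 'd::finite) set \<Rightarrow> 'd set \<Rightarrow> (real ^ 'd) set"
  where "shadow \<alpha> J = plane_proj \<alpha> J ` unit_cube"

definition psi :: "nat \<Rightarrow> (real ^ 'd) set \<Rightarrow> 'd set \<Rightarrow> ('d::finite) word \<Rightarrow> real ^ 'd \<Rightarrow> real ^ 'd"
  where "psi M \<alpha> J A y =
    (THE z. \<exists>x\<in>unit_cube. z = plane_proj \<alpha> J x \<and> y = plane_proj \<alpha> J (cube_map M A x))"

text \<open>Only the values of \<open>f\<close> on \<open>shadow \<alpha> J\<close> enter, because \<open>psi\<close> maps the projected
  subcubes into it.\<close>

definition F_op ::
  "nat \<Rightarrow> (nat ^ 'd::finite \<Rightarrow> real) \<Rightarrow> (real ^ 'd) set \<Rightarrow> 'd set \<Rightarrow> (real ^ 'd \<Rightarrow> real) \<Rightarrow> real ^ 'd \<Rightarrow> real"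
  where "F_op M p \<alpha> J f x =
    (\<Sum>C | C \<in> digits M \<and> x \<in> plane_proj \<alpha> J ` cube M [C]. p C * f (psi M \<alpha> J [C] x))"

text \<open>\<open>shadow \<alpha> J\<close> is centrally symmetric about the image of the centre of the cube, so negative
  ratios would give no further copies.\<close>

definition central_copy :: "(real ^ 'd::finite) set \<Rightarrow> 'd set \<Rightarrow> (real ^ 'd) set \<Rightarrow> bool"
  where "central_copy \<alpha> J I \<longleftrightarrow>
    (\<exists>\<rho>>0. let z = plane_proj \<alpha> J (\<chi> i. 1/2) in I = (\<lambda>x. z + \<rho> *\<^sub>R (x - z)) ` shadow \<alpha> J)"

definition condition_A ::
  "nat \<Rightarrow> (nat ^ 'd::finite \<Rightarrow> real) \<Rightarrow> (real ^ 'd) set \<Rightarrow> 'd set \<Rightarrow> bool"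
  where "condition_A M p \<alpha> J \<longleftrightarrow>
    (\<exists>I\<^sub>1 I\<^sub>2 r.
      I\<^sub>1 \<subseteq> shadow \<alpha> J \<and> I\<^sub>2 \<subseteq> shadow \<alpha> J \<and>
      central_copy \<alpha> J I\<^sub>1 \<and> central_copy \<alpha> J I\<^sub>2 \<and> 0 < r \<and>
      I\<^sub>1 \<subseteq> top_of_set (coord_span J) interior_of I\<^sub>2 \<and>
      I\<^sub>2 \<subseteq> top_of_set (coord_span J) interior_of shadow \<alpha> J \<and>
      (\<forall>x\<in>shadow \<alpha> J. (F_op M p \<alpha> J ^^ r) (indicator I\<^sub>1) x \<ge> 2 * indicator I\<^sub>2 x))"

end

theory Submission
  imports Defs
begin

text \<open>
  Fix a unit vector \<open>v\<close> with no vanishing coordinate. Condition A for the corresponding plane says that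
  a fibre parallel to the plane's complement which meets a central part of the cube meets, in the mean,
  the central parts of at least two retained cubes \<open>r\<close> levels below. This survives a small perturbation,
  so it holds for all rays from, or spheres around, centres \<open>t\<close> that see the cube from far away almost in
  direction \<open>v\<close>; this class of fibres is invariant under rescaling subcubes. The number of
  retained cubes along each fibre then grows geometrically except with doubly exponentially small
  probability, whereas there are only exponentially many fibres up to the resolution of level \<open>n\<close>. Hence
  with positive probability all these fibres meet \<open>E\<close>. By a zero-one law this happens, almost surely on
  survival, inside every surviving cube, for countably many \<open>v\<close> whose neighbourhoods cover all
  directions. Given \<open>t\<close>, choose a point of \<open>E\<close> whose difference to \<open>t\<close> has no vanishing coordinate and
  rescale a small enough cube around it.\<close>

text \<open>The gap between the two concentric cores in Condition A is the resource spent
  throughout: half of it pays for replacing a flat fibre by a ray or a sphere, the other half for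
  passing from a fibre to its neighbour in a finite net. Both errors have to be small relative to
  the side of the cube at hand, at every level; rescaling a subcube only pushes a far centre further
  away, so one accuracy \<delta> serves all levels. The growth rate 2 in the mean is lowered to 3/2
  to leave room for a Chernoff bound. That bound is useful only once (3/2)^n is large, so the
  induction starts from the event that all cubes down to some level are retained. Its probability is
  tiny but positive, and positivity is all that the zero-one law asks for. Nothing is assumed about
  coordinate planes; directions \<open>v\<close> without a vanishing coordinate avoid them both as
  normals of hyperplanes and as spanning vectors of lines, at the price of having to find a point of
  E that shares no coordinate with \<open>t\<close>.\<close>

no_notation scalar_prod (infix \<open>\<bullet>\<close> 70)

section \<open>Words and cubes\<close>

text \<open>\<open>retained\<close> for a fixed configuration \<open>\<xi>\<close> in place of a
  sample point, so that the same notion applies to the configuration below any word. Prefixes are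
  tested from length 1 on, since the root is retained unconditionally.\<close>

definition openings :: "nat \<Rightarrow> (('d::finite) word \<Rightarrow> bool) \<Rightarrow> nat \<Rightarrow> 'd word set"
  where "openings M \<xi> n = {A \<in> words M n. \<forall>i\<in>{1..n}. \<xi> (take i A)}"

text \<open>Polymorphic in the values, so that it shifts a configuration \<open>\<xi>\<close> as
  well as the family \<open>c\<close> of random variables; the second use turns a subtree into
  another percolation on the same probability space.\<close>

definition below :: "(('d::finite) word \<Rightarrow> 'b) \<Rightarrow> 'd word \<Rightarrow> 'd word \<Rightarrow> 'b"
  where "below c B = (\<lambda>A. c (B @ A))"

lemma below_Nil [simp]: "below c [] = c"
  by (simp add: below_def)

lemma below_below: "below (below c A) B = below c (A @ B)"
  by (simp add: below_def)

lemma words_0 [simp]: "words M 0 = {[]}"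
  by (auto simp: words_def)

lemma words_length: "A \<in> words M n \<Longrightarrow> length A = n"
  by (simp add: words_def)

lemma words_append: "A \<in> words M m \<Longrightarrow> B \<in> words M n \<Longrightarrow> A @ B \<in> words M (m + n)"
  by (auto simp: words_def)

lemma words_take: "A \<in> words M n \<Longrightarrow> i \<le> n \<Longrightarrow> take i A \<in> words M i"
  by (auto simp: words_def dest: in_set_takeD)

lemma words_drop: "A \<in> words M n \<Longrightarrow> drop i A \<in> words M (n - i)"
  by (auto simp: words_def dest: in_set_dropD)

lemma words_Suc: "words M (Suc n) = (\<lambda>(C, A). C # A) ` (digits M \<times> words M n)"
  by (auto simp: words_def length_Suc_conv image_iff)

lemma words_Suc': "words M (Suc n) = (\<lambda>(A, C). A @ [C]) ` (words M n \<times> digits M)"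
proof (intro equalityI subsetI)
  fix A assume A: "A \<in> words M (Suc n)"
  then have "A \<noteq> []" by (auto simp: words_def)
  then have "A = butlast A @ [last A]" by simp
  moreover have "butlast A \<in> words M n"
    using A by (auto simp: words_def dest: in_set_butlastD)
  moreover have "last A \<in> digits M"
    using A \<open>A \<noteq> []\<close> by (auto simp: words_def)
  ultimately show "A \<in> (\<lambda>(A, C). A @ [C]) ` (words M n \<times> digits M)"
    by (metis (no_types, lifting) SigmaI case_prod_conv image_eqI)
qed (auto simp: words_def)

lemma finite_digits [simp, intro]: "finite (digits M :: (nat ^ 'd::finite) set)"
proof -
  have "digits M \<subseteq> vec_lambda ` (PiE UNIV (\<lambda>_::'d. {..<M}))"
  proof
    fix C :: "nat ^ 'd" assume "C \<in> digits M"
    then have "vec_nth C \<in> PiE UNIV (\<lambda>_. {..<M})" by (auto simp: digits_def)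
    then show "C \<in> vec_lambda ` (PiE UNIV (\<lambda>_::'d. {..<M}))"
      by (metis imageI vec_lambda_eta)
  qed
  then show ?thesis by (rule finite_subset) (simp add: finite_PiE)
qed

lemma finite_words [simp, intro]: "finite (words M n)"
  unfolding words_def using finite_lists_length_eq[OF finite_digits] by (simp add: conj_commute)

lemma digits_nonempty: "M \<ge> 1 \<Longrightarrow> digits M \<noteq> {}"
  by (auto simp: digits_def intro!: exI[of _ "\<chi> i. 0"])

lemma words_1: "[C] \<in> words M (Suc 0) \<longleftrightarrow> C \<in> digits M"
  by (auto simp: words_def)

lemma openings_subset: "openings M \<xi> n \<subseteq> words M n"
  by (auto simp: openings_def)

lemma finite_openings [simp, intro]: "finite (openings M \<xi> n)"
  using finite_subset[OF openings_subset finite_words] .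

lemma openings_0 [simp]: "openings M \<xi> 0 = {[]}"
  by (auto simp: openings_def)

lemma openings_append:
  assumes "A \<in> words M m" "B \<in> words M n"
  shows "A @ B \<in> openings M \<xi> (m + n) \<longleftrightarrow> A \<in> openings M \<xi> m \<and> B \<in> openings M (below \<xi> A) n"
proof
  assume *: "A @ B \<in> openings M \<xi> (m + n)"
  have "\<xi> (take i A)" if "i \<in> {1..m}" for i
    using * that assms by (force simp: openings_def words_length dest: bspec[of _ _ i])
  moreover have "\<xi> (A @ take i B)" if "i \<in> {1..n}" for i
    using * that assms by (auto simp: openings_def words_length dest: bspec[of _ _ "m + i"])
  ultimately show "A \<in> openings M \<xi> m \<and> B \<in> openings M (below \<xi> A) n"
    using assms by (auto simp: openings_def below_def)
next
  assume *: "A \<in> openings M \<xi> m \<and> B \<in> openings M (below \<xi> A) n"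
  have "\<xi> (take i (A @ B))" if "i \<in> {1..m + n}" for i
  proof (cases "i \<le> m")
    case True
    with * that assms show ?thesis by (auto simp: openings_def words_length)
  next
    case False
    then have "i - m \<in> {1..n}" using that by auto
    then have "\<xi> (A @ take (i - m) B)" using * by (auto simp: openings_def below_def)
    with False assms show ?thesis by (simp add: words_length)
  qed
  then show "A @ B \<in> openings M \<xi> (m + n)"
    using words_append[OF assms] by (auto simp: openings_def)
qed

lemma openings_1: "openings M \<xi> (Suc 0) = {[C] | C. C \<in> digits M \<and> \<xi> [C]}"
  by (auto simp: openings_def words_def length_Suc_conv)

lemma openings_take: "A \<in> openings M \<xi> n \<Longrightarrow> i \<le> n \<Longrightarrow> take i A \<in> openings M \<xi> i"
  by (auto simp: openings_def words_take min_def)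

lemma openings_mono:
  assumes "openings M \<xi> n \<noteq> {}" "m \<le> n"
  shows "openings M \<xi> m \<noteq> {}"
  using assms openings_take by blast

lemma openings_cong:
  fixes \<xi> \<xi>' :: "('d::finite) word \<Rightarrow> bool"
  assumes "\<And>A. length A \<in> {1..n} \<Longrightarrow> A \<in> words M (length A) \<Longrightarrow> \<xi> A = \<xi>' A"
  shows "openings M \<xi> n = openings M \<xi>' n"
  unfolding openings_def
proof (intro Collect_cong conj_cong refl ball_cong)
  fix A :: "'d word" and i assume "A \<in> words M n" "i \<in> {1..n}"
  then show "\<xi> (take i A) = \<xi>' (take i A)"
    by (intro assms) (auto simp: words_length words_take min_def)
qed

lemma retained_eq: "retained M c n \<omega> = openings M (\<lambda>A. c A \<omega>) n"
proof (induction n)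
  case (Suc n)
  define \<xi> where "\<xi> = (\<lambda>A. c A \<omega>)"
  have *: "A @ [C] \<in> openings M \<xi> (Suc n) \<longleftrightarrow> A \<in> openings M \<xi> n \<and> c (A @ [C]) \<omega>"
    if "A \<in> words M n" "C \<in> digits M" for A C
    using openings_append[of A M n "[C]" "Suc 0" \<xi>] that
    by (auto simp: words_1 openings_1 below_def \<xi>_def)
  show ?case
  proof (intro equalityI subsetI)
    fix D assume "D \<in> retained M c (Suc n) \<omega>"
    then obtain A C where "D = A @ [C]" "A \<in> openings M \<xi> n" "C \<in> digits M" "c (A @ [C]) \<omega>"
      using Suc by (auto simp: \<xi>_def)
    then show "D \<in> openings M (\<lambda>A. c A \<omega>) (Suc n)"
      using * openings_subset[of M \<xi> n] by (auto simp: \<xi>_def)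
  next
    fix D assume D: "D \<in> openings M (\<lambda>A. c A \<omega>) (Suc n)"
    then obtain A C where AC: "D = A @ [C]" "A \<in> words M n" "C \<in> digits M"
      using openings_subset[of M "\<lambda>A. c A \<omega>" "Suc n"] unfolding words_Suc' by auto
    with D * have "A \<in> openings M \<xi> n \<and> c (A @ [C]) \<omega>" by (simp add: \<xi>_def)
    with AC Suc show "D \<in> retained M c (Suc n) \<omega>" by (auto simp: \<xi>_def)
  qed
qed simp

text \<open>The inverse of \<open>cube_map\<close>, defined on the whole space because it is mostly
  applied to centres \<open>t\<close> outside the cube.\<close>

definition uncube :: "nat \<Rightarrow> ('d::finite) word \<Rightarrow> real ^ 'd \<Rightarrow> real ^ 'd"
  where "uncube M A y = (real M ^ length A) *\<^sub>R (y - cube_map M A 0)"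

lemma cube_map_affine: "cube_map M A x = (1 / real M ^ length A) *\<^sub>R x + cube_map M A 0"
  by (simp add: cube_map_def)

lemma cube_map_diff: "cube_map M A x - cube_map M A y = (1 / real M ^ length A) *\<^sub>R (x - y)"
  unfolding cube_map_affine[of M A x] cube_map_affine[of M A y] by (simp add: scaleR_diff_right)

lemma uncube_cube_map [simp]: "M \<ge> 1 \<Longrightarrow> uncube M A (cube_map M A x) = x"
  unfolding uncube_def cube_map_diff by simp

lemma cube_map_uncube [simp]: "M \<ge> 1 \<Longrightarrow> cube_map M A (uncube M A x) = x"
  unfolding uncube_def by (subst cube_map_affine) simp

lemma cube_map_Nil [simp]: "cube_map M [] x = x"
  by (simp add: cube_map_def zero_vec_def[symmetric] vec_eq_iff)

lemma cube_map_Cons: "cube_map M (C # A) x = cube_map M [C] (cube_map M A x)"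
proof -
  have "cube_map M (C # A) x $ i = cube_map M [C] (cube_map M A x) $ i" for i
    unfolding cube_map_def
    by (simp add: sum.lessThan_Suc_shift add_divide_distrib sum_divide_distrib mult.commute
        del: sum.lessThan_Suc)
  then show ?thesis by (simp add: vec_eq_iff)
qed

lemma cube_map_append: "cube_map M (A @ B) x = cube_map M A (cube_map M B x)"
proof (induction A)
  case (Cons C A)
  then show ?case by (simp add: cube_map_Cons[of M C "A @ B"] cube_map_Cons[of M C A])
qed simp

lemma cube_map_digit_in_unit_cube:
  assumes "C \<in> digits M" "x \<in> unit_cube" "M \<ge> 1"
  shows "cube_map M [C] x \<in> unit_cube"
proof -
  have "(x $ i + real (C $ i)) / real M \<in> {0..1}" for i
  proof -
    have "C $ i < M" using assms(1) by (simp add: digits_def)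
    then have "real (C $ i) + 1 \<le> real M" by linarith
    moreover have "0 \<le> x $ i" "x $ i \<le> 1" using assms(2) by (auto simp: unit_cube_def)
    ultimately show ?thesis using \<open>M \<ge> 1\<close> by (auto simp: field_simps)
  qed
  then show ?thesis by (simp add: unit_cube_def cube_map_def add_divide_distrib)
qed

lemma cube_map_in_unit_cube:
  assumes "A \<in> words M n" "x \<in> unit_cube" "M \<ge> 1"
  shows "cube_map M A x \<in> unit_cube"
  using assms(1)
proof (induction A arbitrary: n)
  case (Cons C A)
  then have "cube_map M A x \<in> unit_cube" "C \<in> digits M" by (auto simp: words_def)
  then show ?case by (subst cube_map_Cons) (rule cube_map_digit_in_unit_cube[OF _ _ assms(3)])
qed (use assms in simp)

lemma cube_append_subset:
  assumes "B \<in> words M n" "M \<ge> 1"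
  shows "cube M (A @ B) \<subseteq> cube M A"
  using cube_map_in_unit_cube[OF assms(1) _ assms(2)] by (auto simp: cube_def cube_map_append)

lemma unit_cube_eq_cbox: "unit_cube = cbox 0 (\<chi> i. 1)"
  by (auto simp: unit_cube_def mem_box_cart)

lemma compact_unit_cube: "compact unit_cube"
  by (simp add: unit_cube_eq_cbox)

lemma continuous_on_cube_map: "continuous_on S (cube_map M A)"
  unfolding cube_map_def[abs_def] by (intro continuous_intros)

lemma compact_cube: "compact (cube M A)"
  unfolding cube_def by (intro compact_continuous_image continuous_on_cube_map compact_unit_cube)

lemma norm_le_card:
  fixes x :: "real ^ 'd::finite"
  assumes "\<And>i. \<bar>x $ i\<bar> \<le> b"
  shows "norm x \<le> real CARD('d) * b"
proof -
  have "norm x \<le> (\<Sum>i\<in>UNIV. \<bar>x $ i\<bar>)" by (rule norm_le_l1_cart)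
  also have "\<dots> \<le> (\<Sum>i\<in>(UNIV::'d set). b)" by (rule sum_mono) (use assms in auto)
  finally show ?thesis by simp
qed

lemma unit_cube_dist:
  fixes x y :: "real ^ 'd::finite"
  assumes "x \<in> unit_cube" "y \<in> unit_cube"
  shows "norm (x - y) \<le> real CARD('d)"
proof -
  have "\<bar>(x - y) $ i\<bar> \<le> 1" for i
    using assms[unfolded unit_cube_def mem_Collect_eq, rule_format, of i] by (auto simp: abs_le_iff)
  from norm_le_card[OF this] show ?thesis by simp
qed

text \<open>The concentric cube of side \<rho>. Its projection is the central copy of the shadow
  with ratio \<rho>, which is how Condition A becomes a statement about cubes.\<close>

definition core :: "real \<Rightarrow> (real ^ 'd::finite) set"
  where "core \<rho> = {x. \<forall>i. \<bar>x $ i - 1/2\<bar> \<le> \<rho> / 2}"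

lemma core_subset_unit_cube: "\<rho> \<le> 1 \<Longrightarrow> core \<rho> \<subseteq> unit_cube"
  unfolding core_def unit_cube_def
proof clarify
  fix x :: "real ^ 'd" and i
  assume "\<rho> \<le> 1" "\<forall>i. \<bar>x $ i - 1/2\<bar> \<le> \<rho> / 2"
  then have "\<bar>x $ i - 1/2\<bar> \<le> 1 / 2" by (meson divide_right_mono order_trans zero_le_numeral)
  then show "0 \<le> x $ i \<and> x $ i \<le> 1" by linarith
qed

text \<open>Corresponding faces of the two cores are (\<rho> - \<rho>')/2 apart, and passing to a
  cube of level n divides this margin by M^n.\<close>

lemma cube_map_core_perturb:
  fixes y y' :: "real ^ 'd::finite"
  assumes "y \<in> cube_map M A ` core \<rho>'" "norm (y - y') \<le> (\<rho> - \<rho>') / 2 / real M ^ length A" "M \<ge> 1"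
  shows "y' \<in> cube_map M A ` core \<rho>"
proof -
  obtain x where x: "x \<in> core \<rho>'" "y = cube_map M A x" using assms(1) by blast
  have "uncube M A y' \<in> core \<rho>" unfolding core_def
  proof (clarify)
    fix i
    have "norm (x - uncube M A y') = norm (uncube M A y - uncube M A y')" using x assms by simp
    also have "\<dots> = real M ^ length A * norm (y - y')"
      by (simp add: uncube_def flip: scaleR_diff_right)
    also have "\<dots> \<le> (\<rho> - \<rho>') / 2" using assms(2,3) by (simp add: field_simps)
    finally have "\<bar>(x - uncube M A y') $ i\<bar> \<le> (\<rho> - \<rho>') / 2"
      using component_le_norm_cart[of "x - uncube M A y'" i] by linarith
    moreover have "\<bar>x $ i - 1/2\<bar> \<le> \<rho>' / 2" using x by (simp add: core_def)
    ultimately show "\<bar>uncube M A y' $ i - 1/2\<bar> \<le> \<rho> / 2"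
      unfolding vector_minus_component diff_divide_distrib by linarith
  qed
  then show ?thesis using assms(3) by (metis cube_map_uncube imageI)
qed

section \<open>The limit set of a configuration\<close>

lemma percolation_set_eq:
  "percolation_set M c \<omega> = (\<Inter>n\<in>{1..}. \<Union>A\<in>openings M (\<lambda>A. c A \<omega>) n. cube M A)"
  by (simp add: percolation_set_def level_set_def retained_eq)

definition limit_set :: "nat \<Rightarrow> (('d::finite) word \<Rightarrow> bool) \<Rightarrow> (real ^ 'd) set"
  where "limit_set M \<xi> = (\<Inter>n. \<Union>A\<in>openings M \<xi> n. cube M A)"

lemma level_decreasing:
  assumes "M \<ge> 1" "m \<le> n"
  shows "(\<Union>A\<in>openings M \<xi> n. cube M A) \<subseteq> (\<Union>A\<in>openings M \<xi> m. cube M A)"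
proof clarify
  fix x A assume A: "x \<in> cube M A" "A \<in> openings M \<xi> n"
  have "take m A \<in> openings M \<xi> m" using openings_take[OF A(2) assms(2)] .
  moreover have "drop m A \<in> words M (n - m)" using A openings_subset words_drop by blast
  then have "x \<in> cube M (take m A)"
    using cube_append_subset[of "drop m A" M _ "take m A"] A(1) assms(1) by auto
  ultimately show "x \<in> (\<Union>A\<in>openings M \<xi> m. cube M A)" by blast
qed

lemma percolation_set_limit_set:
  assumes "M \<ge> 1"
  shows "percolation_set M c \<omega> = limit_set M (\<lambda>A. c A \<omega>)"
proof -
  define L where "L n = (\<Union>A\<in>openings M (\<lambda>A. c A \<omega>) n. cube M A)" for n
  have "L 1 \<subseteq> L n" if "n \<notin> {1..}" for n
    unfolding L_def using that by (intro level_decreasing[OF assms]) auto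
  then have "(\<Inter>n\<in>{1..}. L n) \<subseteq> L n" for n
    by (cases "n \<in> {1..}") (blast, metis INT_lower atLeast_iff order_refl order_trans)
  then have "(\<Inter>n\<in>{1..}. L n) = (\<Inter>n. L n)" by (intro equalityI INT_greatest) auto
  then show ?thesis unfolding percolation_set_eq limit_set_def L_def .
qed

lemma limit_set_cube_map:
  assumes "M \<ge> 1" "B \<in> openings M \<xi> m" "x \<in> limit_set M (below \<xi> B)"
  shows "cube_map M B x \<in> limit_set M \<xi>"
proof -
  have "cube_map M B x \<in> (\<Union>A\<in>openings M \<xi> n. cube M A)" for n
  proof -
    obtain A where A: "A \<in> openings M (below \<xi> B) n" "x \<in> cube M A"
      using assms(3) by (auto simp: limit_set_def)
    then have "B @ A \<in> openings M \<xi> (m + n)"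
      using assms openings_subset openings_append by (metis subsetD)
    moreover have "cube_map M B x \<in> cube M (B @ A)"
      using A(2) by (auto simp: cube_def cube_map_append)
    ultimately show ?thesis using level_decreasing[OF assms(1), of n "m + n" \<xi>] by auto
  qed
  then show ?thesis by (auto simp: limit_set_def)
qed

text \<open>Koenig's lemma, for the tree of retained cubes containing \<open>x\<close>.\<close>

lemma limit_set_surviving_cube:
  assumes "M \<ge> 1" "x \<in> limit_set M \<xi>"
  obtains A where "A \<in> openings M \<xi> n" "x \<in> cube M A" "\<And>m. openings M (below \<xi> A) m \<noteq> {}"
proof -
  have "\<exists>A\<in>openings M \<xi> n. x \<in> cube M A \<and> openings M (below \<xi> A) m \<noteq> {}" for m
  proof -
    obtain D where D: "D \<in> openings M \<xi> (n + m)" "x \<in> cube M D"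
      using assms(2) by (auto simp: limit_set_def)
    have w: "D \<in> words M (n + m)" using D openings_subset by blast
    have "take n D \<in> words M n" "drop n D \<in> words M m"
      using words_take[OF w, of n] words_drop[OF w, of n] by auto
    then have "take n D \<in> openings M \<xi> n" "drop n D \<in> openings M (below \<xi> (take n D)) m"
      using D openings_append[of "take n D" M n "drop n D" m \<xi>] by auto
    moreover have "x \<in> cube M (take n D)"
      using cube_append_subset[OF \<open>drop n D \<in> words M m\<close> assms(1), of "take n D"] D by auto
    ultimately show ?thesis by blast
  qed
  then obtain f where f: "\<And>m. f m \<in> openings M \<xi> n \<and> x \<in> cube M (f m) \<and> openings M (below \<xi> (f m)) m \<noteq> {}"
    by metis
  \<comment> \<open>The witnesses for survival to depth m range over finitely many words, so one
    word serves infinitely many depths, and hence all of them by monotonicity.\<close>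
  have "\<exists>A\<in>openings M \<xi> n. \<exists>\<^sub>\<infinity>m. f m = A"
    using inf_img_fin_dom[of f UNIV] finite_subset[of "range f" "openings M \<xi> n"] f
    by (auto simp: INFM_iff_infinite vimage_def)
  then obtain A where A: "A \<in> openings M \<xi> n" "\<exists>\<^sub>\<infinity>m. f m = A" by blast
  show thesis
  proof (rule that[OF A(1)])
    show "x \<in> cube M A" using INFM_EX[OF A(2)] f by blast
    show "openings M (below \<xi> A) m \<noteq> {}" for m
    proof -
      obtain k where "k \<ge> m" "f k = A" using A(2) by (auto simp: INFM_nat_le)
      with f[of k] openings_mono show ?thesis by metis
    qed
  qed
qed

lemma limit_set_nonempty_survives:
  "limit_set M \<xi> \<noteq> {} \<Longrightarrow> openings M \<xi> n \<noteq> {}"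
  by (auto simp: limit_set_def)

text \<open>The levels \<open>n * r\<close> with n \<ge> n0 are cofinal, so hits there make the
  trace of \<open>F\<close> nonempty at every level; these traces are compact and nested.\<close>

lemma limit_set_meets_closed:
  fixes F :: "(real ^ 'd::finite) set"
  assumes "M \<ge> 1" "closed F" "\<And>n. n \<ge> n0 \<Longrightarrow> \<exists>A\<in>openings M \<xi> (n * r). F \<inter> cube M A \<noteq> {}" "r \<ge> 1"
  shows "F \<inter> limit_set M \<xi> \<noteq> {}"
proof -
  define L where "L n = F \<inter> (\<Union>A\<in>openings M \<xi> n. cube M A)" for n
  have cl: "compact (L n)" for n
    unfolding L_def by (intro closed_Int_compact assms compact_UN finite_openings compact_cube)
  have dec: "L n \<subseteq> L m" if "m \<le> n" for m n
    using level_decreasing[OF assms(1) that] by (auto simp: L_def)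
  have ne: "L n \<noteq> {}" for n
  proof -
    have "L (max n n0 * r) \<noteq> {}" using assms(3)[of "max n n0"] by (auto simp: L_def)
    moreover have "n \<le> max n n0 * r" using assms(4)
      by (metis max.cobounded1 mult.right_neutral mult_le_mono)
    ultimately show ?thesis using dec by blast
  qed
  have "(\<Inter>n. L n) \<noteq> {}" by (rule compact_nest[OF cl ne dec])
  then show ?thesis by (auto simp: L_def limit_set_def)
qed

section \<open>The law of the random tree\<close>

abbreviation coins :: "'i set \<Rightarrow> ('i \<Rightarrow> bool) measure"
  where "coins I \<equiv> PiM I (\<lambda>_. count_space UNIV)"

text \<open>A predicate on total configurations that factors through the coordinates in
  \<open>I\<close> and is measurable there. \<open>restrict\<close> appears only to reach the
  product space, whose points are \<open>undefined\<close> outside \<open>I\<close>; everywhere else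
  configurations stay total.\<close>

definition determined :: "'i set \<Rightarrow> (('i \<Rightarrow> bool) \<Rightarrow> bool) \<Rightarrow> bool"
  where "determined I \<Phi> \<longleftrightarrow>
    (\<forall>\<xi>. \<Phi> (restrict \<xi> I) = \<Phi> \<xi>) \<and> {x \<in> space (coins I). \<Phi> x} \<in> sets (coins I)"

lemma determinedD:
  assumes "determined I \<Phi>"
  shows "\<Phi> (restrict \<xi> I) = \<Phi> \<xi>" "{x \<in> space (coins I). \<Phi> x} \<in> sets (coins I)"
  using assms by (auto simp: determined_def)

lemma determined_cong:
  assumes "determined I \<Phi>" "\<And>i. i \<in> I \<Longrightarrow> \<xi> i = \<xi>' i"
  shows "\<Phi> \<xi> = \<Phi> \<xi>'"
proof -
  have "restrict \<xi> I = restrict \<xi>' I" using assms(2) by (auto simp: restrict_def)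
  then show ?thesis using determinedD(1)[OF assms(1)] by metis
qed

lemma determined_not: "determined I \<Phi> \<Longrightarrow> determined I (\<lambda>\<xi>. \<not> \<Phi> \<xi>)"
  unfolding determined_def by (auto intro!: sets.sets_Collect_neg)

lemma determined_conj:
  "determined I \<Phi> \<Longrightarrow> determined I \<Psi> \<Longrightarrow> determined I (\<lambda>\<xi>. \<Phi> \<xi> \<and> \<Psi> \<xi>)"
  unfolding determined_def by (auto intro!: sets.sets_Collect_conj)

lemma determined_disj:
  "determined I \<Phi> \<Longrightarrow> determined I \<Psi> \<Longrightarrow> determined I (\<lambda>\<xi>. \<Phi> \<xi> \<or> \<Psi> \<xi>)"
  unfolding determined_def by (auto intro!: sets.sets_Collect_disj)

lemma determined_ball:
  "countable X \<Longrightarrow> (\<And>a. a \<in> X \<Longrightarrow> determined I (\<Phi> a)) \<Longrightarrow> determined I (\<lambda>\<xi>. \<forall>a\<in>X. \<Phi> a \<xi>)"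
proof (cases "X = {}")
  case False
  assume X: "countable X" "\<And>a. a \<in> X \<Longrightarrow> determined I (\<Phi> a)"
  have "(\<Inter>a\<in>X. {x \<in> space (coins I). \<Phi> a x}) \<in> sets (coins I)"
    using X determinedD(2) False by (intro sets.countable_INT') auto
  moreover have "(\<Inter>a\<in>X. {x \<in> space (coins I). \<Phi> a x}) = {x \<in> space (coins I). \<forall>a\<in>X. \<Phi> a x}"
    using False by auto
  ultimately show ?thesis
    using determinedD(1)[OF X(2)] by (simp add: determined_def)
qed (auto simp: determined_def)

lemma determined_bex:
  assumes "countable X" "\<And>a. a \<in> X \<Longrightarrow> determined I (\<Phi> a)"
  shows "determined I (\<lambda>\<xi>. \<exists>a\<in>X. \<Phi> a \<xi>)"
  using determined_not[OF determined_ball[OF assms(1) determined_not[OF assms(2)]]] by simp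

lemma determined_const: "determined I (\<lambda>_. b)"
  unfolding determined_def by (cases b) auto

lemma determined_component: "i \<in> I \<Longrightarrow> determined I (\<lambda>\<xi>. \<xi> i)"
proof -
  assume i: "i \<in> I"
  have "(\<lambda>x. x i) -` {True} \<inter> space (coins I) \<in> sets (coins I)"
    by (rule measurable_sets[OF measurable_component_singleton[OF i]]) auto
  moreover have "(\<lambda>x. x i) -` {True} \<inter> space (coins I) = {x \<in> space (coins I). x i}" by auto
  ultimately show ?thesis using i by (auto simp: determined_def)
qed

text \<open>Such a predicate is a finite union of cylinders, one for each satisfying assignment of
  the coins in \<open>F\<close>, so measurability is automatic.\<close>

lemma determined_finite:
  fixes \<Phi> :: "('i \<Rightarrow> bool) \<Rightarrow> bool"
  assumes F: "finite F" "F \<subseteq> I" and dep: "\<And>\<xi> \<xi>'. (\<And>i. i \<in> F \<Longrightarrow> \<xi> i = \<xi>' i) \<Longrightarrow> \<Phi> \<xi> = \<Phi> \<xi>'"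
  shows "determined I \<Phi>"
proof -
  let ?E = "{\<eta> \<in> PiE F (\<lambda>_. UNIV). \<Phi> \<eta>}"
  have "\<Phi> \<xi> \<longleftrightarrow> (\<exists>\<eta>\<in>?E. \<forall>i\<in>F. \<xi> i = \<eta> i)" for \<xi>
  proof
    assume "\<Phi> \<xi>"
    moreover have "\<Phi> (restrict \<xi> F) = \<Phi> \<xi>" by (rule dep) simp
    ultimately have "restrict \<xi> F \<in> ?E" by auto
    then show "\<exists>\<eta>\<in>?E. \<forall>i\<in>F. \<xi> i = \<eta> i" by (rule bexI[rotated]) simp
  next
    assume "\<exists>\<eta>\<in>?E. \<forall>i\<in>F. \<xi> i = \<eta> i"
    then obtain \<eta> where "\<Phi> \<eta>" "\<And>i. i \<in> F \<Longrightarrow> \<xi> i = \<eta> i" by auto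
    then show "\<Phi> \<xi>" using dep[of \<xi> \<eta>] by simp
  qed
  then have eq: "\<Phi> = (\<lambda>\<xi>. \<exists>\<eta>\<in>?E. \<forall>i\<in>F. \<xi> i = \<eta> i)" by (intro ext)
  have "determined I (\<lambda>\<xi>. \<exists>\<eta>\<in>?E. \<forall>i\<in>F. \<xi> i = \<eta> i)"
  proof (rule determined_bex)
    have "finite ?E" using finite_PiE[OF F(1), of "\<lambda>_. UNIV :: bool set"] by simp
    then show "countable ?E" by (rule countable_finite)
  next
    fix \<eta> :: "'i \<Rightarrow> bool"
    have "determined I (\<lambda>\<xi>. \<xi> i = \<eta> i)" if "i \<in> F" for i
      using determined_component[of i I] determined_not[OF determined_component[of i I]] that F
      by (cases "\<eta> i") auto
    then show "determined I (\<lambda>\<xi>. \<forall>i\<in>F. \<xi> i = \<eta> i)"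
      using F by (intro determined_ball countable_finite)
  qed
  then show ?thesis by (subst eq)
qed

text \<open>Reading coordinates through \<open>h\<close> is a measurable map of product spaces. With
  \<open>h\<close> prefixing a word, this covers the events of a subtree.\<close>

lemma determined_reindex:
  assumes "determined I \<Phi>" "h ` I \<subseteq> J"
  shows "determined J (\<lambda>\<xi>. \<Phi> (\<lambda>i. \<xi> (h i)))"
  unfolding determined_def
proof
  show "\<forall>\<xi>. \<Phi> (\<lambda>i. restrict \<xi> J (h i)) = \<Phi> (\<lambda>i. \<xi> (h i))"
    using assms(2) by (intro allI determined_cong[OF assms(1)]) auto
  have m: "(\<lambda>x. \<lambda>i\<in>I. x (h i)) \<in> coins J \<rightarrow>\<^sub>M coins I"
    using assms(2) by (intro measurable_restrict measurable_component_singleton) auto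
  have "{x \<in> space (coins J). \<Phi> (\<lambda>i. x (h i))} =
      (\<lambda>x. \<lambda>i\<in>I. x (h i)) -` {x \<in> space (coins I). \<Phi> x} \<inter> space (coins J)"
    using determinedD(1)[OF assms(1)] measurable_space[OF m] by auto
  also have "\<dots> \<in> sets (coins J)"
    by (rule measurable_sets[OF m determinedD(2)[OF assms(1)]])
  finally show "{x \<in> space (coins J). \<Phi> (\<lambda>i. x (h i))} \<in> sets (coins J)" .
qed

lemma determined_mono: "determined I \<Phi> \<Longrightarrow> I \<subseteq> J \<Longrightarrow> determined J \<Phi>"
  using determined_reindex[of I \<Phi> "\<lambda>i. i" J] by simp

text \<open>The index set of the coins; the root carries no choice, hence no empty word.\<close>

definition tree_words :: "nat \<Rightarrow> ('d::finite) word set"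
  where "tree_words M = (\<Union>n\<in>{1..}. words M n)"

lemma tree_words_iff: "A \<in> tree_words M \<longleftrightarrow> A \<in> words M (length A) \<and> A \<noteq> []"
  by (cases "length A") (auto simp: tree_words_def words_def Suc_le_eq)

lemma append_tree_words: "B \<in> words M m \<Longrightarrow> A \<in> tree_words M \<Longrightarrow> B @ A \<in> tree_words M"
  by (auto simp: tree_words_iff words_def)

lemma determined_below:
  "determined (tree_words M) \<Phi> \<Longrightarrow> B \<in> words M m \<Longrightarrow>
    determined (tree_words M) (\<lambda>\<xi>. \<Phi> (below \<xi> B))"
  unfolding below_def by (rule determined_reindex) (auto simp: append_tree_words)

lemma determined_level:
  fixes \<Phi> :: "(('d::finite) word \<Rightarrow> bool) \<Rightarrow> bool"
  assumes "\<And>\<xi> \<xi>'. (\<And>m. m \<le> n \<Longrightarrow> openings M \<xi> m = openings M \<xi>' m) \<Longrightarrow> \<Phi> \<xi> = \<Phi> \<xi>'"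
    "(\<Union>m\<in>{1..n}. words M m) \<subseteq> I"
  shows "determined I \<Phi>"
proof (rule determined_finite)
  show "finite (\<Union>m\<in>{1..n}. words M m)" by simp
  show "(\<Union>m\<in>{1..n}. words M m) \<subseteq> I" by fact
  fix \<xi> \<xi>' :: "'d word \<Rightarrow> bool"
  assume eq: "\<And>i. i \<in> (\<Union>m\<in>{1..n}. words M m) \<Longrightarrow> \<xi> i = \<xi>' i"
  show "\<Phi> \<xi> = \<Phi> \<xi>'"
  proof (intro assms openings_cong eq)
    fix m and A :: "'d word"
    assume "m \<le> n" "length A \<in> {1..m}" "A \<in> words M (length A)"
    then show "A \<in> (\<Union>m\<in>{1..n}. words M m)" by (intro UN_I[of "length A"]) auto
  qed
qed

lemma determined_openings_level:
  "determined (tree_words M) (\<lambda>\<xi>. Q (openings M \<xi> n))"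
  by (rule determined_level[of n M]) (auto simp: tree_words_def)

section \<open>Independence and self-similarity of the random tree\<close>

locale percolation = prob_space P
  for P :: "'w measure"
    and M :: nat
    and p :: "nat ^ 'd::finite \<Rightarrow> real"
    and c :: "'d word \<Rightarrow> 'w \<Rightarrow> bool" +
  assumes M_ge_2: "M \<ge> 2"
    and p_bounds: "\<And>C. C \<in> digits M \<Longrightarrow> 0 < p C \<and> p C < 1"
    and choices: "percolation_choices P M p c"
begin

lemma M_ge_1: "M \<ge> 1" using M_ge_2 by simp

definition tree_prob :: "(('d word \<Rightarrow> bool) \<Rightarrow> bool) \<Rightarrow> real"
  where "tree_prob \<Phi> = prob {\<omega> \<in> space P. \<Phi> (\<lambda>A. c A \<omega>)}"

lemma indep: "indep_vars (\<lambda>_. count_space UNIV) c (tree_words M)"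
  using choices by (simp add: percolation_choices_def tree_words_def)

lemma rv: "A \<in> tree_words M \<Longrightarrow> c A \<in> P \<rightarrow>\<^sub>M count_space UNIV"
  using indep by (auto simp: indep_vars_def2)

lemma prob_open:
  assumes "A \<in> tree_words M"
  shows "prob {\<omega> \<in> space P. c A \<omega>} = p (last A)"
proof -
  have "A = butlast A @ [last A]" "butlast A \<in> words M (length A - 1)" "last A \<in> digits M"
    using assms by (auto simp: tree_words_iff words_def dest: in_set_butlastD)
  then have "prob {\<omega> \<in> space P. c (butlast A @ [last A]) \<omega>} = p (last A)"
    using choices unfolding percolation_choices_def by blast
  then show ?thesis unfolding \<open>A = butlast A @ [last A]\<close>[symmetric] .
qed

lemma measurable_restrict_choices:
  "I \<subseteq> tree_words M \<Longrightarrow> (\<lambda>\<omega>. restrict (\<lambda>A. c A \<omega>) I) \<in> P \<rightarrow>\<^sub>M coins I"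
  using rv by (intro measurable_restrict) auto

lemma determined_vimage:
  assumes "determined I \<Phi>"
  shows "{\<omega> \<in> space P. \<Phi> (\<lambda>A. c A \<omega>)} =
    (\<lambda>\<omega>. restrict (\<lambda>A. c A \<omega>) I) -` {x \<in> space (coins I). \<Phi> x} \<inter> space P"
  using determinedD(1)[OF assms] by (auto simp: space_PiM)

lemma determined_event:
  assumes "determined I \<Phi>" "I \<subseteq> tree_words M"
  shows "{\<omega> \<in> space P. \<Phi> (\<lambda>A. c A \<omega>)} \<in> events"
  unfolding determined_vimage[OF assms(1)]
  by (rule measurable_sets[OF measurable_restrict_choices[OF assms(2)] determinedD(2)[OF assms(1)]])

text \<open>Restrictions to disjoint blocks of coins are independent random elements, and each event
  is a preimage under the restriction to its own block.\<close>

lemma determined_block_prob: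
  assumes "finite L" "L \<noteq> {}" "disjoint_family_on K L"
    "\<And>j. j \<in> L \<Longrightarrow> K j \<subseteq> tree_words M" "\<And>j. j \<in> L \<Longrightarrow> determined (K j) (\<Phi> j)"
  shows "tree_prob (\<lambda>\<xi>. \<forall>j\<in>L. \<Phi> j \<xi>) = (\<Prod>j\<in>L. tree_prob (\<Phi> j))"
proof -
  let ?X = "\<lambda>j \<omega>. restrict (\<lambda>A. c A \<omega>) (K j)"
  let ?A = "\<lambda>j. {x \<in> space (coins (K j)). \<Phi> j x}"
  have ind: "indep_vars (\<lambda>j. coins (K j)) ?X L"
    by (rule indep_vars_restrict[OF indep assms(4,3)])
  have "prob (\<Inter>j\<in>L. ?X j -` ?A j \<inter> space P) = (\<Prod>j\<in>L. prob (?X j -` ?A j \<inter> space P))"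
    by (rule indep_varsD_finite[OF ind assms(2,1)]) (rule determinedD(2)[OF assms(5)])
  moreover have "?X j -` ?A j \<inter> space P = {\<omega> \<in> space P. \<Phi> j (\<lambda>A. c A \<omega>)}" if "j \<in> L" for j
    by (rule determined_vimage[OF assms(5)[OF that], symmetric])
  moreover have "(\<Inter>j\<in>L. {\<omega> \<in> space P. \<Phi> j (\<lambda>A. c A \<omega>)}) =
      {\<omega> \<in> space P. \<forall>j\<in>L. \<Phi> j (\<lambda>A. c A \<omega>)}"
    using assms(2) by auto
  ultimately show ?thesis unfolding tree_prob_def by (metis (mono_tags, lifting) INF_cong prod.cong)
qed

text \<open>Prefixing by \<open>B\<close> is injective, so the shifted coins are again independent,
  and a retention probability depends on the last digit only.\<close>

lemma percolation_below:
  assumes "B \<in> words M m"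
  shows "percolation P M p (below c B)"
proof
  show "M \<ge> 2" "\<And>C. C \<in> digits M \<Longrightarrow> 0 < p C \<and> p C < 1" by (fact M_ge_2, fact p_bounds)
  let ?K = "\<lambda>A. {B @ A}"
  have "indep_vars (\<lambda>A. coins (?K A)) (\<lambda>A \<omega>. restrict (\<lambda>A. c A \<omega>) (?K A)) (tree_words M)"
    using append_tree_words[OF assms]
    by (intro indep_vars_restrict[OF indep]) (auto simp: disjoint_family_on_def)
  then have "indep_vars (\<lambda>_. count_space UNIV)
      (\<lambda>A \<omega>. (\<lambda>x. x (B @ A)) (restrict (\<lambda>A. c A \<omega>) (?K A))) (tree_words M)"
    by (rule indep_vars_compose2) (auto intro: measurable_component_singleton)
  then have "indep_vars (\<lambda>_. count_space UNIV) (below c B) (tree_words M)"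
    by (simp add: below_def)
  moreover have "prob {\<omega> \<in> space P. below c B (A @ [C]) \<omega>} = p C"
    if "A \<in> words M n" "C \<in> digits M" for A C n
    using prob_open[of "B @ A @ [C]"] that assms
    by (simp add: below_def tree_words_iff) (auto simp: words_def)
  ultimately show "percolation_choices P M p (below c B)"
    using prob_space_axioms by (auto simp: percolation_choices_def tree_words_def)
qed

text \<open>The right-hand side mentions \<open>M\<close> and \<open>p\<close> but not
  \<open>c\<close>, so all families of choices with these parameters give the same probabilities.
  Comparing \<open>c\<close> with \<open>below c B\<close> yields self-similarity.\<close>

lemma tree_prob_eq_product_measure:
  assumes "determined (tree_words M) \<Phi>"
  shows "tree_prob \<Phi> =
    measure (PiM (tree_words M) (\<lambda>A. measure_pmf (bernoulli_pmf (p (last A)))))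
      {x \<in> space (coins (tree_words M)). \<Phi> x}"
proof -
  let ?I = "tree_words M :: 'd word set"
  have ne: "?I \<noteq> {}"
  proof -
    obtain C :: "nat ^ 'd" where "C \<in> digits M" using digits_nonempty[OF M_ge_1] by blast
    then have "[C] \<in> ?I" by (simp add: tree_words_iff words_1)
    then show ?thesis by blast
  qed
  have *: "distr P (count_space UNIV) (c A) = measure_pmf (bernoulli_pmf (p (last A)))"
    if A: "A \<in> ?I" for A
  proof (rule measure_eqI)
    interpret D: prob_space "distr P (count_space UNIV) (c A)"
      by (rule prob_space_distr[OF rv[OF A]])
    have p01: "p (last A) \<in> {0..1}"
    proof -
      have "last A \<in> digits M" using A by (auto simp: tree_words_iff words_def)
      then show ?thesis using p_bounds less_imp_le by auto
    qed
    have v: "c A -` {True} \<inter> space P = {\<omega> \<in> space P. c A \<omega>}" by auto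
    have t: "D.prob {True} = p (last A)"
      using measure_distr[OF rv[OF A], of "{True}"] prob_open[OF A] by (simp add: v)
    have f: "D.prob {False} = 1 - p (last A)"
    proof -
      have "{False} = space (distr P (count_space UNIV) (c A)) - {True}" by (auto simp: space_distr)
      then show ?thesis using D.prob_compl[of "{True}"] t by simp
    qed
    show "emeasure (distr P (count_space UNIV) (c A)) X = emeasure (measure_pmf (bernoulli_pmf (p (last A)))) X"
      if "X \<in> sets (distr P (count_space UNIV) (c A))" for X
    proof -
      have "D.prob X = (\<Sum>b\<in>X. D.prob {b})"
        by (rule D.finite_measure_eq_sum_singleton) auto
      moreover have "measure_pmf.prob (bernoulli_pmf (p (last A))) X =
          (\<Sum>b\<in>X. pmf (bernoulli_pmf (p (last A))) b)"
        by (rule measure_measure_pmf_finite) simp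
      moreover have "D.prob {b} = pmf (bernoulli_pmf (p (last A))) b" for b
        using t f p01 by (cases b) auto
      ultimately show ?thesis
        by (simp add: D.emeasure_eq_measure measure_pmf.emeasure_eq_measure)
    qed
  qed simp
  have "distr P (coins ?I) (\<lambda>\<omega>. \<lambda>A\<in>?I. c A \<omega>) =
      PiM ?I (\<lambda>A. distr P (count_space UNIV) (c A))"
  proof -
    \<comment> \<open>Off the index set \<open>c A\<close> may fail to be measurable; a constant
      there makes every component a random variable without affecting the joint law.\<close>
    define X where "X A = (if A \<in> ?I then c A else (\<lambda>_. True))" for A
    have "indep_vars (\<lambda>_. count_space UNIV) X ?I \<longleftrightarrow> indep_vars (\<lambda>_. count_space UNIV) c ?I"
      by (rule indep_vars_cong) (auto simp: X_def)
    moreover have "random_variable (count_space UNIV) (X A)" for A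
      using rv by (auto simp: X_def)
    ultimately have "distr P (coins ?I) (\<lambda>\<omega>. \<lambda>A\<in>?I. X A \<omega>) =
        PiM ?I (\<lambda>A. distr P (count_space UNIV) (X A))"
      using indep_vars_iff_distr_eq_PiM[OF ne, where X = X and M' = "\<lambda>_. count_space UNIV"] indep
      by auto
    moreover have "(\<lambda>\<omega>. \<lambda>A\<in>?I. X A \<omega>) = (\<lambda>\<omega>. \<lambda>A\<in>?I. c A \<omega>)"
      by (auto simp: X_def restrict_def fun_eq_iff)
    moreover have "PiM ?I (\<lambda>A. distr P (count_space UNIV) (X A)) =
        PiM ?I (\<lambda>A. distr P (count_space UNIV) (c A))"
      by (rule PiM_cong) (auto simp: X_def)
    ultimately show ?thesis by simp
  qed
  also have "\<dots> = PiM ?I (\<lambda>A. measure_pmf (bernoulli_pmf (p (last A))))"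
    by (rule PiM_cong) (use * in auto)
  finally have d: "distr P (coins ?I) (\<lambda>\<omega>. \<lambda>A\<in>?I. c A \<omega>) =
      PiM ?I (\<lambda>A. measure_pmf (bernoulli_pmf (p (last A))))" .
  show ?thesis
    unfolding tree_prob_def determined_vimage[OF assms] d[symmetric]
    by (rule measure_distr[symmetric, OF measurable_restrict_choices determinedD(2)[OF assms]]) simp
qed

end

lemma (in percolation) tree_prob_below:
  assumes "B \<in> words M m" "determined (tree_words M) \<Phi>"
  shows "tree_prob (\<lambda>\<xi>. \<Phi> (below \<xi> B)) = tree_prob \<Phi>"
proof -
  interpret b: percolation P M p "below c B" by (rule percolation_below[OF assms(1)])
  have "tree_prob (\<lambda>\<xi>. \<Phi> (below \<xi> B)) = b.tree_prob \<Phi>"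
    unfolding tree_prob_def b.tree_prob_def by (simp add: below_def)
  then show ?thesis
    using tree_prob_eq_product_measure[OF assms(2)] b.tree_prob_eq_product_measure[OF assms(2)] by simp
qed

section \<open>Large deviations of the offspring\<close>

lemma borel_measurable_finite_coins:
  fixes f :: "('i \<Rightarrow> bool) \<Rightarrow> real"
  assumes "finite K" "\<And>\<xi> \<xi>'. (\<And>i. i \<in> K \<Longrightarrow> \<xi> i = \<xi>' i) \<Longrightarrow> f \<xi> = f \<xi>'"
  shows "f \<in> borel_measurable (coins K)"
proof (rule measurableI)
  fix X :: "real set"
  have "determined K (\<lambda>\<xi>. f \<xi> \<in> X)"
  proof (rule determined_finite[OF assms(1) order_refl])
    fix \<xi> \<xi>' :: "'i \<Rightarrow> bool" assume "\<And>i. i \<in> K \<Longrightarrow> \<xi> i = \<xi>' i"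
    then show "(f \<xi> \<in> X) = (f \<xi>' \<in> X)" using assms(2)[of \<xi> \<xi>'] by simp
  qed
  then have "{x \<in> space (coins K). f x \<in> X} \<in> sets (coins K)" by (rule determinedD)
  then show "f -` X \<inter> space (coins K) \<in> sets (coins K)"
    by (rule back_subst[of "\<lambda>Y. Y \<in> sets (coins K)"]) auto
qed simp

text \<open>The slope 4/5 is that of the chord of 1/(1 + y) over [0, 1/4]. What matters is that it
  exceeds 3/4: twice the slope then beats the threshold 3/2 of the Chernoff bound.\<close>

lemma exp_minus_le_chord:
  assumes "0 \<le> y" "y \<le> 1 / 4"
  shows "exp (- y) \<le> 1 - 4 / 5 * (y::real)"
proof -
  have "exp (- y) \<le> 1 / (1 + y)"
    using exp_ge_add_one_self[of y] assms by (simp add: exp_minus field_simps)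
  also have "\<dots> \<le> 1 - 4 / 5 * y"
  proof -
    have "0 \<le> y * (1 / 4 - y)" using assms by simp
    then show ?thesis using assms by (simp add: field_simps)
  qed
  finally show ?thesis .
qed

context percolation
begin

lemma tree_prob_nonneg [simp]: "0 \<le> tree_prob \<Phi>"
  by (simp add: tree_prob_def)

lemma tree_prob_le_1 [simp]: "tree_prob \<Phi> \<le> 1"
  by (simp add: tree_prob_def)

lemma tree_prob_mono:
  assumes "determined (tree_words M) \<Psi>" "\<And>\<xi>. \<Phi> \<xi> \<Longrightarrow> \<Psi> \<xi>"
  shows "tree_prob \<Phi> \<le> tree_prob \<Psi>"
  unfolding tree_prob_def
  by (rule finite_measure_mono) (use assms determined_event in auto)

lemma tree_prob_not:
  assumes "determined (tree_words M) \<Phi>"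
  shows "tree_prob (\<lambda>\<xi>. \<not> \<Phi> \<xi>) = 1 - tree_prob \<Phi>"
  unfolding tree_prob_def by (rule prob_neg) (use determined_event[OF assms] in auto)

lemma tree_prob_split:
  assumes "determined (tree_words M) \<Phi>" "determined (tree_words M) \<Psi>"
  shows "tree_prob \<Phi> = tree_prob (\<lambda>\<xi>. \<Phi> \<xi> \<and> \<Psi> \<xi>) + tree_prob (\<lambda>\<xi>. \<Phi> \<xi> \<and> \<not> \<Psi> \<xi>)"
proof -
  have "{\<omega> \<in> space P. \<Phi> (\<lambda>A. c A \<omega>)} =
      {\<omega> \<in> space P. \<Phi> (\<lambda>A. c A \<omega>) \<and> \<Psi> (\<lambda>A. c A \<omega>)} \<union>
      {\<omega> \<in> space P. \<Phi> (\<lambda>A. c A \<omega>) \<and> \<not> \<Psi> (\<lambda>A. c A \<omega>)}"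
    by auto
  then show ?thesis unfolding tree_prob_def
    using determined_event[OF determined_conj[OF assms]]
      determined_event[OF determined_conj[OF assms(1) determined_not[OF assms(2)]]]
    by (subst finite_measure_Union[symmetric]) auto
qed

text \<open>The coin at \<open>[C]\<close> and the coins strictly below it form disjoint blocks, and
  the subtree has the law of the whole tree.\<close>

lemma tree_prob_child:
  assumes "C \<in> digits M" "determined (tree_words M) \<Phi>"
  shows "tree_prob (\<lambda>\<xi>. \<xi> [C] \<and> \<Phi> (below \<xi> [C])) = p C * tree_prob \<Phi>"
proof -
  define K where "K b = (if b then {[C]} else (\<lambda>A. C # A) ` tree_words M)" for b
  define \<Theta> :: "bool \<Rightarrow> ('d word \<Rightarrow> bool) \<Rightarrow> bool"
    where "\<Theta> b = (if b then (\<lambda>\<xi>. \<xi> [C]) else (\<lambda>\<xi>. \<Phi> (below \<xi> [C])))" for b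
  have C: "[C] \<in> words M 1" using assms(1) by (simp add: words_1)
  have "tree_prob (\<lambda>\<xi>. \<forall>b\<in>{True, False}. \<Theta> b \<xi>) = (\<Prod>b\<in>{True, False}. tree_prob (\<Theta> b))"
  proof (rule determined_block_prob[where K = K])
    show "disjoint_family_on K {True, False}"
      by (auto simp: disjoint_family_on_def K_def tree_words_iff)
    show "K b \<subseteq> tree_words M" for b
      using C append_tree_words[OF C] by (auto simp: K_def tree_words_iff)
    have "determined ((\<lambda>A. C # A) ` tree_words M) (\<lambda>\<xi>. \<Phi> (below \<xi> [C]))"
      unfolding below_def by (rule determined_reindex[OF assms(2)]) auto
    then show "determined (K b) (\<Theta> b)" for b
      using determined_component[of "[C]" "{[C]}"] by (auto simp: K_def \<Theta>_def)
  qed auto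
  moreover have "tree_prob (\<lambda>\<xi>. \<xi> [C]) = p C"
    using prob_open[of "[C]"] C by (simp add: tree_prob_def tree_words_iff)
  ultimately show ?thesis
    using tree_prob_below[OF C assms(2)] by (simp add: \<Theta>_def ex_bool_eq)
qed

text \<open>\<open>\<Theta>\<close> expresses that \<open>\<Psi> C\<close> reads only the coin of
  \<open>C\<close> and the subtree below it, which are disjoint blocks for different
  \<open>C\<close>. Having the outcome of the coin as an argument lets conjunctions and implications
  be treated alike.\<close>

lemma tree_prob_children:
  assumes "\<And>C. C \<in> digits M \<Longrightarrow> determined (tree_words M) (\<Psi> C)"
    "\<And>C b. C \<in> digits M \<Longrightarrow> determined (tree_words M) (\<Theta> C b)"
    "\<And>C \<xi>. C \<in> digits M \<Longrightarrow> \<Psi> C \<xi> \<longleftrightarrow> \<Theta> C (\<xi> [C]) (below \<xi> [C])"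
  shows "tree_prob (\<lambda>\<xi>. \<forall>C\<in>digits M. \<Psi> C \<xi>) = (\<Prod>C\<in>digits M. tree_prob (\<Psi> C))"
proof (rule determined_block_prob)
  let ?K = "\<lambda>C. insert [C] ((\<lambda>A. C # A) ` tree_words M)"
  show "digits M \<noteq> ({} :: (nat ^ 'd) set)" by (rule digits_nonempty[OF M_ge_1])
  show "disjoint_family_on ?K (digits M)" by (auto simp: disjoint_family_on_def)
  fix C :: "nat ^ 'd" assume C: "C \<in> digits M"
  then show "?K C \<subseteq> tree_words M"
    using append_tree_words[of "[C]" M 1] by (auto simp: tree_words_iff words_1)
  have "determined (?K C) (\<lambda>\<xi>. \<Theta> C b (below \<xi> [C]))" for b
    unfolding below_def by (rule determined_reindex[OF assms(2)[OF C]]) auto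
  moreover have "determined (?K C) (\<lambda>\<xi>. \<xi> [C])" by (rule determined_component) simp
  ultimately have "determined (?K C) (\<lambda>\<xi>. \<xi> [C] \<and> \<Theta> C True (below \<xi> [C]) \<or>
      \<not> \<xi> [C] \<and> \<Theta> C False (below \<xi> [C]))"
    by (intro determined_disj determined_conj determined_not)
  moreover have "\<Psi> C = (\<lambda>\<xi>. \<xi> [C] \<and> \<Theta> C True (below \<xi> [C]) \<or>
      \<not> \<xi> [C] \<and> \<Theta> C False (below \<xi> [C]))"
    using assms(3)[OF C] by (intro ext) (metis (full_types))
  ultimately show "determined (?K C) (\<Psi> C)" by simp
qed simp

lemma tree_prob_word_open:
  assumes "A \<in> words M n"
  shows "tree_prob (\<lambda>\<xi>. A \<in> openings M \<xi> n) = prod_list (map p A)"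
  using assms
proof (induction A arbitrary: n)
  case Nil
  then show ?case by (auto simp: words_def tree_prob_def prob_space)
next
  case (Cons C A)
  then obtain m where n: "n = Suc m" "A \<in> words M m" "C \<in> digits M" by (auto simp: words_def)
  have "C # A \<in> openings M \<xi> n \<longleftrightarrow> \<xi> [C] \<and> A \<in> openings M (below \<xi> [C]) m" for \<xi>
    using openings_append[of "[C]" M "Suc 0" A m \<xi>] n by (simp add: words_1 openings_1)
  then show ?case
    using tree_prob_child[OF n(3) determined_openings_level, of "\<lambda>X. A \<in> X" m] Cons.IH[OF n(2)]
    by simp
qed

lemma expectation_of_bool:
  assumes "determined (tree_words M) \<Phi>"
  shows "expectation (\<lambda>\<omega>. of_bool (\<Phi> (\<lambda>A. c A \<omega>)) :: real) = tree_prob \<Phi>"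
proof -
  let ?X = "{\<omega> \<in> space P. \<Phi> (\<lambda>A. c A \<omega>)}"
  have "?X \<in> events" by (rule determined_event[OF assms]) simp
  have "expectation (\<lambda>\<omega>. of_bool (\<Phi> (\<lambda>A. c A \<omega>)) :: real) = expectation (indicator ?X)"
    by (rule Bochner_Integration.integral_cong) (auto simp: indicator_def)
  then show ?thesis using \<open>?X \<in> events\<close> by (simp add: tree_prob_def)
qed

lemma integrable_of_bool:
  assumes "determined (tree_words M) \<Phi>"
  shows "integrable P (\<lambda>\<omega>. of_bool (\<Phi> (\<lambda>A. c A \<omega>)) :: real)"
proof -
  let ?X = "{\<omega> \<in> space P. \<Phi> (\<lambda>A. c A \<omega>)}"
  have "?X \<in> events" by (rule determined_event[OF assms]) simp
  then have "integrable P (indicator ?X :: _ \<Rightarrow> real)" by (intro integrable_real_indicator) (auto simp: emeasure_eq_measure)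
  then show ?thesis
    by (rule Bochner_Integration.integrable_cong[THEN iffD1, rotated -1]) (auto simp: indicator_def)
qed

text \<open>The choice of \<open>l\<close> keeps \<open>l\<close> times the number of retained words
  at most 1/4, where the linear bound on the exponential holds; in the mean it leaves at most 1 -
  4/5 * 2 * l.\<close>

lemma expectation_exp_offspring:
  assumes H: "H \<subseteq> words M r" "2 \<le> (\<Sum>B\<in>H. prod_list (map p B))" and A: "A \<in> words M N"
    and l: "l = 1 / (4 * real (card (words M r :: 'd word set)))"
  shows "expectation (\<lambda>\<omega>. exp (- l * real (card (H \<inter> openings M (below (\<lambda>A. c A \<omega>) A) r))))
    \<le> exp (- 8 / 5 * l)"
proof -
  define W where "W = real (card (words M r :: 'd word set))"
  have fH: "finite H" using H(1) finite_subset by blast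
  have "card (words M r :: 'd word set) > 0"
    using H(2) H(1) by (intro card_gt_0_iff[THEN iffD2] conjI finite_words) auto
  then have W: "W > 0" by (simp add: W_def)
  have l': "l = 1 / (4 * W)" "l > 0" using W by (auto simp: l W_def)
  define X where "X \<omega> = real (card (H \<inter> openings M (below (\<lambda>A. c A \<omega>) A) r))" for \<omega>
  define Y where "Y B \<omega> = (of_bool (B \<in> openings M (below (\<lambda>A. c A \<omega>) A) r) :: real)" for B \<omega>
  have det: "determined (tree_words M) (\<lambda>\<xi>. Q (openings M (below \<xi> A) r))" for Q
    by (rule determined_below[OF determined_openings_level A])
  have XY: "X \<omega> = (\<Sum>B\<in>H. Y B \<omega>)" for \<omega>
    using fH by (simp add: X_def Y_def of_bool_def sum.If_cases Int_def)
  have Yi: "integrable P (Y B)" for B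
    unfolding Y_def by (rule integrable_of_bool[OF det])
  have EY: "expectation (Y B) = prod_list (map p B)" if "B \<in> H" for B
    unfolding Y_def
    by (subst expectation_of_bool[OF det], subst tree_prob_below[OF A determined_openings_level],
        rule tree_prob_word_open) (use that H in auto)
  have EX: "expectation X \<ge> 2" and Xi: "integrable P X"
    unfolding XY[abs_def] using H(2) EY Yi by (auto simp: Bochner_Integration.integral_sum)
  have XW: "0 \<le> X \<omega>" "X \<omega> \<le> W" for \<omega>
    using card_mono[of "words M r" "H \<inter> openings M (below (\<lambda>A. c A \<omega>) A) r"] H(1)
    by (auto simp: X_def W_def)
  have pw: "exp (- l * X \<omega>) \<le> 1 - 4 / 5 * (l * X \<omega>)" for \<omega>
  proof -
    have "l * X \<omega> \<le> 1 / 4" using XW[of \<omega>] W by (simp add: l' field_simps)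
    then show ?thesis using exp_minus_le_chord[of "l * X \<omega>"] XW[of \<omega>] l'(2) by simp
  qed
  have mX: "X \<in> borel_measurable P" using Xi by auto
  have ei: "integrable P (\<lambda>\<omega>. exp (- l * X \<omega>))"
  proof (rule integrable_const_bound[where B = 1])
    show "AE \<omega> in P. norm (exp (- l * X \<omega>)) \<le> 1" using l' XW(1) by simp
  qed (use mX in measurable)
  have "expectation (\<lambda>\<omega>. exp (- l * X \<omega>)) \<le> expectation (\<lambda>\<omega>. 1 - 4 / 5 * (l * X \<omega>))"
    using pw ei Xi by (intro integral_mono) auto
  also have "\<dots> = 1 - 4 / 5 * (l * expectation X)" using Xi by (simp add: prob_space)
  also have "\<dots> \<le> 1 - 8 / 5 * l" using mult_left_mono[OF EX less_imp_le[OF l'(2)]] by linarith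
  also have "\<dots> \<le> exp (- 8 / 5 * l)" using exp_ge_add_one_self[of "- 8 / 5 * l"] by simp
  finally show ?thesis by (simp add: X_def)
qed

text \<open>Chernoff bound, conditionally on the first \<open>N\<close> generations.\<close>

lemma offspring_large_deviation:
  assumes \<Phi>: "determined (\<Union>m\<in>{1..N}. words M m) \<Phi>"
    and S: "S \<subseteq> words M N"
    and H: "\<And>A. A \<in> S \<Longrightarrow> H A \<subseteq> words M r"
      "\<And>A. A \<in> S \<Longrightarrow> 2 \<le> (\<Sum>B\<in>H A. prod_list (map p B))"
  shows "tree_prob (\<lambda>\<xi>. \<Phi> \<xi> \<and> real (\<Sum>A\<in>S. card (H A \<inter> openings M (below \<xi> A) r)) < 3 / 2 * real (card S))
    \<le> tree_prob \<Phi> * exp (- real (card S) / (40 * real (card (words M r :: 'd word set))))"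
proof -
  define l where "l = 1 / (4 * real (card (words M r :: 'd word set)))"
  have l: "l \<ge> 0" by (simp add: l_def)
  have fS: "finite S" using S finite_subset by blast
  define X where "X A \<xi> = real (card (H A \<inter> openings M (below \<xi> A) r))" for A \<xi>
  \<comment> \<open>\<open>None\<close> stands for the past up to level N, \<open>Some A\<close> for
    the first r generations below \<open>A\<close>. These blocks are disjoint, so conditioning on
    \<Phi> becomes a product of expectations.\<close>
  define K where "K j = (case j of None \<Rightarrow> (\<Union>m\<in>{1..N}. words M m)
      | Some A \<Rightarrow> (\<lambda>B. A @ B) ` (\<Union>m\<in>{1..r}. words M m))" for j :: "'d word option"
  define g where "g j = (case j of None \<Rightarrow> (\<lambda>\<xi>. of_bool (\<Phi> \<xi>)) | Some A \<Rightarrow> (\<lambda>\<xi>. exp (- l * X A \<xi>)))"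
    for j
  define L where "L = insert None (Some ` S)"
  have finL: "finite L" using fS by (simp add: L_def)
  have gdep: "g j \<xi> = g j \<xi>'" if eq: "\<And>i. i \<in> K j \<Longrightarrow> \<xi> i = \<xi>' i" for j \<xi> \<xi>'
  proof (cases j)
    case None
    then show ?thesis using eq determined_cong[OF \<Phi>, of \<xi> \<xi>'] by (simp add: g_def K_def)
  next
    case (Some A)
    have "openings M (below \<xi> A) r = openings M (below \<xi>' A) r"
    proof (rule openings_cong)
      fix B :: "'d word" assume "length B \<in> {1..r}" "B \<in> words M (length B)"
      then have "A @ B \<in> K j" by (force simp: K_def Some)
      then show "below \<xi> A B = below \<xi>' A B" using eq by (simp add: below_def)
    qed
    then show ?thesis by (simp add: g_def Some X_def)
  qed
  have Ksub: "K j \<subseteq> tree_words M" if "j \<in> L" for j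
  proof (cases j)
    case None
    then show ?thesis by (auto simp: K_def tree_words_def)
  next
    case (Some A)
    then have "A \<in> words M N" using that S by (auto simp: L_def)
    moreover have "B \<in> tree_words M" if "B \<in> words M m" "m \<in> {1..r}" for B :: "'d word" and m
      using that by (auto simp: tree_words_def)
    ultimately show ?thesis using append_tree_words[of A M N] by (auto simp: K_def Some)
  qed
  have disj: "disjoint_family_on K L"
  proof (unfold disjoint_family_on_def, intro ballI impI)
    have *: "K None \<inter> K (Some A) = {}" if "A \<in> S" for A
      using that S by (auto simp: K_def words_def)
    have **: "K (Some A) \<inter> K (Some A') = {}" if "A \<in> S" "A' \<in> S" "A \<noteq> A'" for A A'
      using that S by (auto simp: K_def words_def subset_iff append_eq_append_conv)
    fix i j assume ij: "i \<in> L" "j \<in> L" "i \<noteq> j"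
    show "K i \<inter> K j = {}"
    proof (cases "i = None \<or> j = None")
      case True
      then show ?thesis using * ij by (auto simp: L_def Int_commute)
    next
      case False
      then obtain A A' where "i = Some A" "j = Some A'" "A \<in> S" "A' \<in> S" "A \<noteq> A'"
        using ij by (auto simp: L_def)
      then show ?thesis using **[of A A'] by simp
    qed
  qed
  have gm: "g j \<in> borel_measurable (coins (K j))" for j
    by (rule borel_measurable_finite_coins[OF _ gdep]) (auto simp: K_def split: option.splits)
  have gr: "g j (restrict \<xi> (K j)) = g j \<xi>" for j \<xi> by (rule gdep) simp
  have "indep_vars (\<lambda>j. coins (K j)) (\<lambda>j \<omega>. restrict (\<lambda>A. c A \<omega>) (K j)) L"
    by (rule indep_vars_restrict[OF indep Ksub disj])
  then have "indep_vars (\<lambda>_. borel) (\<lambda>j \<omega>. g j (restrict (\<lambda>A. c A \<omega>) (K j))) L"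
    by (rule indep_vars_compose2) (rule gm)
  then have ind: "indep_vars (\<lambda>_. borel) (\<lambda>j \<omega>. g j (\<lambda>A. c A \<omega>)) L" by (simp add: gr)
  have gbd: "0 \<le> g j \<xi>" "g j \<xi> \<le> 1" for j \<xi>
    using l by (auto simp: g_def X_def split: option.splits)
  have gi: "integrable P (\<lambda>\<omega>. g j (\<lambda>A. c A \<omega>))" if "j \<in> L" for j
  proof (rule integrable_const_bound[where B = 1])
    show "AE \<omega> in P. norm (g j (\<lambda>A. c A \<omega>)) \<le> 1" using gbd by simp
    show "random_variable borel (\<lambda>\<omega>. g j (\<lambda>A. c A \<omega>))"
      using ind that by (auto simp: indep_vars_def2)
  qed
  have prodL: "(\<Prod>j\<in>L. f j) = f None * (\<Prod>A\<in>S. f (Some A))" for f :: "_ \<Rightarrow> real"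
    using fS by (simp add: L_def prod.reindex)
  have pi: "integrable P (\<lambda>\<omega>. \<Prod>j\<in>L. g j (\<lambda>A. c A \<omega>))"
    by (rule indep_vars_integrable[OF finL ind gi])
  have \<Phi>': "determined (tree_words M) \<Phi>"
    by (rule determined_mono[OF \<Phi>]) (auto simp: tree_words_def)
  have Eprod: "expectation (\<lambda>\<omega>. \<Prod>j\<in>L. g j (\<lambda>A. c A \<omega>)) =
      tree_prob \<Phi> * (\<Prod>A\<in>S. expectation (\<lambda>\<omega>. exp (- l * X A (\<lambda>A. c A \<omega>))))"
    using indep_vars_lebesgue_integral[OF finL ind gi] expectation_of_bool[OF \<Phi>']
    by (simp add: prodL g_def)
  define D where "D \<xi> \<longleftrightarrow> \<Phi> \<xi> \<and> (\<Sum>A\<in>S. X A \<xi>) < 3 / 2 * real (card S)" for \<xi>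
  have detD: "determined (tree_words M) D"
    unfolding D_def
  proof (rule determined_conj[OF \<Phi>'])
    show "determined (tree_words M) (\<lambda>\<xi>. (\<Sum>A\<in>S. X A \<xi>) < 3 / 2 * real (card S))"
    proof (rule determined_finite)
      show "finite (\<Union>j\<in>Some ` S. K j)" using fS by (auto simp: K_def)
      show "(\<Union>j\<in>Some ` S. K j) \<subseteq> tree_words M" using Ksub by (auto simp: L_def)
      fix \<xi> \<xi>' :: "'d word \<Rightarrow> bool"
      assume eq: "\<And>i. i \<in> (\<Union>j\<in>Some ` S. K j) \<Longrightarrow> \<xi> i = \<xi>' i"
      have "X A \<xi> = X A \<xi>'" if A: "A \<in> S" for A
      proof -
        have "openings M (below \<xi> A) r = openings M (below \<xi>' A) r"
        proof (rule openings_cong)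
          fix B :: "'d word" assume "length B \<in> {1..r}" "B \<in> words M (length B)"
          then have "A @ B \<in> K (Some A)" by (force simp: K_def)
          then show "below \<xi> A B = below \<xi>' A B" using eq A by (auto simp: below_def)
        qed
        then show ?thesis by (simp add: X_def)
      qed
      then show "((\<Sum>A\<in>S. X A \<xi>) < 3 / 2 * real (card S)) = ((\<Sum>A\<in>S. X A \<xi>') < 3 / 2 * real (card S))"
        by simp
    qed
  qed
  \<comment> \<open>The exponential Markov inequality, pointwise: on \<open>D\<close> the total
    exponent is nonnegative, and elsewhere the left-hand side is 0.\<close>
  have pw: "of_bool (D \<xi>) \<le> exp (3 / 2 * l * card S) * (\<Prod>j\<in>L. g j \<xi>)" for \<xi>
  proof (cases "D \<xi>")
    case True
    have "(\<Prod>j\<in>L. g j \<xi>) = exp (- l * (\<Sum>A\<in>S. X A \<xi>))"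
      using True by (simp add: prodL g_def D_def exp_sum[OF fS, symmetric] sum_distrib_left sum_negf)
    then have "exp (3 / 2 * l * card S) * (\<Prod>j\<in>L. g j \<xi>) = exp (l * (3 / 2 * card S - (\<Sum>A\<in>S. X A \<xi>)))"
      by (simp add: exp_add[symmetric] algebra_simps)
    moreover have "0 \<le> l * (3 / 2 * card S - (\<Sum>A\<in>S. X A \<xi>))"
      using l True by (intro mult_nonneg_nonneg) (auto simp: D_def)
    ultimately show ?thesis using True by simp
  qed (use gbd in \<open>simp add: prod_nonneg\<close>)
  have "tree_prob D = expectation (\<lambda>\<omega>. of_bool (D (\<lambda>A. c A \<omega>)))"
    by (rule expectation_of_bool[OF detD, symmetric])
  also have "\<dots> \<le> expectation (\<lambda>\<omega>. exp (3 / 2 * l * card S) * (\<Prod>j\<in>L. g j (\<lambda>A. c A \<omega>)))"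
    using pw pi by (intro integral_mono integrable_of_bool[OF detD]) auto
  also have "\<dots> = exp (3 / 2 * l * card S) *
      (tree_prob \<Phi> * (\<Prod>A\<in>S. expectation (\<lambda>\<omega>. exp (- l * X A (\<lambda>A. c A \<omega>)))))"
    by (simp add: Eprod)
  also have "\<dots> \<le> exp (3 / 2 * l * card S) * (tree_prob \<Phi> * (\<Prod>A\<in>S. exp (- 8 / 5 * l)))"
    unfolding X_def using S
    by (intro mult_left_mono prod_mono conjI expectation_exp_offspring[OF H] l_def) auto
  \<comment> \<open>Each member of \<open>S\<close> contributes 8/5 - 3/2 = 1/10 to the
    rate.\<close>
  also have "\<dots> = tree_prob \<Phi> * exp (- (l * real (card S) / 10))"
    by (simp add: exp_of_nat_mult[symmetric] exp_add[symmetric] algebra_simps)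
  also have "\<dots> = tree_prob \<Phi> * exp (- real (card S) / (40 * real (card (words M r :: 'd word set))))"
    by (simp add: l_def)
  finally show ?thesis by (simp only: D_def[abs_def] X_def of_nat_sum)
qed

end

section \<open>Simultaneous branching along all fibres\<close>

text \<open>Coordinates are rounded to cells of side \<eta> / DIM, and one member of
  \<open>X\<close> is kept for each occupied cell. The net thus lies in \<open>X\<close> itself,
  where the branching assumption will be available for its members.\<close>

lemma finite_net:
  fixes f :: "'x \<Rightarrow> 'e::euclidean_space"
  assumes bd: "\<And>x. x \<in> X \<Longrightarrow> norm (f x) \<le> Bd" and \<eta>: "\<eta> > 0" and "Bd \<ge> 0"
  shows "\<exists>R\<subseteq>X. finite R \<and> real (card R) \<le> (2 * Bd * DIM('e) / \<eta> + 3) ^ DIM('e) \<and>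
    (\<forall>x\<in>X. \<exists>y\<in>R. norm (f y - f x) \<le> \<eta>)"
proof -
  define s where "s = \<eta> / DIM('e)"
  have s: "s > 0" using \<eta> by (simp add: s_def)
  define N where "N = \<lceil>Bd / s\<rceil>"
  have "0 \<le> Bd / s" using \<open>Bd \<ge> 0\<close> s by simp
  then have N0: "N \<ge> 0" unfolding N_def by linarith
  define key where "key x = restrict (\<lambda>b. \<lfloor>(f x \<bullet> b) / s\<rfloor>) (Basis :: 'e set)" for x
  have key: "key ` X \<subseteq> PiE Basis (\<lambda>_. {-N..N})"
  proof clarify
    fix x assume x: "x \<in> X"
    have "- N \<le> \<lfloor>(f x \<bullet> b) / s\<rfloor> \<and> \<lfloor>(f x \<bullet> b) / s\<rfloor> \<le> N" if b: "b \<in> Basis" for b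
    proof -
      have "\<bar>f x \<bullet> b\<bar> \<le> Bd" using Basis_le_norm[OF b, of "f x"] bd[OF x] by linarith
      then have "\<bar>(f x \<bullet> b) / s\<bar> \<le> Bd / s" using s by (simp add: divide_right_mono)
      moreover have "Bd / s \<le> real_of_int N" by (simp add: N_def)
      ultimately have *: "- real_of_int N \<le> (f x \<bullet> b) / s" "(f x \<bullet> b) / s \<le> real_of_int N" by linarith+
      show ?thesis using * by linarith
    qed
    then show "key x \<in> PiE Basis (\<lambda>_. {-N..N})" by (auto simp: key_def)
  qed
  have fin: "finite (PiE (Basis::'e set) (\<lambda>_. {-N..N}))" by (intro finite_PiE) auto
  define R where "R = (\<lambda>k. SOME x. x \<in> X \<and> key x = k) ` (key ` X)"
  have rep: "(SOME y. y \<in> X \<and> key y = key x) \<in> X \<and> key (SOME y. y \<in> X \<and> key y = key x) = key x"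
    if "x \<in> X" for x
    using someI_ex[of "\<lambda>y. y \<in> X \<and> key y = key x"] that by auto
  have "R \<subseteq> X" using rep by (auto simp: R_def)
  moreover have "finite R" unfolding R_def using finite_subset[OF key fin] by blast
  moreover have "real (card R) \<le> (2 * Bd * DIM('e) / \<eta> + 3) ^ DIM('e)"
  proof -
    have "card R \<le> card (key ` X)" unfolding R_def by (rule card_image_le[OF finite_subset[OF key fin]])
    also have "\<dots> \<le> card (PiE (Basis::'e set) (\<lambda>_. {-N..N}))" by (rule card_mono[OF fin key])
    also have "\<dots> = nat (2 * N + 1) ^ DIM('e)" using N0 by (simp add: card_PiE add.commute)
    finally have "real (card R) \<le> real (nat (2 * N + 1)) ^ DIM('e)" by (metis of_nat_le_iff of_nat_power)
    also have "\<dots> \<le> (2 * Bd * DIM('e) / \<eta> + 3) ^ DIM('e)"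
    proof (rule power_mono)
      have "real_of_int N \<le> Bd / s + 1" unfolding N_def by linarith
      moreover have "Bd / s = Bd * DIM('e) / \<eta>" by (simp add: s_def)
      ultimately show "real (nat (2 * N + 1)) \<le> 2 * Bd * DIM('e) / \<eta> + 3" using N0 by simp
    qed simp
    finally show ?thesis .
  qed
  moreover have "\<exists>y\<in>R. norm (f y - f x) \<le> \<eta>" if x: "x \<in> X" for x
  proof
    let ?y = "SOME y. y \<in> X \<and> key y = key x"
    show "?y \<in> R" unfolding R_def using x by blast
    have k: "key ?y = key x" using rep[OF x] by blast
    have "\<bar>(f ?y - f x) \<bullet> b\<bar> \<le> s" if b: "b \<in> Basis" for b
    proof -
      have "\<lfloor>(f ?y \<bullet> b) / s\<rfloor> = \<lfloor>(f x \<bullet> b) / s\<rfloor>"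
        using fun_cong[OF k, of b] b by (simp add: key_def)
      then have "\<bar>(f ?y \<bullet> b) / s - (f x \<bullet> b) / s\<bar> \<le> 1" by linarith
      then have "\<bar>((f ?y - f x) \<bullet> b) / s\<bar> \<le> 1" by (simp add: inner_diff_left diff_divide_distrib)
      then show ?thesis using s by simp
    qed
    then have "norm (f ?y - f x) \<le> (\<Sum>b\<in>(Basis :: 'e set). s)"
      by (intro order_trans[OF norm_le_l1] sum_mono) 
    then show "norm (f ?y - f x) \<le> \<eta>" by (simp add: s_def)
  qed
  ultimately show ?thesis by blast
qed

text \<open>Since (3/2)^(n+1) = (3/2)^n + (3/2)^n / 2, the ratio of consecutive terms is L^D * exp
  (- k/2 * (3/2)^n), which tends to 0.\<close>

lemma summable_double_exponential:
  fixes C L k :: real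
  assumes "L > 0" "k > 0" "C \<ge> 0"
  shows "summable (\<lambda>n. (C * L ^ Suc n) ^ D * exp (- k * (3 / 2) ^ n))"
proof -
  define a where "a = L ^ D"
  have a: "a > 0" using assms by (simp add: a_def)
  define g where "g n = a ^ n * exp (- k * (3 / 2) ^ n)" for n :: nat
  obtain N where N: "ln (2 * a) * 2 / k < (3 / 2) ^ N" using real_arch_pow[of "3 / 2 :: real"] by auto
  have "summable g"
  proof (rule summable_ratio_test[of "1 / 2" N])
    fix n assume "n \<ge> N"
    then have "(3 / 2 :: real) ^ N \<le> (3 / 2) ^ n" by (intro power_increasing) auto
    with N have "ln (2 * a) * 2 / k \<le> (3 / 2) ^ n" by linarith
    then have "ln (2 * a) \<le> k / 2 * (3 / 2) ^ n" using assms(2) by (simp add: field_simps)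
    then have "exp (ln (2 * a)) \<le> exp (k / 2 * (3 / 2) ^ n)" by (simp only: exp_le_cancel_iff)
    then have "2 * a \<le> exp (k / 2 * (3 / 2) ^ n)" using a by simp
    then have e: "a * exp (- (k / 2 * (3 / 2) ^ n)) \<le> 1 / 2" by (simp add: exp_minus field_simps)
    have "g (Suc n) = g n * (a * exp (- (k / 2 * (3 / 2) ^ n)))"
      by (simp add: g_def exp_add[symmetric] algebra_simps)
    also have "\<dots> \<le> g n * (1 / 2)" using e a by (intro mult_left_mono) (auto simp: g_def)
    finally show "norm (g (Suc n)) \<le> 1 / 2 * norm (g n)" using a by (simp add: g_def)
  qed simp
  then have "summable (\<lambda>n. (C * L) ^ D * g n)" by (rule summable_mult)
  moreover have "(C * L) ^ D * g n = (C * L ^ Suc n) ^ D * exp (- k * (3 / 2) ^ n)" for n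
    by (simp add: g_def a_def power_mult_distrib power_mult[symmetric] mult.commute[of D] mult.assoc)
  ultimately show ?thesis by simp
qed

lemma (in percolation) tree_prob_partition:
  assumes "finite V" "\<And>\<xi>. f \<xi> \<in> V" "determined (tree_words M) \<Phi>"
    "\<And>v. v \<in> V \<Longrightarrow> determined (tree_words M) (\<lambda>\<xi>. f \<xi> = v)"
  shows "(\<Sum>v\<in>V. tree_prob (\<lambda>\<xi>. \<Phi> \<xi> \<and> f \<xi> = v)) = tree_prob \<Phi>"
proof -
  let ?A = "\<lambda>v. {\<omega> \<in> space P. \<Phi> (\<lambda>A. c A \<omega>) \<and> f (\<lambda>A. c A \<omega>) = v}"
  have "prob (\<Union>v\<in>V. ?A v) = (\<Sum>v\<in>V. prob (?A v))"
    using determined_event[OF determined_conj[OF assms(3,4)]]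
    by (intro finite_measure_finite_Union assms(1)) (auto simp: disjoint_family_on_def)
  moreover have "(\<Union>v\<in>V. ?A v) = {\<omega> \<in> space P. \<Phi> (\<lambda>A. c A \<omega>)}" using assms(2) by auto
  ultimately show ?thesis by (simp add: tree_prob_def)
qed

lemma (in percolation) tree_prob_union_bound:
  assumes "finite I" "\<And>i. i \<in> I \<Longrightarrow> determined (tree_words M) (\<Psi> i)"
    "\<And>\<xi>. \<Phi> \<xi> \<Longrightarrow> \<exists>i\<in>I. \<Psi> i \<xi>"
  shows "tree_prob \<Phi> \<le> (\<Sum>i\<in>I. tree_prob (\<Psi> i))"
proof -
  let ?A = "\<lambda>i. {\<omega> \<in> space P. \<Psi> i (\<lambda>A. c A \<omega>)}"
  have "prob {\<omega> \<in> space P. \<Phi> (\<lambda>A. c A \<omega>)} \<le> prob (\<Union>i\<in>I. ?A i)"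
    using assms determined_event[OF assms(2)] by (intro finite_measure_mono) auto
  also have "\<dots> \<le> (\<Sum>i\<in>I. prob (?A i))"
    using determined_event[OF assms(2)] by (intro measure_UNION_le assms(1)) auto
  finally show ?thesis by (simp add: tree_prob_def)
qed

lemma (in percolation) prod_list_p_bounds:
  assumes "A \<in> words M n"
  shows "0 \<le> prod_list (map p A)" "prod_list (map p A) \<le> 1"
  using tree_prob_word_open[OF assms] tree_prob_nonneg tree_prob_le_1 by metis+

text \<open>\<open>rel t u y\<close> says that \<open>y\<close> lies on the fibre through \<open>u\<close> of the projection from \<open>t\<close>;
  \<open>e t u\<close> are coordinates for this fibre in which the space of fibres is bounded.\<close>

locale percolation_fibres = percolation P M p c
  for P :: "'w measure" and M and p :: "nat ^ 'd::finite \<Rightarrow> real" and c +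
  fixes rel :: "real ^ 'd \<Rightarrow> real ^ 'd \<Rightarrow> real ^ 'd \<Rightarrow> bool"
    and T :: "(real ^ 'd) set"
    and e :: "real ^ 'd \<Rightarrow> real ^ 'd \<Rightarrow> 'e::euclidean_space"
    and \<rho>' \<rho> Bd Lip :: real and r :: nat
  assumes \<rho>: "\<rho>' < \<rho>" "\<rho> < 1" and r: "r \<ge> 1" and Lip: "Lip > 0" and Bd: "Bd \<ge> 0"
    and rel_refl: "\<And>t u. t \<in> T \<Longrightarrow> rel t u u"
    and rel_trans: "\<And>t u y z. t \<in> T \<Longrightarrow> rel t u y \<Longrightarrow> rel t y z \<Longrightarrow> rel t u z"
    and uncube_T: "\<And>t A n. t \<in> T \<Longrightarrow> A \<in> words M n \<Longrightarrow> uncube M A t \<in> T"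
    and rel_cube_map: "\<And>t A n u y. t \<in> T \<Longrightarrow> A \<in> words M n \<Longrightarrow> rel (uncube M A t) u y \<Longrightarrow>
      rel t (cube_map M A u) (cube_map M A y)"
    and branching: "\<And>t u. t \<in> T \<Longrightarrow> u \<in> core \<rho> \<Longrightarrow>
      2 \<le> (\<Sum>A\<in>{A \<in> words M r. \<exists>y\<in>cube_map M A ` core \<rho>'. rel t u y}. prod_list (map p A))"
    and fibre_lipschitz: "\<And>t t' u u' y \<eta>. t \<in> T \<Longrightarrow> t' \<in> T \<Longrightarrow> u \<in> core \<rho> \<Longrightarrow> u' \<in> core \<rho> \<Longrightarrow>
      y \<in> unit_cube \<Longrightarrow> rel t u y \<Longrightarrow> norm (e t u - e t' u') \<le> \<eta> \<Longrightarrow>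
      \<exists>y'. rel t' u' y' \<and> norm (y - y') \<le> Lip * \<eta>"
    and fibre_bounded: "\<And>t u. t \<in> T \<Longrightarrow> u \<in> core \<rho> \<Longrightarrow> norm (e t u) \<le> Bd"
    and fibre_closed: "\<And>t u. t \<in> T \<Longrightarrow> u \<in> core \<rho> \<Longrightarrow> closed {y \<in> unit_cube. rel t u y}"
begin

section \<open>Growth of the number of cubes hit by a fibre\<close>

definition hit :: "nat \<Rightarrow> real ^ 'd \<Rightarrow> real ^ 'd \<Rightarrow> 'd word set"
  where "hit n t u = {A \<in> words M (n * r). \<exists>y\<in>cube_map M A ` core \<rho>. rel t u y}"

text \<open>Successors have to be hit in the smaller core. The margin lost here is what allows
  passing to a neighbouring fibre, which then hits them in the larger core again.\<close>

definition hit_next :: "real ^ 'd \<Rightarrow> real ^ 'd \<Rightarrow> 'd word \<Rightarrow> 'd word set"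
  where "hit_next t u A = {B \<in> words M r. \<exists>y\<in>cube_map M (A @ B) ` core \<rho>'. rel t u y}"

lemma finite_hit: "finite (hit n t u)"
  by (simp add: hit_def)

lemma finite_hit_next: "finite (hit_next t u A)"
  by (simp add: hit_next_def)

text \<open>Rescaling \<open>A\<close> to the unit cube turns the centre into another member of
  \<open>T\<close> and the fibre into one through a point of the core, so the branching assumption
  applies inside \<open>A\<close>.\<close>

lemma hit_next_mass:
  assumes "t \<in> T" "u \<in> core \<rho>" "A \<in> hit n t u"
  shows "2 \<le> (\<Sum>B\<in>hit_next t u A. prod_list (map p B))"
proof -
  obtain u0 where A: "A \<in> words M (n * r)" and u0: "u0 \<in> core \<rho>" "rel t u (cube_map M A u0)"
    using assms(3) by (auto simp: hit_def)
  let ?H = "{B \<in> words M r. \<exists>y\<in>cube_map M B ` core \<rho>'. rel (uncube M A t) u0 y}"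
  have "2 \<le> (\<Sum>B\<in>?H. prod_list (map p B))"
    by (rule branching[OF uncube_T[OF assms(1) A] u0(1)])
  also have "\<dots> \<le> (\<Sum>B\<in>hit_next t u A. prod_list (map p B))"
  proof (rule sum_mono2[OF finite_hit_next])
    show "?H \<subseteq> hit_next t u A"
    proof
      fix B assume "B \<in> ?H"
      then obtain z where B: "B \<in> words M r" and z: "z \<in> core \<rho>'" "rel (uncube M A t) u0 (cube_map M B z)"
        by auto
      have "rel t u (cube_map M (A @ B) z)"
        using rel_trans[OF assms(1) u0(2) rel_cube_map[OF assms(1) A z(2)]]
        by (simp add: cube_map_append)
      then show "B \<in> hit_next t u A" using B z by (auto simp: hit_next_def)
    qed
    show "0 \<le> prod_list (map p B)" if "B \<in> hit_next t u A - ?H" for B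
      using that prod_list_p_bounds by (auto simp: hit_next_def)
  qed
  finally show ?thesis .
qed

lemma card_hit_next:
  assumes "t \<in> T" "u \<in> core \<rho>" "A \<in> hit n t u"
  shows "2 \<le> card (hit_next t u A)"
proof -
  have "2 \<le> (\<Sum>B\<in>hit_next t u A. prod_list (map p B))" by (rule hit_next_mass[OF assms])
  also have "\<dots> \<le> (\<Sum>B\<in>hit_next t u A. 1)"
    by (rule sum_mono) (use prod_list_p_bounds in \<open>auto simp: hit_next_def\<close>)
  finally show ?thesis by simp
qed

definition good :: "('d word \<Rightarrow> bool) \<Rightarrow> nat \<Rightarrow> bool"
  where "good \<xi> n \<longleftrightarrow> (\<forall>t\<in>T. \<forall>u\<in>core \<rho>. (3 / 2) ^ n \<le> real (card (hit n t u \<inter> openings M \<xi> (n * r))))"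

text \<open>Fibres whose coordinates differ by at most this amount differ in space, after the factor
  \<open>Lip\<close>, by at most the margin between the two cores in cubes of level
  \<open>n * r\<close>.\<close>

definition scale :: "nat \<Rightarrow> real"
  where "scale n = (\<rho> - \<rho>') / 2 / real M ^ (n * r) / Lip"

lemma scale_pos: "scale n > 0"
  using \<rho> Lip M_ge_1 by (simp add: scale_def)

definition net :: "nat \<Rightarrow> ((real ^ 'd) \<times> (real ^ 'd)) set \<Rightarrow> bool"
  where "net n R \<longleftrightarrow> R \<subseteq> T \<times> core \<rho> \<and> finite R \<and>
    (\<forall>t\<in>T. \<forall>u\<in>core \<rho>. \<exists>t' u'. (t', u') \<in> R \<and> norm (e t' u' - e t u) \<le> scale n)"

definition few :: "('d word \<Rightarrow> bool) \<Rightarrow> nat \<Rightarrow> real ^ 'd \<Rightarrow> real ^ 'd \<Rightarrow> 'd word set \<Rightarrow> bool"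
  where "few \<xi> n t u S \<longleftrightarrow>
    real (\<Sum>A\<in>S. card (hit_next t u A \<inter> openings M (below \<xi> A) r)) < 3 / 2 * real (card S)"

text \<open>A net fibre bounds the count of every fibre close to it: a cube that the net fibre hits
  in the small core is hit in the large core by all its neighbours. Finitely many fibres therefore
  decide about all of them.\<close>

lemma good_Suc:
  assumes "net (Suc n) R" "good \<xi> n"
    "\<And>t u. (t, u) \<in> R \<Longrightarrow> \<not> few \<xi> n t u (hit n t u \<inter> openings M \<xi> (n * r))"
  shows "good \<xi> (Suc n)"
  unfolding good_def
proof (intro ballI)
  fix t u :: "real ^ 'd" assume tu: "t \<in> T" "u \<in> core \<rho>"
  then obtain t' u' where R: "(t', u') \<in> R" and d: "norm (e t' u' - e t u) \<le> scale (Suc n)"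
    using assms(1) unfolding net_def by blast
  then have tu': "t' \<in> T" "u' \<in> core \<rho>" using assms(1) by (auto simp: net_def)
  define S where "S = hit n t' u' \<inter> openings M \<xi> (n * r)"
  define Z where "Z = (SIGMA A:S. hit_next t' u' A \<inter> openings M (below \<xi> A) r)"
  have fS: "finite S" using finite_hit by (simp add: S_def)
  have "(3 / 2) ^ Suc n \<le> 3 / 2 * real (card S)"
    using assms(2) tu' by (simp add: good_def S_def)
  also have "\<dots> \<le> real (\<Sum>A\<in>S. card (hit_next t' u' A \<inter> openings M (below \<xi> A) r))"
    using assms(3)[OF R] by (simp add: few_def S_def)
  also have "(\<Sum>A\<in>S. card (hit_next t' u' A \<inter> openings M (below \<xi> A) r)) = card Z"
    unfolding Z_def using fS finite_hit_next by (subst card_SigmaI) auto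
  also have "card Z \<le> card (hit (Suc n) t u \<inter> openings M \<xi> (Suc n * r))"
  proof (rule card_inj_on_le[where f = "\<lambda>(A, B). A @ B"])
    show "inj_on (\<lambda>(A, B). A @ B) Z"
    proof (rule inj_onI, clarify)
      fix A B A' B' assume "(A, B) \<in> Z" "(A', B') \<in> Z" "A @ B = A' @ B'"
      moreover from this have "length A = length A'" by (auto simp: Z_def S_def hit_def words_length)
      ultimately show "A = A' \<and> B = B'" by simp
    qed
    show "(\<lambda>(A, B). A @ B) ` Z \<subseteq> hit (Suc n) t u \<inter> openings M \<xi> (Suc n * r)"
    proof clarify
      fix A B assume AB: "(A, B) \<in> Z"
      then have w: "A \<in> words M (n * r)" "B \<in> words M r"
        by (auto simp: Z_def S_def hit_def hit_next_def)
      have w': "A @ B \<in> words M (Suc n * r)" using words_append[OF w] by (simp add: add.commute)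
      have o: "A @ B \<in> openings M \<xi> (Suc n * r)"
        using openings_append[OF w, of \<xi>] AB by (simp add: Z_def S_def add.commute)
      obtain y where y: "y \<in> cube_map M (A @ B) ` core \<rho>'" "rel t' u' y"
        using AB by (auto simp: Z_def hit_next_def)
      have "y \<in> unit_cube"
        using y(1) core_subset_unit_cube[of \<rho>'] \<rho> cube_map_in_unit_cube[OF w' _ M_ge_1] by auto
      then obtain y' where y': "rel t u y'" "norm (y - y') \<le> Lip * scale (Suc n)"
        using fibre_lipschitz[OF tu'(1) tu(1) tu'(2) tu(2) _ y(2) d] by blast
      have "norm (y - y') \<le> (\<rho> - \<rho>') / 2 / real M ^ length (A @ B)"
        using y'(2) Lip words_length[OF w'] by (simp add: scale_def)
      then have "y' \<in> cube_map M (A @ B) ` core \<rho>"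
        by (rule cube_map_core_perturb[OF y(1) _ M_ge_1])
      then show "A @ B \<in> hit (Suc n) t u \<inter> openings M \<xi> (Suc n * r)"
        using o w' y'(1) by (auto simp: hit_def)
    qed
  qed (simp add: finite_hit)
  finally show "(3 / 2) ^ Suc n \<le> real (card (hit (Suc n) t u \<inter> openings M \<xi> (Suc n * r)))"
    by simp
qed

lemma net_exists:
  "\<exists>R. net n R \<and> real (card R) \<le> (2 * Bd * DIM('e) / scale n + 3) ^ DIM('e)"
proof -
  have "norm (case_prod e x) \<le> Bd" if "x \<in> T \<times> core \<rho>" for x
    using fibre_bounded that by (cases x) auto
  from finite_net[of "T \<times> core \<rho>" "case_prod e" Bd "scale n", OF this scale_pos Bd]
  obtain R where R: "R \<subseteq> T \<times> core \<rho>" "finite R"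
      "real (card R) \<le> (2 * Bd * DIM('e) / scale n + 3) ^ DIM('e)"
      "\<And>x. x \<in> T \<times> core \<rho> \<Longrightarrow> \<exists>y\<in>R. norm (case_prod e y - case_prod e x) \<le> scale n"
    by blast
  have "\<exists>t' u'. (t', u') \<in> R \<and> norm (e t' u' - e t u) \<le> scale n" if "t \<in> T" "u \<in> core \<rho>" for t u
    using R(4)[of "(t, u)"] that by auto
  then have "net n R" using R(1,2) by (simp add: net_def)
  with R(3) show ?thesis by blast
qed

lemma good_cong:
  "openings M \<xi> (n * r) = openings M \<xi>' (n * r) \<Longrightarrow> good \<xi> n = good \<xi>' n"
  by (simp add: good_def)

text \<open>Supplies the start of the induction. When everything is retained, a hit cube has at
  least 2 hit successors, because their masses are at most 1 each and add up to at least 2.\<close>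

lemma good_all_open:
  assumes "\<And>A. A \<in> (\<Union>m\<in>{1..n * r}. words M m) \<Longrightarrow> \<xi> A"
  shows "good \<xi> n"
proof -
  let ?o = "\<lambda>_ :: 'd word. True"
  have op: "openings M ?o m = words M m" for m by (simp add: openings_def)
  have "good ?o n"
  proof (induction n)
    case 0
    have "u \<in> cube_map M [] ` core \<rho>" if "u \<in> core \<rho>" for u :: "real ^ 'd" using that by (auto simp: image_iff)
    then have "hit 0 t u = {[]}" if "t \<in> T" "u \<in> core \<rho>" for t u
      using rel_refl[OF that(1)] that by (force simp: hit_def)
    then show ?case by (simp add: good_def)
  next
    case (Suc n)
    obtain R where R: "net (Suc n) R" using net_exists by blast
    show ?case
    proof (rule good_Suc[OF R Suc])
      fix t u :: "real ^ 'd" assume "(t, u) \<in> R"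
      then have tu: "t \<in> T" "u \<in> core \<rho>" using R by (auto simp: net_def)
      let ?S = "hit n t u \<inter> openings M ?o (n * r)"
      have "2 * card ?S = (\<Sum>A\<in>?S. 2)" by simp
      also have "\<dots> \<le> (\<Sum>A\<in>?S. card (hit_next t u A \<inter> openings M (below ?o A) r))"
      proof (rule sum_mono)
        fix A assume "A \<in> ?S"
        moreover have "hit_next t u A \<inter> openings M (below ?o A) r = hit_next t u A"
          by (auto simp: below_def op hit_next_def)
        ultimately show "2 \<le> card (hit_next t u A \<inter> openings M (below ?o A) r)"
          using card_hit_next[OF tu, of A n] by simp
      qed
      finally show "\<not> few ?o n t u ?S" unfolding few_def by linarith
    qed
  qed
  moreover have "openings M \<xi> (n * r) = openings M ?o (n * r)"
    by (rule openings_cong) (use assms in force)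
  ultimately show ?thesis using good_cong by blast
qed

lemma determined_good: "n * r \<le> N \<Longrightarrow> determined (\<Union>m\<in>{1..N}. words M m) (\<lambda>\<xi>. good \<xi> n)"
  by (rule determined_level[of N M]) (auto intro!: good_cong)

lemma levels_subset: "(\<Union>m\<in>{1..N}. words M m) \<subseteq> tree_words M"
  by (auto simp: tree_words_def)

text \<open>The retained cubes hit by a net fibre at level n form a random set, so the event is
  split according to its value \<open>V\<close>; given \<open>V\<close>, the offspring are
  independent. Summing over \<open>V\<close> restores the probability of \<Phi>, and the union over
  the net contributes the factor \<open>card R\<close>.\<close>

lemma good_step_prob:
  assumes \<Phi>: "determined (\<Union>m\<in>{1..n * r}. words M m) \<Phi>" and R: "net (Suc n) R"
    and good: "\<And>\<xi>. \<Phi> \<xi> \<Longrightarrow> good \<xi> n"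
  shows "tree_prob (\<lambda>\<xi>. \<Phi> \<xi> \<and> \<not> good \<xi> (Suc n)) \<le>
    real (card R) * exp (- (1 / (40 * real (card (words M r :: 'd word set)))) * (3 / 2) ^ n) * tree_prob \<Phi>"
proof -
  define W where "W = real (card (words M r :: 'd word set))"
  have W: "W \<ge> 0" by (simp add: W_def)
  define S where "S x \<xi> = hit n (fst x) (snd x) \<inter> openings M \<xi> (n * r)" for x :: "(real ^ 'd) \<times> (real ^ 'd)" and \<xi>
  have detS: "determined (\<Union>m\<in>{1..n * r}. words M m) (\<lambda>\<xi>. S x \<xi> = V)" for x V
    by (rule determined_level[of "n * r" M]) (auto simp: S_def)
  have detF: "determined (tree_words M) (\<lambda>\<xi>. few \<xi> n t u V)" if "V \<subseteq> words M (n * r)" for t u V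
  proof (rule determined_finite)
    let ?F = "\<Union>A\<in>V. (\<lambda>B. A @ B) ` (\<Union>m\<in>{1..r}. words M m)"
    have "finite V" using that finite_subset by blast
    then show "finite ?F" by simp
    show "?F \<subseteq> tree_words M"
      using that append_tree_words levels_subset[of r] by blast
    fix \<xi> \<xi>' :: "'d word \<Rightarrow> bool"
    assume eq: "\<And>i. i \<in> ?F \<Longrightarrow> \<xi> i = \<xi>' i"
    have "openings M (below \<xi> A) r = openings M (below \<xi>' A) r" if "A \<in> V" for A
    proof (rule openings_cong)
      fix B :: "'d word" assume "length B \<in> {1..r}" "B \<in> words M (length B)"
      then have "A @ B \<in> ?F" using that by blast
      then show "below \<xi> A B = below \<xi>' A B" using eq by (simp add: below_def)
    qed
    then show "few \<xi> n t u V = few \<xi>' n t u V" by (simp add: few_def)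
  qed
  \<comment> \<open>The lower bound on the cardinality follows from \<open>good\<close>. It empties
    the event for small \<open>V\<close> and makes the deviation bound uniform over the remaining
    \<open>V\<close>.\<close>
  define E where "E x \<xi> \<longleftrightarrow> \<Phi> \<xi> \<and> few \<xi> n (fst x) (snd x) (S x \<xi>) \<and> (3 / 2) ^ n \<le> real (card (S x \<xi>))" for x \<xi>
  have ES: "tree_prob (\<lambda>\<xi>. E x \<xi> \<and> S x \<xi> = V) \<le> exp (- ((3 / 2) ^ n) / (40 * W)) * tree_prob (\<lambda>\<xi>. \<Phi> \<xi> \<and> S x \<xi> = V)"
    if x: "x \<in> R" and V: "V \<in> Pow (hit n (fst x) (snd x))" for x V
  proof (cases "(3 / 2) ^ n \<le> real (card V)")
    case True
    have Vw: "V \<subseteq> words M (n * r)" using V by (auto simp: hit_def)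
    have tu: "fst x \<in> T" "snd x \<in> core \<rho>" using x R by (auto simp: net_def)
    have d1: "determined (\<Union>m\<in>{1..n * r}. words M m) (\<lambda>\<xi>. \<Phi> \<xi> \<and> S x \<xi> = V)"
      by (rule determined_conj[OF \<Phi> detS])
    have "tree_prob (\<lambda>\<xi>. E x \<xi> \<and> S x \<xi> = V) \<le> tree_prob (\<lambda>\<xi>. (\<Phi> \<xi> \<and> S x \<xi> = V) \<and> few \<xi> n (fst x) (snd x) V)"
      by (rule tree_prob_mono[OF determined_conj[OF determined_mono[OF d1 levels_subset] detF[OF Vw]]])
        (auto simp: E_def)
    also have "\<dots> \<le> tree_prob (\<lambda>\<xi>. \<Phi> \<xi> \<and> S x \<xi> = V) * exp (- real (card V) / (40 * real (card (words M r :: 'd word set))))"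
      unfolding few_def
      using hit_next_mass[OF tu] V
      by (intro offspring_large_deviation[OF d1 Vw]) (auto simp: hit_next_def)
    also have "\<dots> \<le> tree_prob (\<lambda>\<xi>. \<Phi> \<xi> \<and> S x \<xi> = V) * exp (- ((3 / 2) ^ n) / (40 * W))"
      using True W by (intro mult_left_mono) (auto simp: W_def intro: divide_right_mono)
    finally show ?thesis by (simp add: mult.commute)
  next
    case False
    then have "tree_prob (\<lambda>\<xi>. E x \<xi> \<and> S x \<xi> = V) = tree_prob (\<lambda>\<xi>. False)"
      by (intro arg_cong[of _ _ tree_prob] ext) (auto simp: E_def)
    also have "\<dots> = 0" by (simp add: tree_prob_def)
    finally show ?thesis by simp
  qed
  have detES: "determined (tree_words M) (\<lambda>\<xi>. E x \<xi> \<and> S x \<xi> = V)" if "V \<subseteq> hit n (fst x) (snd x)" for x V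
  proof -
    have "determined (tree_words M) (\<lambda>\<xi>. \<Phi> \<xi> \<and> few \<xi> n (fst x) (snd x) V \<and> (3 / 2) ^ n \<le> real (card V) \<and> S x \<xi> = V)"
      using that by (intro determined_conj determined_const detF determined_mono[OF \<Phi> levels_subset]
          determined_mono[OF detS levels_subset]) (auto simp: hit_def)
    moreover have "(\<lambda>\<xi>. E x \<xi> \<and> S x \<xi> = V) =
      (\<lambda>\<xi>. \<Phi> \<xi> \<and> few \<xi> n (fst x) (snd x) V \<and> (3 / 2) ^ n \<le> real (card V) \<and> S x \<xi> = V)"
      by (auto simp: E_def)
    ultimately show ?thesis by simp
  qed
  have fR: "finite R" using R by (simp add: net_def)
  have "tree_prob (\<lambda>\<xi>. \<Phi> \<xi> \<and> \<not> good \<xi> (Suc n)) \<le>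
      (\<Sum>(x, V)\<in>(SIGMA x:R. Pow (hit n (fst x) (snd x))). tree_prob (\<lambda>\<xi>. E x \<xi> \<and> S x \<xi> = V))"
    unfolding case_prod_beta
  proof (rule tree_prob_union_bound)
    show "finite (SIGMA x:R. Pow (hit n (fst x) (snd x)))" using fR finite_hit by auto
    show "determined (tree_words M) (\<lambda>\<xi>. E (fst i) \<xi> \<and> S (fst i) \<xi> = snd i)"
      if "i \<in> (SIGMA x:R. Pow (hit n (fst x) (snd x)))" for i
      using that by (intro detES) auto
    fix \<xi> assume \<xi>: "\<Phi> \<xi> \<and> \<not> good \<xi> (Suc n)"
    then obtain t u where tu: "(t, u) \<in> R" "few \<xi> n t u (S (t, u) \<xi>)"
      using good_Suc[OF R good[of \<xi>]] unfolding S_def fst_conv snd_conv by blast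
    moreover have "t \<in> T" "u \<in> core \<rho>" using tu R by (auto simp: net_def)
    ultimately have "E (t, u) \<xi>" using good[of \<xi>] \<xi> by (auto simp: E_def S_def good_def)
    then show "\<exists>i\<in>SIGMA x:R. Pow (hit n (fst x) (snd x)). E (fst i) \<xi> \<and> S (fst i) \<xi> = snd i"
      using tu by (intro bexI[of _ "((t, u), S (t, u) \<xi>)"]) (auto simp: S_def)
  qed
  also have "\<dots> = (\<Sum>x\<in>R. \<Sum>V\<in>Pow (hit n (fst x) (snd x)). tree_prob (\<lambda>\<xi>. E x \<xi> \<and> S x \<xi> = V))"
    using fR finite_hit by (subst sum.Sigma) auto
  also have "\<dots> \<le> (\<Sum>x\<in>R. \<Sum>V\<in>Pow (hit n (fst x) (snd x)).
      exp (- ((3 / 2) ^ n) / (40 * W)) * tree_prob (\<lambda>\<xi>. \<Phi> \<xi> \<and> S x \<xi> = V))"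
    by (intro sum_mono ES)
  also have "\<dots> = (\<Sum>x\<in>R. exp (- ((3 / 2) ^ n) / (40 * W)) * tree_prob \<Phi>)"
    using finite_hit determined_mono[OF \<Phi> levels_subset] determined_mono[OF detS levels_subset]
    by (intro sum.cong refl) (subst sum_distrib_left[symmetric], subst tree_prob_partition, auto simp: S_def)
  finally show ?thesis by (simp add: W_def mult.assoc)
qed

end

context percolation_fibres
begin

text \<open>The branching makes the number of retained cubes met by a fibre grow geometrically, while the
  number of essentially different fibres at scale \<open>scale n\<close> is only exponential in \<open>n\<close>; the union of
  the large deviation events is therefore summable.\<close>

theorem all_fibres_meet_limit_set:
  "\<exists>Q. determined (tree_words M) Q \<and> 0 < tree_prob Q \<and>
    (\<forall>\<xi>. Q \<xi> \<longrightarrow> (\<forall>t\<in>T. \<forall>u\<in>core \<rho>. \<exists>y\<in>limit_set M \<xi>. rel t u y))"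
proof -
  define k where "k = 1 / (40 * real (card (words M r :: 'd word set)))"
  have "words M r \<noteq> ({} :: 'd word set)"
  proof -
    obtain C :: "nat ^ 'd" where "C \<in> digits M" using digits_nonempty[OF M_ge_1] by blast
    then have "replicate r C \<in> words M r" by (auto simp: words_def)
    then show ?thesis by blast
  qed
  then have k: "k > 0" by (simp add: k_def card_gt_0_iff)
  define c0 where "c0 = 2 * Bd * DIM('e) / ((\<rho> - \<rho>') / 2 / Lip)"
  have c0: "c0 \<ge> 0" using Bd Lip \<rho> by (simp add: c0_def)
  define L where "L = real M ^ r"
  have L: "L \<ge> 1" using M_ge_1 by (simp add: L_def)
  define \<epsilon> where "\<epsilon> n = ((c0 + 3) * L ^ Suc n) ^ DIM('e) * exp (- k * (3 / 2) ^ n)" for n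
  have \<epsilon>0: "\<epsilon> n \<ge> 0" for n using c0 L by (simp add: \<epsilon>_def)
  have "summable \<epsilon>"
    unfolding \<epsilon>_def using c0 L k by (intro summable_double_exponential) auto
  then have "\<forall>e>0. \<exists>N. \<forall>m\<ge>N. \<forall>n. norm (sum \<epsilon> {m..<n}) < e" by (simp only: summable_Cauchy)
  from this[rule_format, of "1 / 2"]
  obtain N where N: "\<And>m n. m \<ge> N \<Longrightarrow> norm (sum \<epsilon> {m..<n}) < 1 / 2" by auto
  \<comment> \<open>From \<open>N\<close> on, all block sums of the losses stay below 1/2. The level
    is at least 1 so that \<open>start\<close> concerns a nonempty set of words.\<close>
  define n0 where "n0 = max N 1"
  define start where "start \<xi> \<longleftrightarrow> (\<forall>A\<in>(\<Union>m\<in>{1..n0 * r}. words M m). \<xi> A)" for \<xi> :: "'d word \<Rightarrow> bool"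
  define F where "F n = (\<Union>m\<in>{1..n * r}. words M m :: 'd word set)" for n
  define \<Phi> where "\<Phi> n \<xi> \<longleftrightarrow> start \<xi> \<and> (\<forall>j\<in>{n0..n}. good \<xi> j)" for n \<xi>
  have det: "determined (F n) (\<Phi> n)" if "n \<ge> n0" for n
    unfolding \<Phi>_def[abs_def]
  proof (intro determined_conj determined_ball countable_finite)
    have "F n0 \<subseteq> F n" unfolding F_def using that by (intro UN_mono) auto
    then show "determined (F n) start"
      unfolding start_def[abs_def] F_def[symmetric]
      by (intro determined_ball countable_finite determined_component) (auto simp: F_def)
    show "determined (F n) (\<lambda>\<xi>. good \<xi> j)" if "j \<in> {n0..n}" for j
      unfolding F_def using that by (intro determined_good) simp
  qed simp
  have start_pos: "tree_prob start > 0"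
  proof -
    have "tree_prob start = (\<Prod>A\<in>F n0. tree_prob (\<lambda>\<xi>. \<xi> A))"
      unfolding start_def[abs_def] F_def[symmetric]
    proof (rule determined_block_prob[where K = "\<lambda>A. {A}"])
      obtain C :: "nat ^ 'd" where "C \<in> digits M" using digits_nonempty[OF M_ge_1] by blast
      then have "[C] \<in> F n0" using r unfolding F_def
        by (intro UN_I[of 1]) (auto simp: words_1 n0_def)
      then show "F n0 \<noteq> {}" by blast
      show "finite (F n0)" by (simp add: F_def)
      show "disjoint_family_on (\<lambda>A. {A}) (F n0)" by (simp add: disjoint_family_on_def)
      show "{A} \<subseteq> tree_words M" if "A \<in> F n0" for A
        using that levels_subset by (auto simp: F_def)
      show "determined {A} (\<lambda>\<xi>. \<xi> A)" for A :: "'d word" by (rule determined_component) simp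
    qed
    also have "\<dots> > 0"
    proof (rule prod_pos)
      fix A assume "A \<in> F n0"
      then have A: "A \<in> tree_words M" by (auto simp: F_def tree_words_def)
      then have "last A \<in> digits M" by (auto simp: tree_words_iff words_def)
      then show "0 < tree_prob (\<lambda>\<xi>. \<xi> A)"
        using prob_open[OF A] p_bounds by (simp add: tree_prob_def)
    qed
    finally show ?thesis .
  qed
  have \<Phi>n0: "\<Phi> n0 = start"
    using good_all_open[of n0] by (auto simp: \<Phi>_def start_def fun_eq_iff)
  \<comment> \<open>Losses are measured against the fixed probability of \<open>start\<close>, which
    dominates those of all later events, so that they can simply be added up.\<close>
  have step: "tree_prob (\<Phi> n) - \<epsilon> n * tree_prob start \<le> tree_prob (\<Phi> (Suc n))" if n: "n \<ge> n0" for n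
  proof -
    obtain R where R: "net (Suc n) R" "real (card R) \<le> (2 * Bd * DIM('e) / scale (Suc n) + 3) ^ DIM('e)"
      using net_exists by blast
    have dT: "determined (tree_words M) (\<Phi> m)" if "m \<ge> n0" for m
      by (rule determined_mono[OF det[OF that]]) (simp only: F_def levels_subset)
    have "2 * Bd * DIM('e) / scale (Suc n) = c0 * L ^ Suc n"
      by (simp add: c0_def scale_def L_def power_mult[symmetric] mult.commute power_add)
    \<comment> \<open>The additive 3 is absorbed because L \<ge> 1; the net is then of at most
      exponential size in n.\<close>
    also have "c0 * L ^ Suc n + 3 \<le> (c0 + 3) * L ^ Suc n"
      using one_le_power[OF L, of "Suc n"] by (simp add: algebra_simps)
    finally have "real (card R) \<le> ((c0 + 3) * L ^ Suc n) ^ DIM('e)"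
      using Bd scale_pos[of "Suc n"]
      by (intro order_trans[OF R(2)] power_mono add_nonneg_nonneg divide_nonneg_nonneg) auto
    then have cR: "real (card R) * exp (- k * (3 / 2) ^ n) \<le> \<epsilon> n"
      unfolding \<epsilon>_def by (intro mult_right_mono) auto
    have le: "tree_prob (\<Phi> n) \<le> tree_prob start"
      unfolding \<Phi>n0[symmetric] by (rule tree_prob_mono[OF dT]) (auto simp: \<Phi>_def n \<Phi>n0)
    have "tree_prob (\<lambda>\<xi>. \<Phi> n \<xi> \<and> \<not> good \<xi> (Suc n)) \<le> real (card R) * exp (- k * (3 / 2) ^ n) * tree_prob (\<Phi> n)"
      unfolding k_def
      by (rule good_step_prob[OF det[OF n, unfolded F_def] R(1)]) (use n in \<open>auto simp: \<Phi>_def\<close>)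
    also have "\<dots> \<le> \<epsilon> n * tree_prob start" using cR le \<epsilon>0 by (intro mult_mono) auto
    finally have b: "tree_prob (\<lambda>\<xi>. \<Phi> n \<xi> \<and> \<not> good \<xi> (Suc n)) \<le> \<epsilon> n * tree_prob start" .
    have dg: "determined (tree_words M) (\<lambda>\<xi>. good \<xi> (Suc n))"
      by (rule determined_mono[OF determined_good[OF order_refl] levels_subset])
    have "\<Phi> (Suc n) = (\<lambda>\<xi>. \<Phi> n \<xi> \<and> good \<xi> (Suc n))"
      using n by (auto simp: \<Phi>_def fun_eq_iff atLeastAtMostSuc_conv)
    then show ?thesis using tree_prob_split[OF dT[OF n] dg] b by simp
  qed
  have chain: "tree_prob start * (1 - sum \<epsilon> {n0..<n0 + j}) \<le> tree_prob (\<Phi> (n0 + j))" for j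
  proof (induction j)
    case (Suc j)
    show ?case using Suc step[of "n0 + j"] by (simp add: algebra_simps)
  qed (simp add: \<Phi>n0)
  define Q where "Q \<xi> \<longleftrightarrow> (\<forall>j\<in>UNIV. \<Phi> (n0 + j) \<xi>)" for \<xi>
  have dT: "determined (tree_words M) (\<Phi> (n0 + j))" for j
    by (rule determined_mono[OF det]) (simp_all only: F_def levels_subset le_add1)
  have dQ: "determined (tree_words M) Q"
    unfolding Q_def[abs_def] by (rule determined_ball[OF _ dT]) simp
  have "tree_prob start / 2 \<le> tree_prob Q"
  proof -
    let ?A = "\<lambda>j. {\<omega> \<in> space P. \<Phi> (n0 + j) (\<lambda>A. c A \<omega>)}"
    have "(\<lambda>j. prob (?A j)) \<longlonglongrightarrow> prob (\<Inter>j. ?A j)"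
    proof (rule finite_Lim_measure_decseq)
      show "range ?A \<subseteq> events" using determined_event[OF dT] by auto
      show "decseq ?A" by (rule decseq_SucI) (auto simp: \<Phi>_def)
    qed
    moreover have "(\<Inter>j. ?A j) = {\<omega> \<in> space P. Q (\<lambda>A. c A \<omega>)}" by (auto simp: Q_def)
    ultimately have "(\<lambda>j. tree_prob (\<Phi> (n0 + j))) \<longlonglongrightarrow> tree_prob Q" by (simp add: tree_prob_def)
    moreover have "tree_prob start / 2 \<le> tree_prob (\<Phi> (n0 + j))" for j
    proof -
      have "sum \<epsilon> {n0..<n0 + j} \<le> 1 / 2" using N[of n0 "n0 + j"] by (simp add: n0_def)
      then have "tree_prob start * (1 / 2) \<le> tree_prob start * (1 - sum \<epsilon> {n0..<n0 + j})"
        by (intro mult_left_mono) auto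
      with chain[of j] show ?thesis by simp
    qed
    ultimately show ?thesis by (intro LIMSEQ_le_const) auto
  qed
  then have "tree_prob Q > 0" using start_pos by linarith
  moreover have "\<exists>y\<in>limit_set M \<xi>. rel t u y" if Q: "Q \<xi>" and tu: "t \<in> T" "u \<in> core \<rho>" for \<xi> t u
  proof -
    let ?Y = "{y \<in> unit_cube. rel t u y}"
    have "?Y \<inter> limit_set M \<xi> \<noteq> {}"
    proof (rule limit_set_meets_closed[OF M_ge_1 fibre_closed[OF tu] _ r])
      fix n assume n: "n \<ge> n0"
      have "\<Phi> (n0 + (n - n0)) \<xi>" using Q unfolding Q_def by blast
      then have "good \<xi> n" using n by (simp add: \<Phi>_def)
      then have "0 < real (card (hit n t u \<inter> openings M \<xi> (n * r)))"
        using tu unfolding good_def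
        by (metis less_le_trans zero_less_power zero_less_divide_iff zero_less_numeral)
      then have "hit n t u \<inter> openings M \<xi> (n * r) \<noteq> {}" by (metis card.empty less_irrefl of_nat_0)
      then obtain A x where A: "A \<in> openings M \<xi> (n * r)" "A \<in> words M (n * r)"
          "x \<in> core \<rho>" "rel t u (cube_map M A x)"
        by (auto simp: hit_def)
      then have "x \<in> unit_cube" using core_subset_unit_cube[of \<rho>] \<rho> by auto
      then have "cube_map M A x \<in> ?Y \<inter> cube M A"
        using A cube_map_in_unit_cube[OF A(2) _ M_ge_1] by (auto simp: cube_def)
      then show "\<exists>A\<in>openings M \<xi> (n * r). ?Y \<inter> cube M A \<noteq> {}" using A(1) by blast
    qed
    then show ?thesis by auto
  qed
  ultimately show ?thesis
    using dQ by (intro exI[of _ Q] conjI allI impI ballI) simp_all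
qed

end

section \<open>Survival and a zero-one law\<close>

definition survives :: "nat \<Rightarrow> (('d::finite) word \<Rightarrow> bool) \<Rightarrow> bool"
  where "survives M \<xi> \<longleftrightarrow> (\<forall>n\<in>UNIV. openings M \<xi> n \<noteq> {})"

lemma survivesD: "survives M \<xi> \<Longrightarrow> openings M \<xi> n \<noteq> {}"
  by (auto simp: survives_def)

lemma limit_set_survives: "limit_set M \<xi> \<noteq> {} \<Longrightarrow> survives M \<xi>"
  using limit_set_nonempty_survives by (auto simp: survives_def)

lemma determined_survives: "determined (tree_words M) (survives M)"
  unfolding survives_def[abs_def] by (intro determined_ball determined_openings_level) auto

lemma child_survives:
  assumes "A \<in> openings M \<xi> m" "survives M (below \<xi> A)"
  shows "survives M \<xi>"
  unfolding survives_def
proof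
  fix n
  obtain B where B: "B \<in> openings M (below \<xi> A) n" using survivesD[OF assms(2)] by blast
  then have "A @ B \<in> openings M \<xi> (m + n)"
    using assms(1) openings_append openings_subset by (metis subsetD)
  then show "openings M \<xi> n \<noteq> {}" using openings_mono[of M \<xi> "m + n" n] by auto
qed

text \<open>Finitely many open children that die out have a common depth m by which all of them are
  extinct; nothing is left at depth m + 1.\<close>

lemma survives_iff_child:
  "\<not> survives M \<xi> \<longleftrightarrow> (\<forall>C\<in>digits M. \<xi> [C] \<longrightarrow> \<not> survives M (below \<xi> [C]))"
proof
  assume *: "\<not> survives M \<xi>"
  have "\<not> survives M (below \<xi> [C])" if "C \<in> digits M" "\<xi> [C]" for C
    using child_survives[of "[C]" M \<xi> "Suc 0"] that * by (auto simp: openings_1)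
  then show "\<forall>C\<in>digits M. \<xi> [C] \<longrightarrow> \<not> survives M (below \<xi> [C])" by blast
next
  assume "\<forall>C\<in>digits M. \<xi> [C] \<longrightarrow> \<not> survives M (below \<xi> [C])"
  then have "\<forall>C\<in>digits M. \<exists>n. \<xi> [C] \<longrightarrow> openings M (below \<xi> [C]) n = {}" by (auto simp: survives_def)
  then obtain n where n: "\<And>C. C \<in> digits M \<Longrightarrow> \<xi> [C] \<Longrightarrow> openings M (below \<xi> [C]) (n C) = {}"
    by metis
  \<comment> \<open>The inserted 0 keeps the maximum meaningful when there are no digits,
    \<open>M\<close> being arbitrary here.\<close>
  define m where "m = Max (insert 0 (n ` digits M))"
  have m: "n C \<le> m" if "C \<in> digits M" for C using that by (simp add: m_def)
  have "openings M \<xi> (Suc m) = {}"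
  proof (rule ccontr)
    assume "openings M \<xi> (Suc m) \<noteq> {}"
    then obtain D where D: "D \<in> openings M \<xi> (Suc m)" by blast
    then obtain C A where CA: "D = C # A" "C \<in> digits M" "A \<in> words M m"
      using openings_subset[of M \<xi> "Suc m"] by (auto simp: words_Suc)
    then have "\<xi> [C] \<and> A \<in> openings M (below \<xi> [C]) m"
      using openings_append[of "[C]" M "Suc 0" A m \<xi>] D by (simp add: words_1 openings_1)
    then show False using openings_mono[of M "below \<xi> [C]" m "n C"] n[OF CA(2)] m[OF CA(2)] by auto
  qed
  then show "\<not> survives M \<xi>" by (auto simp: survives_def)
qed

text \<open>A full generation is demanded so that a digit can be chosen afterwards, in dependence on
  the centre.\<close>

definition all_children :: "nat \<Rightarrow> ((('d::finite) word \<Rightarrow> bool) \<Rightarrow> bool) \<Rightarrow> ('d word \<Rightarrow> bool) \<Rightarrow> bool"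
  where "all_children M \<Phi> \<xi> \<longleftrightarrow> (\<forall>C\<in>digits M. \<xi> [C] \<and> \<Phi> (below \<xi> [C]))"

lemma all_childrenD:
  assumes "all_children M \<Phi> \<xi>" "C \<in> digits M"
  shows "[C] \<in> openings M \<xi> (Suc 0)" "\<Phi> (below \<xi> [C])"
  using assms by (auto simp: all_children_def openings_1)

text \<open>With g the product and g(1) = 1, strict convexity on the segment from e to 1 would give
  g(u) < u for any u strictly between the two. Strictness stems from multiplying at least two
  nonconstant affine factors.\<close>

lemma generating_function_strictly_convex:
  fixes p :: "'c \<Rightarrow> real"
  assumes "finite D" "2 \<le> card D" "\<And>C. C \<in> D \<Longrightarrow> 0 < p C \<and> p C < 1"
    "0 \<le> e" "e \<le> u" "u < 1" "e = (\<Prod>C\<in>D. 1 - p C + p C * e)" "u \<le> (\<Prod>C\<in>D. 1 - p C + p C * u)"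
  shows "u = e"
proof (rule ccontr)
  assume "u \<noteq> e"
  then have eu: "e < u" "e < 1" using assms by auto
  define l where "l = (1 - u) / (1 - e)"
  have l: "0 < l" "l < 1" using eu assms(6) by (auto simp: l_def field_simps)
  have "l * (1 - e) = 1 - u" using eu by (simp add: l_def)
  then have u: "u = l * e + (1 - l)" by (simp add: algebra_simps)
  define g where "g X s = (\<Prod>C\<in>X. 1 - p C + p C * s)" for X s
  have pos: "0 < 1 - p C + p C * s" if "C \<in> D" "0 \<le> s" for C s
    using assms(3)[OF that(1)] that(2) by (intro add_pos_nonneg) auto
  have lt1: "1 - p C + p C * e < 1" if "C \<in> D" for C
    using assms(3)[OF that] eu by simp
  \<comment> \<open>Convexity along the segment, by induction on the factors. The bounds on
    \<open>g X e\<close> are carried along because they decide the sign of the error term.\<close>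
  have key: "g X u \<le> l * g X e + (1 - l) \<and> g X e \<le> 1 \<and>
      (X \<noteq> {} \<longrightarrow> g X e < 1) \<and> (2 \<le> card X \<longrightarrow> g X u < l * g X e + (1 - l))" if "X \<subseteq> D" for X
    using finite_subset[OF that assms(1)] that
  proof (induction X rule: finite_induct)
    case empty
    then show ?case by (simp add: g_def)
  next
    case (insert C X)
    then have IH: "g X u \<le> l * g X e + (1 - l)" "g X e \<le> 1" "X \<noteq> {} \<Longrightarrow> g X e < 1" and C: "C \<in> D"
      by auto
    define b where "b = 1 - p C + p C * e"
    have b: "0 < b" "b < 1" using pos[OF C assms(4)] lt1[OF C] by (auto simp: b_def)
    have bu: "1 - p C + p C * u = l * b + (1 - l)" by (simp add: b_def u algebra_simps)
    have gi: "g (insert C X) s = (1 - p C + p C * s) * g X s" for s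
      using insert by (simp add: g_def)
    have g0: "0 < g X e" unfolding g_def using insert pos assms(4) by (intro prod_pos) auto
    have "g (insert C X) u \<le> (l * b + (1 - l)) * (l * g X e + (1 - l))"
      unfolding gi bu using IH(1) l b by (intro mult_left_mono) auto
    \<comment> \<open>The product of two chords lies below the chord of the product by a mixed term,
      which is positive as soon as both factors are below 1 at \<open>e\<close>.\<close>
    also have "\<dots> = l * g (insert C X) e + (1 - l) - l * (1 - l) * ((1 - b) * (1 - g X e))"
      unfolding gi b_def[symmetric] by (simp add: algebra_simps)
    finally have le: "g (insert C X) u \<le> l * g (insert C X) e + (1 - l) - l * (1 - l) * ((1 - b) * (1 - g X e))" .
    have "0 \<le> l * (1 - l) * ((1 - b) * (1 - g X e))" using l b IH(2) by simp
    moreover have "0 < l * (1 - l) * ((1 - b) * (1 - g X e))" if "2 \<le> card (insert C X)"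
    proof -
      have "X \<noteq> {}" using that by auto
      then show ?thesis using l b IH(3) by simp
    qed
    moreover have "g (insert C X) e < 1"
    proof -
      have "b * g X e \<le> b * 1" using IH(2) b by (intro mult_left_mono) auto
      then show ?thesis unfolding gi b_def[symmetric] using b by linarith
    qed
    ultimately show ?case using le by force
  qed
  have "u < l * g D e + (1 - l)" using key[of D] assms(2,8) by (simp add: g_def)
  then show False using u assms(7) by (simp add: g_def)
qed

section \<open>The zero-one law on survival\<close>

context percolation
begin

lemma card_digits_ge_2: "2 \<le> card (digits M :: (nat ^ 'd) set)"
proof -
  let ?a = "(\<chi> i. 0) :: nat ^ 'd" and ?b = "(\<chi> i. 1) :: nat ^ 'd"
  have "{?a, ?b} \<subseteq> digits M" using M_ge_2 by (auto simp: digits_def)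
  then have "card {?a, ?b} \<le> card (digits M :: (nat ^ 'd) set)" by (intro card_mono) auto
  moreover have "?a \<noteq> ?b" by (simp add: vec_eq_iff)
  ultimately show ?thesis by simp
qed

lemma determined_open_child:
  assumes "C \<in> digits M" "determined (tree_words M) \<Phi>"
  shows "determined (tree_words M) (\<lambda>\<xi>. \<xi> [C] \<and> \<Phi> (below \<xi> [C]))"
  using assms(1)
  by (intro determined_conj determined_component determined_below[OF assms(2), of _ 1])
    (auto simp: tree_words_iff words_1)

lemma tree_prob_all_children:
  assumes "determined (tree_words M) \<Phi>"
  shows "tree_prob (all_children M \<Phi>) = (\<Prod>C\<in>digits M. p C * tree_prob \<Phi>)"
proof -
  have "tree_prob (\<lambda>\<xi>. \<forall>C\<in>digits M. \<xi> [C] \<and> \<Phi> (below \<xi> [C])) =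
      (\<Prod>C\<in>digits M. tree_prob (\<lambda>\<xi>. \<xi> [C] \<and> \<Phi> (below \<xi> [C])))"
    by (rule tree_prob_children[where \<Theta> = "\<lambda>C b \<xi>. b \<and> \<Phi> \<xi>"])
      (use assms determined_open_child in \<open>auto intro: determined_conj determined_const\<close>)
  then show ?thesis using tree_prob_child[OF _ assms] by (simp add: all_children_def[abs_def])
qed

lemma determined_all_children:
  assumes "determined (tree_words M) \<Phi>"
  shows "determined (tree_words M) (all_children M \<Phi>)"
  unfolding all_children_def[abs_def]
  by (intro determined_ball countable_finite determined_open_child assms) auto

text \<open>The product is the offspring generating function evaluated at the probability of
  \<Phi>.\<close>

lemma tree_prob_no_open_child:
  assumes "determined (tree_words M) \<Phi>"
  shows "tree_prob (\<lambda>\<xi>. \<forall>C\<in>digits M. \<xi> [C] \<longrightarrow> \<Phi> (below \<xi> [C])) =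
    (\<Prod>C\<in>digits M. 1 - p C + p C * tree_prob \<Phi>)"
proof -
  have n: "determined (tree_words M) (\<lambda>\<xi>. \<not> \<Phi> \<xi>)" by (rule determined_not[OF assms])
  have eq: "(\<lambda>\<xi>. \<xi> [C] \<longrightarrow> \<Phi> (below \<xi> [C])) = (\<lambda>\<xi>. \<not> (\<xi> [C] \<and> \<not> \<Phi> (below \<xi> [C])))" for C
    by auto
  have d: "determined (tree_words M) (\<lambda>\<xi>. \<xi> [C] \<longrightarrow> \<Phi> (below \<xi> [C]))" if "C \<in> digits M" for C
    unfolding eq by (rule determined_not[OF determined_open_child[OF that n]])
  have "tree_prob (\<lambda>\<xi>. \<xi> [C] \<longrightarrow> \<Phi> (below \<xi> [C])) = 1 - p C + p C * tree_prob \<Phi>"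
    if "C \<in> digits M" for C
    unfolding eq tree_prob_not[OF determined_open_child[OF that n]] tree_prob_child[OF that n]
      tree_prob_not[OF assms] by (simp add: algebra_simps)
  moreover have "tree_prob (\<lambda>\<xi>. \<forall>C\<in>digits M. \<xi> [C] \<longrightarrow> \<Phi> (below \<xi> [C])) =
      (\<Prod>C\<in>digits M. tree_prob (\<lambda>\<xi>. \<xi> [C] \<longrightarrow> \<Phi> (below \<xi> [C])))"
  proof (rule tree_prob_children[where \<Theta> = "\<lambda>C b \<xi>. b \<longrightarrow> \<Phi> \<xi>"])
    show "determined (tree_words M) (\<lambda>\<xi>. b \<longrightarrow> \<Phi> \<xi>)" for b
      by (cases b) (simp_all add: assms determined_const)
  qed (rule d, assumption, rule refl)
  ultimately show ?thesis by simp
qed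

text \<open>Retention is a premise rather than the range of the quantifier; the quantifiers then
  range over nonrandom countable sets, as measurability wants.\<close>

definition never :: "(('d word \<Rightarrow> bool) \<Rightarrow> bool) \<Rightarrow> ('d word \<Rightarrow> bool) \<Rightarrow> bool"
  where "never Q \<xi> \<longleftrightarrow> (\<forall>n\<in>UNIV. \<forall>B\<in>words M n. B \<in> openings M \<xi> n \<longrightarrow> \<not> Q (below \<xi> B))"

lemma determined_never:
  assumes "determined (tree_words M) Q"
  shows "determined (tree_words M) (never Q)"
proof -
  have "never Q = (\<lambda>\<xi>. \<forall>n\<in>UNIV. \<forall>B\<in>words M n. \<not> (B \<in> openings M \<xi> n \<and> Q (below \<xi> B)))"
    by (auto simp: never_def fun_eq_iff)
  moreover have "determined (tree_words M) \<dots>"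
  proof (rule determined_ball, simp, rule determined_ball)
    fix n and B :: "'d word" assume "B \<in> words M n"
    then show "determined (tree_words M) (\<lambda>\<xi>. \<not> (B \<in> openings M \<xi> n \<and> Q (below \<xi> B)))"
      by (intro determined_not determined_conj determined_openings_level determined_below[OF assms])
  qed (auto intro: countable_finite)
  ultimately show ?thesis by simp
qed

lemma never_child:
  assumes "never Q \<xi>" "C \<in> digits M" "\<xi> [C]"
  shows "never Q (below \<xi> [C])"
  unfolding never_def
proof (intro ballI impI)
  fix n B assume B: "B \<in> words M n" "B \<in> openings M (below \<xi> [C]) n"
  then have "[C] @ B \<in> openings M \<xi> (Suc 0 + n)"
    using openings_append[of "[C]" M "Suc 0" B n \<xi>] assms by (simp add: words_1 openings_1)
  moreover have "[C] @ B \<in> words M (Suc 0 + n)"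
    using B(1) assms(2) by (intro words_append) (simp_all add: words_1)
  ultimately have "\<not> Q (below \<xi> ([C] @ B))" using assms(1) unfolding never_def by blast
  then show "\<not> Q (below (below \<xi> [C]) B)" by (simp add: below_below)
qed

text \<open>Both the extinction probability \<open>e\<close> and the probability \<open>u \<ge> e\<close> of dying out or never seeing
  \<open>Q\<close> satisfy \<open>u \<le> g u\<close> for the strictly convex generating function \<open>g\<close>, which fixes \<open>e\<close> and \<open>1\<close>.\<close>

lemma tree_prob_survives_never:
  assumes Q: "determined (tree_words M) Q" and pos: "0 < tree_prob Q"
    and surv: "\<And>\<xi>. Q \<xi> \<Longrightarrow> survives M \<xi>"
  shows "tree_prob (\<lambda>\<xi>. survives M \<xi> \<and> never Q \<xi>) = 0"
proof -
  define ext where "ext \<xi> \<longleftrightarrow> \<not> survives M \<xi>" for \<xi> :: "'d word \<Rightarrow> bool"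
  define U where "U \<xi> \<longleftrightarrow> never Q \<xi> \<or> ext \<xi>" for \<xi>
  have dext: "determined (tree_words M) ext"
    unfolding ext_def[abs_def] by (rule determined_not[OF determined_survives])
  have dU: "determined (tree_words M) U"
    unfolding U_def[abs_def] by (rule determined_disj[OF determined_never[OF Q] dext])
  have ext_eq: "ext = (\<lambda>\<xi>. \<forall>C\<in>digits M. \<xi> [C] \<longrightarrow> ext (below \<xi> [C]))"
    unfolding ext_def[abs_def] by (intro ext survives_iff_child)
  have e: "tree_prob ext = (\<Prod>C\<in>digits M. 1 - p C + p C * tree_prob ext)"
    by (subst ext_eq, rule tree_prob_no_open_child[OF dext])
  have "determined (tree_words M) (\<lambda>\<xi>. \<forall>C\<in>digits M. \<not> (\<xi> [C] \<and> \<not> U (below \<xi> [C])))"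
    by (intro determined_ball countable_finite determined_not determined_open_child dU) auto
  then have "determined (tree_words M) (\<lambda>\<xi>. \<forall>C\<in>digits M. \<xi> [C] \<longrightarrow> U (below \<xi> [C]))"
    by simp
  then have "tree_prob U \<le> tree_prob (\<lambda>\<xi>. \<forall>C\<in>digits M. \<xi> [C] \<longrightarrow> U (below \<xi> [C]))"
  proof (rule tree_prob_mono)
    fix \<xi> assume U: "U \<xi>"
    then show "\<forall>C\<in>digits M. \<xi> [C] \<longrightarrow> U (below \<xi> [C])"
      using never_child[of Q \<xi>] survives_iff_child[of M \<xi>] unfolding U_def ext_def by blast
  qed
  then have u: "tree_prob U \<le> (\<Prod>C\<in>digits M. 1 - p C + p C * tree_prob U)"
    by (simp only: tree_prob_no_open_child[OF dU])
  \<comment> \<open>The root itself witnesses \<open>Q\<close>, and \<open>Q\<close> forces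
    survival, so \<open>U\<close> excludes \<open>Q\<close>. This keeps the probability of
    \<open>U\<close> away from the fixed point 1.\<close>
  have "tree_prob U \<le> tree_prob (\<lambda>\<xi>. \<not> Q \<xi>)"
  proof (rule tree_prob_mono[OF determined_not[OF Q]])
    fix \<xi> assume U: "U \<xi>"
    show "\<not> Q \<xi>"
    proof
      assume "Q \<xi>"
      then have "\<not> never Q \<xi>"
        unfolding never_def by (auto intro!: exI[of _ 0])
      with U surv[OF \<open>Q \<xi>\<close>] show False by (simp add: U_def ext_def)
    qed
  qed
  then have u1: "tree_prob U < 1" using pos by (simp add: tree_prob_not[OF Q])
  have eu: "tree_prob ext \<le> tree_prob U"
    by (rule tree_prob_mono[OF dU]) (simp add: U_def)
  have "tree_prob U = tree_prob ext"
    by (rule generating_function_strictly_convex[OF finite_digits card_digits_ge_2 p_bounds _ eu u1 e u]) auto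
  moreover have "tree_prob U = tree_prob (\<lambda>\<xi>. U \<xi> \<and> survives M \<xi>) + tree_prob (\<lambda>\<xi>. U \<xi> \<and> \<not> survives M \<xi>)"
    by (rule tree_prob_split[OF dU determined_survives])
  moreover have "(\<lambda>\<xi>. U \<xi> \<and> survives M \<xi>) = (\<lambda>\<xi>. survives M \<xi> \<and> never Q \<xi>)"
    "(\<lambda>\<xi>. U \<xi> \<and> \<not> survives M \<xi>) = ext"
    by (auto simp: U_def ext_def fun_eq_iff)
  ultimately show ?thesis by simp
qed

text \<open>The exceptional event has probability 0 in every subtree by self-similarity, and there
  are countably many words, so a single null set serves all subtrees.\<close>

theorem survival_reaches:
  assumes Q: "determined (tree_words M) Q" and pos: "0 < tree_prob Q"
    and surv: "\<And>\<xi>. Q \<xi> \<Longrightarrow> survives M \<xi>"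
  shows "AE \<omega> in P. \<forall>m. \<forall>B\<in>words M m. survives M (below (\<lambda>A. c A \<omega>) B) \<longrightarrow>
    (\<exists>n. \<exists>D\<in>openings M (below (\<lambda>A. c A \<omega>) B) n. Q (below (\<lambda>A. c A \<omega>) (B @ D)))"
proof -
  let ?\<Phi> = "\<lambda>\<xi>. survives M \<xi> \<and> never Q \<xi>"
  have d: "determined (tree_words M) ?\<Phi>"
    by (rule determined_conj[OF determined_survives determined_never[OF Q]])
  have "AE \<omega> in P. \<not> ?\<Phi> (below (\<lambda>A. c A \<omega>) B)" if B: "B \<in> words M m" for B m
  proof -
    let ?N = "{\<omega> \<in> space P. ?\<Phi> (below (\<lambda>A. c A \<omega>) B)}"
    have "?N \<in> events" by (rule determined_event[OF determined_below[OF d B]]) simp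
    moreover have "prob ?N = 0"
      using tree_prob_below[OF B d] tree_prob_survives_never[OF assms] by (simp add: tree_prob_def)
    ultimately show ?thesis by (subst AE_iff_measurable[of ?N]) (auto simp: emeasure_eq_measure)
  qed
  then have "AE \<omega> in P. \<forall>m. \<forall>B\<in>words M m. \<not> ?\<Phi> (below (\<lambda>A. c A \<omega>) B)"
    by (subst AE_all_countable, intro allI, subst AE_ball_countable) (auto intro: countable_finite)
  then show ?thesis
  proof (rule AE_mp, intro AE_I2 impI allI ballI)
    fix \<omega> m B assume *: "\<forall>m. \<forall>B\<in>words M m. \<not> ?\<Phi> (below (\<lambda>A. c A \<omega>) B)"
      "B \<in> words M m" "survives M (below (\<lambda>A. c A \<omega>) B)"
    then have "\<not> never Q (below (\<lambda>A. c A \<omega>) B)" by blast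
    then show "\<exists>n. \<exists>D\<in>openings M (below (\<lambda>A. c A \<omega>) B) n. Q (below (\<lambda>A. c A \<omega>) (B @ D))"
      unfolding never_def by (auto simp: below_below)
  qed
qed

end

section \<open>Projections along a plane and Condition A\<close>

lemma subspace_coord_span: "subspace (coord_span J)"
  by (simp add: coord_span_def)

lemma coord_span_nth:
  assumes "y \<in> coord_span J" "i \<notin> J"
  shows "y $ i = 0"
proof -
  have "subspace {y :: real ^ 'a. y $ i = 0}" by (auto simp: subspace_def)
  moreover have "(\<lambda>i. axis i 1) ` J \<subseteq> {y. y $ i = 0}" using assms(2) by (auto simp: axis_def)
  ultimately have "coord_span J \<subseteq> {y. y $ i = 0}" unfolding coord_span_def by (rule span_minimal[rotated])
  then show ?thesis using assms(1) by auto
qed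

lemma dim_coord_span: "dim (coord_span (J :: 'd::finite set)) = card J"
proof -
  have sub: "(\<lambda>i. axis i (1::real)) ` J \<subseteq> (Basis :: (real ^ 'd) set)" by (auto simp: Basis_vec_def)
  have "independent ((\<lambda>i. axis i (1::real)) ` J)" by (rule independent_mono[OF independent_Basis sub])
  then have "dim (coord_span J) = card ((\<lambda>i. axis i (1::real)) ` J)"
    unfolding coord_span_def by (rule dim_span_eq_card_independent)
  also have "\<dots> = card J" by (rule card_image) (auto simp: inj_on_def axis_eq_axis)
  finally show ?thesis .
qed

lemma orthonormal_independent:
  assumes "orthonormal_set \<alpha>"
  shows "independent \<alpha>"
  using assms unfolding orthonormal_set_def
  by (intro pairwise_orthogonal_independent) auto

lemma dim_orthogonal_comp_span:
  fixes \<alpha> :: "(real ^ 'd::finite) set"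
  assumes "orthonormal_set \<alpha>"
  shows "dim ((span \<alpha>)\<^sup>\<bottom>) + card \<alpha> = CARD('d)"
proof -
  have "dim {y \<in> UNIV. \<forall>x\<in>span \<alpha>. orthogonal x y} + dim (span \<alpha>) = dim (UNIV :: (real ^ 'd) set)"
    by (rule dim_subspace_orthogonal_to_vectors) auto
  then show ?thesis
    using dim_span_eq_card_independent[OF orthonormal_independent[OF assms]]
    by (simp add: orthogonal_comp_def dim_UNIV)
qed

text \<open>A vector of \<open>(span \<alpha>)\<^sup>\<bottom>\<close> is a combination of the
  columns \<open>cs\<close>. If its entries outside \<open>J\<close> vanish, its coefficients lie in
  the kernel of the minor, whose determinant is nonzero.\<close>

lemma admissible_coords_transversal:
  fixes \<alpha> :: "(real ^ 'd::finite) set"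
  assumes on: "orthonormal_set \<alpha>" and adm: "admissible_coords \<alpha> J"
    and y: "y \<in> (span \<alpha>)\<^sup>\<bottom>" "y \<in> coord_span J"
  shows "y = 0"
proof -
  define m where "m = CARD('d) - card \<alpha>"
  obtain cs js where cs: "distinct cs" "orthonormal_set (set cs)" "span (set cs) = (span \<alpha>)\<^sup>\<bottom>"
    and js: "distinct js" "set js = UNIV - J" and cJ: "card J = card \<alpha>"
    and det: "\<bar>Determinant.det (Matrix.mat m m (\<lambda>(r, s). (cs ! s) $ (js ! r)))\<bar>
          > 1 / (2 * sqrt (real (CARD('d) choose card \<alpha>)))"
    using adm unfolding admissible_coords_def m_def[symmetric] by (auto simp: Let_def m_def)
  have "length cs = dim (span (set cs))"
    using dim_span_eq_card_independent[OF orthonormal_independent[OF cs(2)]] distinct_card[OF cs(1)] by simp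
  then have lcs: "length cs = m"
    using dim_orthogonal_comp_span[OF on] cs(3) by (simp add: m_def)
  have "length js = card (UNIV - J)" using distinct_card[OF js(1)] js(2) by simp
  then have ljs: "length js = m" using cJ by (simp add: m_def card_Diff_subset)
  define X where "X = Matrix.mat m m (\<lambda>(r, s). (cs ! s) $ (js ! r))"
  have X: "X \<in> carrier_mat m m" by (simp add: X_def)
  have "0 \<le> 1 / (2 * sqrt (real (CARD('d) choose card \<alpha>)))" by simp
  then have detX: "Determinant.det X \<noteq> 0" using det unfolding X_def by linarith
  have "y \<in> span (set cs)" using y(1) cs(3) by simp
  then obtain u where u: "y = (\<Sum>v\<in>set cs. u v *\<^sub>R v)"
    unfolding span_finite[OF finite_set] by auto
  define w where "w = Matrix.vec m (\<lambda>s. u (cs ! s))"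
  have ysum: "y = (\<Sum>s<m. u (cs ! s) *\<^sub>R (cs ! s))"
    unfolding u using sum.reindex_bij_betw[OF bij_betw_nth[OF cs(1) refl refl], of "\<lambda>v. u v *\<^sub>R v"]
    by (simp add: lcs)
  have "X *\<^sub>v w = 0\<^sub>v m"
  proof (rule eq_vecI)
    fix r assume "r < dim_vec (0\<^sub>v m :: real Matrix.vec)"
    then have r: "r < m" by simp
    have "js ! r \<notin> J" using r ljs js(2) nth_mem[of r js] by auto
    then have "0 = y $ (js ! r)" using coord_span_nth[OF y(2)] by simp
    also have "\<dots> = (\<Sum>s<m. u (cs ! s) * (cs ! s) $ (js ! r))"
      unfolding ysum by simp
    also have "\<dots> = vec_index (X *\<^sub>v w) r"
      using r by (simp add: X_def w_def scalar_prod_def atLeast0LessThan mult.commute)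
    finally show "vec_index (X *\<^sub>v w) r = vec_index (0\<^sub>v m) r" using r by simp
  qed (simp add: X_def)
  moreover have "w \<in> carrier_vec m" by (simp add: w_def)
  ultimately have "w = 0\<^sub>v m" using det_0_iff_vec_prod_zero[OF X] detX by blast
  then have "u (cs ! s) = 0" if "s < m" for s
    using that by (metis index_vec index_zero_vec(1) w_def)
  then show ?thesis unfolding ysum by simp
qed

lemma mem_core_iff: "x \<in> core \<rho> \<longleftrightarrow> (\<forall>i. 1/2 - \<rho>/2 \<le> x $ i \<and> x $ i \<le> 1/2 + \<rho>/2)"
proof -
  have "\<bar>a - 1/2\<bar> \<le> \<rho>/2 \<longleftrightarrow> 1/2 - \<rho>/2 \<le> a \<and> a \<le> 1/2 + \<rho>/2" for a :: real by linarith
  then show ?thesis by (simp only: core_def mem_Collect_eq)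
qed

lemma core_1: "core 1 = unit_cube"
  by (intro Set.set_eqI) (simp add: mem_core_iff unit_cube_def)

lemma compact_core: "compact (core \<rho> :: (real ^ 'd::finite) set)"
proof -
  have "core \<rho> = cbox (\<chi> i. 1/2 - \<rho>/2) (\<chi> i. 1/2 + \<rho>/2 :: real ^ 'd)"
    by (intro Set.set_eqI) (simp add: mem_core_iff mem_box_cart)
  then show ?thesis by simp
qed

lemma core_mono: "\<rho> \<le> \<rho>' \<Longrightarrow> core \<rho> \<subseteq> core \<rho>'"
proof
  fix x :: "real ^ 'a" assume "\<rho> \<le> \<rho>'" "x \<in> core \<rho>"
  moreover from this have "1/2 - \<rho>'/2 \<le> 1/2 - \<rho>/2" "1/2 + \<rho>/2 \<le> 1/2 + \<rho>'/2" by auto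
  ultimately show "x \<in> core \<rho>'" unfolding mem_core_iff by (meson order_trans)
qed

lemma core_eq_scaled:
  fixes z :: "real ^ 'd::finite"
  assumes "\<rho> > 0" and z: "z = (\<chi> i. 1/2)"
  shows "core \<rho> = (\<lambda>x. z + \<rho> *\<^sub>R (x - z)) ` unit_cube"
proof (intro equalityI subsetI)
  fix x :: "real ^ 'd" assume x: "x \<in> core \<rho>"
  let ?y = "z + (1 / \<rho>) *\<^sub>R (x - z)"
  have "?y \<in> core 1" unfolding core_def
  proof clarify
    fix i
    have "\<bar>x $ i - 1/2\<bar> \<le> \<rho> / 2" using x by (simp add: core_def)
    then have "\<bar>x $ i - 1/2\<bar> / \<rho> \<le> 1 / 2" using assms by (simp add: field_simps)
    then show "\<bar>?y $ i - 1/2\<bar> \<le> 1 / 2" using assms by (simp add: abs_divide)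
  qed
  moreover have "x = z + \<rho> *\<^sub>R (?y - z)" using assms by simp
  ultimately show "x \<in> (\<lambda>x. z + \<rho> *\<^sub>R (x - z)) ` unit_cube" unfolding core_1 by blast
next
  fix x assume "x \<in> (\<lambda>x. z + \<rho> *\<^sub>R (x - z)) ` unit_cube"
  then obtain y where y: "y \<in> core 1" "x = z + \<rho> *\<^sub>R (y - z)" unfolding core_1 by blast
  show "x \<in> core \<rho>" unfolding core_def
  proof clarify
    fix i
    have "\<bar>y $ i - 1/2\<bar> \<le> 1/2" using y(1) by (simp add: core_def)
    then have "\<rho> * \<bar>y $ i - 1/2\<bar> \<le> \<rho> * (1/2)" using assms by (intro mult_left_mono) auto
    then show "\<bar>x $ i - 1/2\<bar> \<le> \<rho> / 2" using assms by (simp add: y(2) abs_mult)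
  qed
qed

section \<open>The oblique projection of a transversal plane\<close>

locale transversal_plane =
  fixes \<alpha> :: "(real ^ 'd::finite) set" and J :: "'d set"
  assumes orthonormal: "orthonormal_set \<alpha>" and admissible: "admissible_coords \<alpha> J"
    and card_ge_1: "card \<alpha> \<ge> 1"
begin

abbreviation W where "W \<equiv> (span \<alpha>)\<^sup>\<bottom>"
abbreviation V where "V \<equiv> coord_span J"
abbreviation Pi where "Pi \<equiv> plane_proj \<alpha> J"

lemma subspace_W: "subspace W"
  by (rule subspace_orthogonal_comp)

lemma card_J: "card J = card \<alpha>"
  using admissible by (simp add: admissible_coords_def)

lemma unique: "y \<in> W \<Longrightarrow> y \<in> V \<Longrightarrow> y = 0"
  by (rule admissible_coords_transversal[OF orthonormal admissible])

text \<open>Dimension count: the two subspaces meet only in 0, and their dimensions add up to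
  d.\<close>

lemma decompose: "\<exists>v\<in>W. x + v \<in> V"
proof -
  let ?S = "{x + y |x y. x \<in> W \<and> y \<in> V}"
  have "dim ?S + dim (W \<inter> V) = dim W + dim V"
    by (rule dim_sums_Int[OF subspace_W subspace_coord_span])
  moreover have "W \<inter> V = {0}"
    using unique subspace_0[OF subspace_W] subspace_0[OF subspace_coord_span] by auto
  ultimately have "dim ?S = CARD('d)"
    using dim_orthogonal_comp_span[OF orthonormal] dim_coord_span[of J] card_J by simp
  then have "span ?S = UNIV" using dim_eq_full[of ?S] by (simp add: dim_UNIV)
  moreover have "subspace ?S" by (rule subspace_sums[OF subspace_W subspace_coord_span])
  then have "span ?S = ?S" by (simp only: span_eq_iff)
  ultimately have "x \<in> ?S" by blast
  then obtain w v where "x = w + v" "w \<in> W" "v \<in> V" by blast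
  then have "- w \<in> W" "x + - w \<in> V" using subspace_neg[OF subspace_W] by simp_all
  then show ?thesis by (rule bexI[rotated])
qed

lemma Pi_ex1: "\<exists>!y. y \<in> ((\<lambda>v. x + v) ` W) \<inter> V"
proof -
  obtain v where v: "v \<in> W" "x + v \<in> V" using decompose by blast
  show ?thesis
  proof (rule ex1I[of _ "x + v"])
    fix y assume y: "y \<in> ((\<lambda>v. x + v) ` W) \<inter> V"
    then obtain v' where v': "y = x + v'" "v' \<in> W" by blast
    have "v' - v \<in> W" using subspace_diff[OF subspace_W] v v' by blast
    moreover have "v' - v = y - (x + v)" using v' by simp
    then have "v' - v \<in> V" using subspace_diff[OF subspace_coord_span] v y by (metis IntD2)
    ultimately show "y = x + v" using unique v' by fastforce
  qed (use v in auto)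
qed

lemma Pi_props: "Pi x \<in> V" "Pi x - x \<in> W"
  using theI'[OF Pi_ex1[of x]] unfolding plane_proj_def by auto

lemma Pi_eqI:
  assumes "y \<in> V" "y - x \<in> W"
  shows "Pi x = y"
proof -
  have "(Pi x - x) - (y - x) \<in> W" by (rule subspace_diff[OF subspace_W Pi_props(2) assms(2)])
  then have "Pi x - y \<in> W" by simp
  moreover have "Pi x - y \<in> V" by (rule subspace_diff[OF subspace_coord_span Pi_props(1) assms(1)])
  ultimately show ?thesis using unique by fastforce
qed

lemma linear_Pi: "linear Pi"
proof (rule linearI)
  show "Pi (x + y) = Pi x + Pi y" for x y
  proof (rule Pi_eqI)
    have "Pi x + Pi y - (x + y) = (Pi x - x) + (Pi y - y)" by simp
    then show "Pi x + Pi y - (x + y) \<in> W" using subspace_add[OF subspace_W] Pi_props by metis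
  qed (rule subspace_add[OF subspace_coord_span Pi_props(1) Pi_props(1)])
  show "Pi (r *\<^sub>R x) = r *\<^sub>R Pi x" for r x
  proof (rule Pi_eqI)
    have "r *\<^sub>R Pi x - r *\<^sub>R x = r *\<^sub>R (Pi x - x)" by (simp add: scaleR_diff_right)
    then show "r *\<^sub>R Pi x - r *\<^sub>R x \<in> W" using subspace_scale[OF subspace_W Pi_props(2)] by metis
  qed (rule subspace_scale[OF subspace_coord_span Pi_props(1)])
qed

lemma Pi_eq_iff: "Pi x = Pi y \<longleftrightarrow> x - y \<in> W"
proof -
  have "Pi x = Pi y \<longleftrightarrow> Pi (x - y) = 0" using linear_diff[OF linear_Pi] by simp
  also have "\<dots> \<longleftrightarrow> x - y \<in> W"
  proof
    assume "Pi (x - y) = 0"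
    then have "- (x - y) \<in> W" using Pi_props(2)[of "x - y"] by simp
    then show "x - y \<in> W" using subspace_neg[OF subspace_W] by fastforce
  next
    assume "x - y \<in> W"
    then show "Pi (x - y) = 0"
      by (intro Pi_eqI subspace_0[OF subspace_coord_span]) (use subspace_neg[OF subspace_W] in force)
  qed
  finally show ?thesis .
qed

section \<open>From iterates of the operator to masses of words\<close>

lemma Pi_cube_map: "Pi (cube_map M A x) = (1 / real M ^ length A) *\<^sub>R Pi x + Pi (cube_map M A 0)"
  by (subst cube_map_affine) (simp add: linear_add[OF linear_Pi] linear_scale[OF linear_Pi])

text \<open>The map \<open>psi\<close> freed from its domain, the projected cube; being affine on
  the whole space, it composes along words.\<close>

definition unproj :: "nat \<Rightarrow> 'd word \<Rightarrow> real ^ 'd \<Rightarrow> real ^ 'd"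
  where "unproj M A y = (real M ^ length A) *\<^sub>R (y - Pi (cube_map M A 0))"

lemma Pi_cube_map_eq_iff:
  assumes "M \<ge> 1"
  shows "Pi (cube_map M A x) = y \<longleftrightarrow> Pi x = unproj M A y"
proof -
  define s where "s = real M ^ length A"
  define t where "t = Pi (cube_map M A 0)"
  have s: "s \<noteq> 0" using assms by (simp add: s_def)
  have "(1 / s) *\<^sub>R Pi x + t = y \<longleftrightarrow> (1 / s) *\<^sub>R Pi x = y - t" by (auto simp: algebra_simps)
  also have "\<dots> \<longleftrightarrow> Pi x = s *\<^sub>R (y - t)"
    using s by (metis inverse_eq_divide real_vector_affinity_eq scaleR_one scaleR_scaleR right_inverse left_inverse)
  finally show ?thesis unfolding unproj_def Pi_cube_map[of M A x] s_def t_def .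
qed

lemma unproj_Cons:
  assumes "M \<ge> 1"
  shows "unproj M (C # A) y = unproj M A (unproj M [C] y)"
proof -
  have "Pi (cube_map M (C # A) 0) = (1 / real M) *\<^sub>R Pi (cube_map M A 0) + Pi (cube_map M [C] 0)"
    by (subst cube_map_Cons) (simp add: Pi_cube_map[of M "[C]" "cube_map M A 0"])
  then show ?thesis using assms by (simp add: unproj_def algebra_simps)
qed

lemma psi_eq:
  assumes "M \<ge> 1" "y \<in> Pi ` cube M [C]"
  shows "psi M \<alpha> J [C] y = unproj M [C] y"
  unfolding psi_def
proof (rule the_equality)
  obtain x where x: "x \<in> unit_cube" "y = Pi (cube_map M [C] x)" using assms(2) by (auto simp: cube_def)
  then have "unproj M [C] y = Pi x" using Pi_cube_map_eq_iff[OF assms(1), of "[C]" x y] by simp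
  then show "\<exists>x\<in>unit_cube. unproj M [C] y = Pi x \<and> y = Pi (cube_map M [C] x)" using x by blast
next
  fix z assume "\<exists>x\<in>unit_cube. z = Pi x \<and> y = Pi (cube_map M [C] x)"
  then show "z = unproj M [C] y" using Pi_cube_map_eq_iff[OF assms(1)] by metis
qed

text \<open>Dropping the condition that the point lies in the projected cube only adds nonnegative
  terms. An upper bound is the useful direction, since Condition A bounds the iterate from
  below.\<close>

lemma F_op_le:
  fixes f :: "real ^ 'd \<Rightarrow> real"
  assumes "M \<ge> 1" "\<And>C. C \<in> digits M \<Longrightarrow> 0 \<le> p C" "\<And>y. 0 \<le> f y"
  shows "F_op M p \<alpha> J f y \<le> (\<Sum>C\<in>digits M. p C * f (unproj M [C] y))"
proof -
  have "F_op M p \<alpha> J f y = (\<Sum>C | C \<in> digits M \<and> y \<in> Pi ` cube M [C]. p C * f (unproj M [C] y))"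
    unfolding F_op_def by (rule sum.cong) (auto simp: psi_eq[OF assms(1)])
  also have "\<dots> \<le> (\<Sum>C\<in>digits M. p C * f (unproj M [C] y))"
    using assms by (intro sum_mono2) auto
  finally show ?thesis .
qed

lemma F_op_nonneg:
  assumes "\<And>C. C \<in> digits M \<Longrightarrow> 0 \<le> p C" "\<And>y. 0 \<le> f y"
  shows "0 \<le> F_op M p \<alpha> J f y"
  unfolding F_op_def by (intro sum_nonneg mult_nonneg_nonneg) (use assms in auto)

lemma F_op_funpow_le:
  fixes f :: "real ^ 'd \<Rightarrow> real"
  assumes "M \<ge> 1" "\<And>C. C \<in> digits M \<Longrightarrow> 0 \<le> p C" "\<And>y. 0 \<le> f y"
  shows "0 \<le> (F_op M p \<alpha> J ^^ n) f y \<and>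
    (F_op M p \<alpha> J ^^ n) f y \<le> (\<Sum>A\<in>words M n. prod_list (map p A) * f (unproj M A y))"
proof (induction n arbitrary: y)
  case 0
  have "cube_map M [] 0 = 0" "Pi 0 = 0" using linear_0[OF linear_Pi] by auto
  then show ?case using assms(3) by (simp add: unproj_def)
next
  case (Suc n)
  let ?g = "(F_op M p \<alpha> J ^^ n) f"
  have g0: "0 \<le> ?g z" for z using Suc by blast
  have "F_op M p \<alpha> J ?g y \<le> (\<Sum>C\<in>digits M. p C * ?g (unproj M [C] y))"
    by (rule F_op_le[OF assms(1,2) g0])
  also have "\<dots> \<le> (\<Sum>C\<in>digits M. p C * (\<Sum>A\<in>words M n. prod_list (map p A) * f (unproj M A (unproj M [C] y))))"
    using Suc assms(2) by (intro sum_mono mult_left_mono) auto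
  also have "\<dots> = (\<Sum>(C, A)\<in>digits M \<times> words M n. prod_list (map p (C # A)) * f (unproj M (C # A) y))"
    by (simp add: sum_distrib_left sum.cartesian_product unproj_Cons[OF assms(1), of _ _ y, symmetric] mult.assoc)
  also have "\<dots> = (\<Sum>A\<in>words M (Suc n). prod_list (map p A) * f (unproj M A y))"
    unfolding words_Suc by (subst sum.reindex) (auto simp: inj_on_def case_prod_beta)
  finally show ?case using F_op_nonneg[of M p ?g, OF assms(2) g0] by simp
qed

lemma central_copy_core:
  assumes "\<rho> > 0"
  shows "(\<lambda>x. Pi (\<chi> i. 1/2) + \<rho> *\<^sub>R (x - Pi (\<chi> i. 1/2))) ` shadow \<alpha> J = Pi ` core \<rho>"
proof -
  have "core \<rho> = (\<lambda>x. ((\<chi> i. 1/2) :: real ^ 'd) + \<rho> *\<^sub>R (x - (\<chi> i. 1/2))) ` unit_cube"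
    by (rule core_eq_scaled[OF assms refl])
  then show ?thesis
    by (simp add: shadow_def image_image linear_add[OF linear_Pi] linear_scale[OF linear_Pi]
        linear_diff[OF linear_Pi])
qed

text \<open>Otherwise the image of the smaller core would be open and closed in the plane.\<close>

lemma core_ratio_less:
  assumes "Pi ` core \<rho>' \<subseteq> top_of_set V interior_of (Pi ` core \<rho>)" "\<rho> > 0"
  shows "\<rho>' < \<rho>"
proof (rule ccontr)
  assume "\<not> \<rho>' < \<rho>"
  then have "Pi ` core \<rho> \<subseteq> Pi ` core \<rho>'" by (intro image_mono core_mono) simp
  with assms(1) have "Pi ` core \<rho> = top_of_set V interior_of (Pi ` core \<rho>)"
    using interior_of_subset by (metis order_trans subset_antisym)
  then have op: "openin (top_of_set V) (Pi ` core \<rho>)" by (metis openin_interior_of)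
  have cp: "compact (Pi ` core \<rho>)"
    by (intro compact_continuous_image compact_core linear_continuous_on) (simp add: linear_Pi linear_linear)
  have "Pi ` core \<rho> \<subseteq> V" using Pi_props by auto
  then have cl: "closedin (top_of_set V) (Pi ` core \<rho>)"
    using closed_subset[OF _ compact_imp_closed[OF cp]] by auto
  have "connected V" using subspace_imp_convex[OF subspace_coord_span] convex_connected by blast
  then have "Pi ` core \<rho> = {} \<or> Pi ` core \<rho> = V" using op cl connected_clopen by blast
  moreover have "(\<chi> i. 1/2) \<in> core \<rho>" using assms(2) by (simp add: core_def)
  ultimately have "bounded V" using compact_imp_bounded[OF cp] by auto
  then obtain b where b: "\<And>x. x \<in> V \<Longrightarrow> norm x \<le> b" by (auto simp: bounded_iff)
  \<comment> \<open>The plane contains a whole coordinate axis, so it cannot be the bounded image of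
    a core.\<close>
  obtain j where "j \<in> J" using card_J card_ge_1 by (metis card.empty ex_in_conv not_one_le_zero)
  then have "axis j 1 \<in> V" unfolding coord_span_def by (intro span_base) auto
  then have "(\<bar>b\<bar> + 1) *\<^sub>R axis j 1 \<in> V" by (rule subspace_scale[OF subspace_coord_span])
  from b[OF this] show False by simp
qed

text \<open>Condition A is evaluated at the projection of \<open>u\<close>. The words counted in the
  bound for the iterate are those for which the flat fibre through \<open>u\<close> meets the small
  core of the cube.\<close>

lemma condition_A_branching:
  assumes "condition_A M p \<alpha> J" "M \<ge> 1" "\<And>C. C \<in> digits M \<Longrightarrow> 0 \<le> p C"
  obtains \<rho>' \<rho> r where "0 < \<rho>'" "\<rho>' < \<rho>" "\<rho> < 1" "1 \<le> r"
    "\<And>u. u \<in> core \<rho> \<Longrightarrow>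
      2 \<le> (\<Sum>A\<in>{A \<in> words M r. \<exists>y\<in>cube_map M A ` core \<rho>'. y - u \<in> W}. prod_list (map p A))"
proof -
  obtain I1 I2 r where I: "central_copy \<alpha> J I1" "central_copy \<alpha> J I2" "0 < r"
    "I1 \<subseteq> top_of_set V interior_of I2" "I2 \<subseteq> top_of_set V interior_of shadow \<alpha> J"
    "I2 \<subseteq> shadow \<alpha> J"
    "\<And>x. x \<in> shadow \<alpha> J \<Longrightarrow> (F_op M p \<alpha> J ^^ r) (indicator I1) x \<ge> 2 * indicator I2 x"
    using assms(1) unfolding condition_A_def by blast
  obtain \<rho>' where \<rho>': "\<rho>' > 0" "I1 = Pi ` core \<rho>'"
    using I(1) central_copy_core unfolding central_copy_def Let_def by metis
  obtain \<rho> where \<rho>: "\<rho> > 0" "I2 = Pi ` core \<rho>"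
    using I(2) central_copy_core unfolding central_copy_def Let_def by metis
  have sh: "shadow \<alpha> J = Pi ` core 1" by (simp add: shadow_def core_1)
  show thesis
  proof (rule that)
    show "0 < \<rho>'" "1 \<le> r" using \<rho>' I by auto
    show "\<rho>' < \<rho>" using core_ratio_less I(4) \<rho> \<rho>' by simp
    show "\<rho> < 1" using core_ratio_less[of \<rho> 1] I(5) \<rho> sh by simp
    fix u :: "real ^ 'd" assume u: "u \<in> core \<rho>"
    then have uI: "Pi u \<in> I2" using \<rho> by blast
    then have "2 \<le> (F_op M p \<alpha> J ^^ r) (indicator I1) (Pi u)"
      using I(7)[of "Pi u"] I(6) by auto
    also have "\<dots> \<le> (\<Sum>A\<in>words M r. prod_list (map p A) * indicator I1 (unproj M A (Pi u)))"
      using F_op_funpow_le[of M p "indicator I1" r "Pi u"] assms by simp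
    also have "\<dots> = (\<Sum>A\<in>{A \<in> words M r. unproj M A (Pi u) \<in> I1}. prod_list (map p A))"
      by (simp add: sum.If_cases indicator_def if_distrib Int_def cong: if_cong)
    also have "\<dots> = (\<Sum>A\<in>{A \<in> words M r. \<exists>y\<in>cube_map M A ` core \<rho>'. y - u \<in> W}. prod_list (map p A))"
    proof (intro sum.cong refl Collect_cong conj_cong)
      fix A :: "'d word"
      have "unproj M A (Pi u) \<in> I1 \<longleftrightarrow> (\<exists>y\<in>core \<rho>'. Pi y = unproj M A (Pi u))"
        unfolding \<rho>'(2) by (auto simp: image_iff intro: sym)
      also have "\<dots> \<longleftrightarrow> (\<exists>y\<in>core \<rho>'. cube_map M A y - u \<in> W)"
        by (simp only: Pi_cube_map_eq_iff[OF assms(2), symmetric] Pi_eq_iff)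
      finally show "unproj M A (Pi u) \<in> I1 \<longleftrightarrow> (\<exists>y\<in>cube_map M A ` core \<rho>'. y - u \<in> W)" by simp
    qed
    finally show "2 \<le> (\<Sum>A\<in>{A \<in> words M r. \<exists>y\<in>cube_map M A ` core \<rho>'. y - u \<in> W}. prod_list (map p A))" .
  qed
qed

end

section \<open>Rays and spheres with far centres\<close>

text \<open>Imposing both conditions at every point of the cube makes the set invariant under
  \<open>uncube\<close>. The bound leaves room for displacements by up to d, a crude bound for the
  diameter of the cube, and makes the sum of two distances from the cube to \<open>t\<close>
  dominate the norm of \<open>t\<close>.\<close>

definition far_centres :: "real \<Rightarrow> real ^ 'd \<Rightarrow> (real ^ 'd::finite) set"
  where "far_centres \<delta> v =
    {t. \<forall>x\<in>unit_cube. 2 * real CARD('d) + 1 \<le> norm (x - t) \<and> norm (sgn (x - t) - v) \<le> \<delta>}"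

definition same_direction :: "real ^ 'd::finite \<Rightarrow> real ^ 'd \<Rightarrow> real ^ 'd \<Rightarrow> bool"
  where "same_direction t u y \<longleftrightarrow> sgn (y - t) = sgn (u - t)"

definition same_distance :: "real ^ 'd::finite \<Rightarrow> real ^ 'd \<Rightarrow> real ^ 'd \<Rightarrow> bool"
  where "same_distance t u y \<longleftrightarrow> norm (y - t) = norm (u - t)"

lemma norm_sgn_le: "norm (sgn (x :: 'a::real_normed_vector)) \<le> 1"
  by (cases "x = 0") (simp_all add: norm_sgn)

lemma norm_scaleR_sgn: "norm x *\<^sub>R sgn (x :: 'a::real_normed_vector) = x"
  by (cases "x = 0") (simp_all add: sgn_div_norm)

lemma norm_sgn_diff_le:
  fixes a b :: "'a::real_normed_vector"
  assumes "b \<noteq> 0"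
  shows "norm (sgn a - sgn b) \<le> 2 * norm (a - b) / norm b"
proof -
  have "norm b *\<^sub>R (sgn a - sgn b) = (norm b - norm a) *\<^sub>R sgn a + (a - b)"
    using norm_scaleR_sgn[of a] norm_scaleR_sgn[of b] by (simp add: algebra_simps)
  then have "norm b * norm (sgn a - sgn b) = norm ((norm b - norm a) *\<^sub>R sgn a + (a - b))"
    by (metis norm_scaleR abs_norm_cancel)
  also have "\<dots> \<le> \<bar>norm b - norm a\<bar> * norm (sgn a) + norm (a - b)"
    by (rule order_trans[OF norm_triangle_ineq]) simp
  also have "\<dots> \<le> norm (a - b) * 1 + norm (a - b)"
    using norm_triangle_ineq3[of b a] norm_sgn_le[of a]
    by (intro add_right_mono mult_mono) (auto simp: norm_minus_commute)
  finally show ?thesis using assms by (simp add: field_simps)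
qed

lemma zero_in_unit_cube: "0 \<in> unit_cube"
  by (simp add: unit_cube_def)

lemma unit_cube_norm: "x \<in> unit_cube \<Longrightarrow> norm (x :: real ^ 'd::finite) \<le> real CARD('d)"
  using unit_cube_dist[OF _ zero_in_unit_cube, of x] by simp

lemma diff_uncube:
  assumes "M \<ge> 1"
  shows "cube_map M A x - t = (1 / real M ^ length A) *\<^sub>R (x - uncube M A t)"
  using cube_map_diff[of M A x "uncube M A t"] assms by simp

text \<open>The unit cube seen from the rescaled centre looks like the small cube seen from
  \<open>t\<close>: directions agree, and distances are multiplied by M^n \<ge> 1.\<close>

lemma uncube_far_centres:
  fixes t :: "real ^ 'd::finite"
  assumes "t \<in> far_centres \<delta> v" "A \<in> words M n" "M \<ge> 1"
  shows "uncube M A t \<in> far_centres \<delta> v"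
  unfolding far_centres_def mem_Collect_eq
proof
  fix x :: "real ^ 'd" assume "x \<in> unit_cube"
  then have c: "cube_map M A x \<in> unit_cube" by (rule cube_map_in_unit_cube[OF assms(2) _ assms(3)])
  have pos: "real M ^ length A \<ge> 1" using assms(3) by simp
  have eq: "cube_map M A x - t = (1 / real M ^ length A) *\<^sub>R (x - uncube M A t)"
    by (rule diff_uncube[OF assms(3)])
  have "norm (cube_map M A x - t) \<le> norm (x - uncube M A t)"
    unfolding eq using pos by (simp add: divide_le_eq mult_le_cancel_left1)
  moreover have "sgn (cube_map M A x - t) = sgn (x - uncube M A t)"
    unfolding eq using assms(3) by (simp add: sgn_scaleR)
  ultimately show "2 * real CARD('d) + 1 \<le> norm (x - uncube M A t) \<and> norm (sgn (x - uncube M A t) - v) \<le> \<delta>"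
    using assms(1) c unfolding far_centres_def by fastforce
qed

lemma same_direction_cube_map:
  assumes "M \<ge> 1" "same_direction (uncube M A t) u y"
  shows "same_direction t (cube_map M A u) (cube_map M A y)"
  using assms by (simp add: same_direction_def diff_uncube sgn_scaleR)

lemma same_distance_cube_map:
  assumes "M \<ge> 1" "same_distance (uncube M A t) u y"
  shows "same_distance t (cube_map M A u) (cube_map M A y)"
  using assms by (simp add: same_distance_def diff_uncube)

lemma same_direction_along_ray:
  assumes "\<bar>s\<bar> < norm (u - t)"
  shows "same_direction t u (u + s *\<^sub>R sgn (u - t))"
proof -
  have "u + s *\<^sub>R sgn (u - t) - t = norm (u - t) *\<^sub>R sgn (u - t) + s *\<^sub>R sgn (u - t)"
    by (simp add: norm_scaleR_sgn)
  also have "\<dots> = (norm (u - t) + s) *\<^sub>R sgn (u - t)" by (simp add: scaleR_add_left)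
  finally have "sgn (u + s *\<^sub>R sgn (u - t) - t) = sgn (sgn (u - t))"
    using assms by (simp add: sgn_scaleR)
  also have "\<dots> = sgn (u - t)" by (simp add: sgn_div_norm[of "sgn (u - t)"] norm_sgn)
  finally show ?thesis by (simp add: same_direction_def)
qed

text \<open>The comparison point is the radial projection of \<open>y\<close> to the sphere through
  \<open>u\<close>.\<close>

lemma same_distance_radial:
  assumes "y \<noteq> t"
  shows "same_distance t u (t + norm (u - t) *\<^sub>R sgn (y - t))"
    "norm (y - (t + norm (u - t) *\<^sub>R sgn (y - t))) = \<bar>norm (y - t) - norm (u - t)\<bar>"
proof -
  show "same_distance t u (t + norm (u - t) *\<^sub>R sgn (y - t))"
    using assms by (simp add: same_distance_def norm_sgn)
  have "y - (t + norm (u - t) *\<^sub>R sgn (y - t)) = (norm (y - t) - norm (u - t)) *\<^sub>R sgn (y - t)"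
    using norm_scaleR_sgn[of "y - t"] by (simp add: algebra_simps)
  then show "norm (y - (t + norm (u - t) *\<^sub>R sgn (y - t))) = \<bar>norm (y - t) - norm (u - t)\<bar>"
    using assms by (simp add: norm_sgn)
qed

text \<open>The segment from \<open>u\<close> to \<open>y\<close> is turned into the direction of
  the ray, keeping its signed length \<open>s\<close>: a length of at most d, a turn of at most
  \<delta>.\<close>

lemma same_direction_approx_line:
  fixes t :: "real ^ 'd::finite"
  assumes t: "t \<in> far_centres \<delta> v" and uy: "u \<in> unit_cube" "y \<in> unit_cube" and v: "norm v = 1"
    and line: "y - u = s *\<^sub>R v"
  shows "\<exists>y'. same_direction t u y' \<and> norm (y - y') \<le> real CARD('d) * \<delta>"
proof (intro exI conjI)
  have "\<bar>s\<bar> = norm (y - u)" using v line by simp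
  also have "\<dots> \<le> real CARD('d)" using uy by (intro unit_cube_dist)
  finally have s: "\<bar>s\<bar> \<le> real CARD('d)" .
  have tu: "2 * real CARD('d) + 1 \<le> norm (u - t)" "norm (sgn (u - t) - v) \<le> \<delta>"
    using t uy by (auto simp: far_centres_def)
  then have "0 \<le> \<delta>" using norm_ge_zero order_trans by blast
  show "same_direction t u (u + s *\<^sub>R sgn (u - t))"
    using s tu(1) by (intro same_direction_along_ray) linarith
  have "y - (u + s *\<^sub>R sgn (u - t)) = s *\<^sub>R (v - sgn (u - t))"
    using line by (simp add: algebra_simps)
  then have "norm (y - (u + s *\<^sub>R sgn (u - t))) = \<bar>s\<bar> * norm (sgn (u - t) - v)"
    by (simp add: norm_minus_commute)
  also have "\<dots> \<le> real CARD('d) * \<delta>" using s tu(2) \<open>0 \<le> \<delta>\<close> by (intro mult_mono) auto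
  finally show "norm (y - (u + s *\<^sub>R sgn (u - t))) \<le> real CARD('d) * \<delta>" .
qed

text \<open>The subgradient inequality of the norm at \<open>a\<close>.\<close>

lemma norm_diff_le_inner_sgn: "norm a - norm b \<le> sgn a \<bullet> (a - b)" for a b :: "'a::real_inner"
proof -
  have "sgn a \<bullet> a = norm a"
    by (cases "a = 0") (simp_all add: sgn_div_norm dot_square_norm power2_eq_square)
  moreover have "sgn a \<bullet> b \<le> norm b"
    using order_trans[OF norm_cauchy_schwarz[of "sgn a" b] mult_right_mono[OF norm_sgn_le[of a] norm_ge_zero[of b]]] by simp
  ultimately show ?thesis by (simp add: inner_diff_right)
qed

text \<open>Convexity of the norm: a sphere with a far centre in direction \<open>v\<close> is almost flat.\<close>

lemma same_distance_approx_plane: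
  fixes t :: "real ^ 'd::finite"
  assumes t: "t \<in> far_centres \<delta> v" and uy: "u \<in> unit_cube" "y \<in> unit_cube"
    and plane: "(y - u) \<bullet> v = 0"
  shows "\<exists>y'. same_distance t u y' \<and> norm (y - y') \<le> real CARD('d) * \<delta>"
proof -
  have far: "2 * real CARD('d) + 1 \<le> norm (x - t)" "norm (sgn (x - t) - v) \<le> \<delta>" if "x \<in> unit_cube" for x
    using t that by (auto simp: far_centres_def)
  have \<delta>: "0 \<le> \<delta>" using far(2)[OF uy(1)] norm_ge_zero order_trans by blast
  have le: "norm (a - t) - norm (b - t) \<le> real CARD('d) * \<delta>"
    if ab: "a \<in> unit_cube" "b \<in> unit_cube" "(a - b) \<bullet> v = 0" for a b
  proof -
    have "norm (a - t) - norm (b - t) \<le> sgn (a - t) \<bullet> (a - b)"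
      using norm_diff_le_inner_sgn[of "a - t" "b - t"] by simp
    also have "\<dots> = (sgn (a - t) - v) \<bullet> (a - b)"
      using ab(3) by (simp add: inner_diff_left inner_commute[of v])
    also have "\<dots> \<le> norm (sgn (a - t) - v) * norm (a - b)" by (rule norm_cauchy_schwarz)
    also have "\<dots> \<le> \<delta> * real CARD('d)"
      using far(2)[OF ab(1)] unit_cube_dist[OF ab(1,2)] \<delta> by (intro mult_mono) auto
    finally show ?thesis by (simp add: mult.commute)
  qed
  have "(u - y) \<bullet> v = 0" using plane by (simp add: inner_diff_left)
  then have "\<bar>norm (y - t) - norm (u - t)\<bar> \<le> real CARD('d) * \<delta>"
    using le[OF uy(2,1) plane] le[OF uy] by linarith
  moreover have "y \<noteq> t" using far(1)[OF uy(2)] by auto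
  ultimately show ?thesis using same_distance_radial[of y t u] by metis
qed

text \<open>On its ray \<open>y\<close> is \<open>u\<close> moved by a signed length
  \<open>s\<close>. Moving \<open>u'\<close> by the same \<open>s\<close> along the other ray, the
  base points cost \<eta> and the directions at most d * \<eta>.\<close>

lemma same_direction_lipschitz:
  fixes t :: "real ^ 'd::finite"
  assumes "t \<in> far_centres \<delta> v" "t' \<in> far_centres \<delta> v" "u \<in> unit_cube" "u' \<in> unit_cube" "y \<in> unit_cube"
    "same_direction t u y" "norm ((u, sgn (u - t)) - (u', sgn (u' - t'))) \<le> \<eta>"
  shows "\<exists>y'. same_direction t' u' y' \<and> norm (y - y') \<le> (1 + real CARD('d)) * \<eta>"
proof (intro exI conjI)
  define s where "s = norm (y - t) - norm (u - t)"
  have "\<bar>s\<bar> \<le> norm ((y - t) - (u - t))" unfolding s_def by (rule norm_triangle_ineq3)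
  also have "\<dots> \<le> real CARD('d)" using unit_cube_dist[OF assms(5,3)] by simp
  finally have s: "\<bar>s\<bar> \<le> real CARD('d)" .
  have "2 * real CARD('d) + 1 \<le> norm (u' - t')" using assms(2,4) by (auto simp: far_centres_def)
  then show "same_direction t' u' (u' + s *\<^sub>R sgn (u' - t'))"
    using s by (intro same_direction_along_ray) linarith
  have "y - u = norm (y - t) *\<^sub>R sgn (y - t) - norm (u - t) *\<^sub>R sgn (u - t)"
    by (simp add: norm_scaleR_sgn)
  also have "\<dots> = s *\<^sub>R sgn (u - t)"
    using assms(6) by (simp add: same_direction_def s_def scaleR_diff_left)
  finally have "y - (u' + s *\<^sub>R sgn (u' - t')) = (u - u') + s *\<^sub>R (sgn (u - t) - sgn (u' - t'))"
    by (simp add: algebra_simps)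
  then have "norm (y - (u' + s *\<^sub>R sgn (u' - t'))) \<le> norm (u - u') + \<bar>s\<bar> * norm (sgn (u - t) - sgn (u' - t'))"
    by (metis norm_triangle_ineq norm_scaleR)
  also have "\<dots> \<le> \<eta> + real CARD('d) * \<eta>"
  proof -
    have "norm (u - u') \<le> \<eta>" "norm (sgn (u - t) - sgn (u' - t')) \<le> \<eta>"
      using assms(7) norm_fst_le[of "u - u'" "sgn (u - t) - sgn (u' - t')"]
        norm_snd_le[of "sgn (u - t) - sgn (u' - t')" "u - u'"] by auto
    then show ?thesis using s by (intro add_mono mult_mono) auto
  qed
  finally show "norm (y - (u' + s *\<^sub>R sgn (u' - t'))) \<le> (1 + real CARD('d)) * \<eta>"
    by (simp add: algebra_simps)
qed

text \<open>The sphere through \<open>u\<close> centred at \<open>t\<close> has the equation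
  \<open>\<kappa> |y|\<^sup>2 - 2 y \<bullet> w = \<kappa> |u|\<^sup>2 - 2 u \<bullet> w\<close> with \<open>w = sgn t\<close> and \<open>\<kappa> = 1 / |t|\<close>, whose coefficients
  stay bounded as \<open>t\<close> goes to infinity.\<close>

lemma same_distance_lipschitz:
  fixes t :: "real ^ 'd::finite"
  assumes "t \<in> far_centres \<delta> v" "t' \<in> far_centres \<delta> v" "u \<in> unit_cube" "u' \<in> unit_cube" "y \<in> unit_cube"
    "same_distance t u y" "norm ((u, sgn t, 1 / norm t) - (u', sgn t', 1 / norm t')) \<le> \<eta>"
  shows "\<exists>y'. same_distance t' u' y' \<and>
    norm (y - y') \<le> (2 * (real CARD('d))\<^sup>2 + 6 * real CARD('d) + 2) * \<eta>"
proof -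
  define d where "d = real CARD('d)"
  have d: "d \<ge> 1" by (simp add: d_def Suc_leI)
  define \<kappa> where "\<kappa> s = 1 / norm s" for s :: "real ^ 'd"
  define q where "q s x = \<kappa> s * (norm x)\<^sup>2 - 2 * (x \<bullet> sgn s)" for s x :: "real ^ 'd"
  have far: "2 * d + 1 \<le> norm (x - s)" if "x \<in> unit_cube" "s \<in> far_centres \<delta> v" for x s :: "real ^ 'd"
    using that by (auto simp: far_centres_def d_def)
  have big: "2 * d + 1 \<le> norm s" if "s \<in> far_centres \<delta> v" for s :: "real ^ 'd"
    using far[OF zero_in_unit_cube that] by simp
  have \<kappa>: "0 \<le> \<kappa> s" "\<kappa> s \<le> 1" if "s \<in> far_centres \<delta> v" for s
    using big[OF that] d by (auto simp: \<kappa>_def divide_le_eq)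
  have nd: "norm u \<le> d" "norm u' \<le> d" "norm y \<le> d"
    using assms(3-5) unit_cube_norm by (auto simp: d_def)
  \<comment> \<open>\<open>q\<close> is the squared distance without its constant term, divided by
    the norm of the centre; unlike the distance, it stays bounded on the cube as the centre
    recedes.\<close>
  have eq: "(norm (x - s))\<^sup>2 = norm s * q s x + (norm s)\<^sup>2" if "s \<in> far_centres \<delta> v" for x s
  proof -
    have ns: "norm s > 0" using big[OF that] d by linarith
    have "norm s * (x \<bullet> sgn s) = x \<bullet> s"
      using norm_scaleR_sgn[of s] by (metis inner_scaleR_right)
    then have "norm s * q s x = (norm x)\<^sup>2 - 2 * (x \<bullet> s)"
      using ns by (simp add: q_def \<kappa>_def algebra_simps)
    then show ?thesis
      by (simp add: power2_norm_eq_inner inner_diff_left inner_diff_right inner_commute)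
  qed
  have q0: "q t y = q t u"
  proof -
    have "norm t > 0" using big[OF assms(1)] d by linarith
    then show ?thesis using assms(6) eq[OF assms(1), of y] eq[OF assms(1), of u]
      by (simp add: same_distance_def)
  qed
  have e: "norm (u - u') \<le> \<eta>" "norm (sgn t - sgn t') \<le> \<eta>" "\<bar>\<kappa> t - \<kappa> t'\<bar> \<le> \<eta>"
  proof -
    let ?a = "u - u'" and ?b = "sgn t - sgn t'" and ?c = "\<kappa> t - \<kappa> t'"
    have n: "norm (?a, ?b, ?c) \<le> \<eta>" using assms(7) by (simp add: \<kappa>_def)
    have "norm (?b, ?c) \<le> norm (?a, ?b, ?c)" by (rule norm_snd_le)
    moreover have "norm ?a \<le> norm (?a, ?b, ?c)" by (rule norm_fst_le)
    moreover have "norm ?b \<le> norm (?b, ?c)" by (rule norm_fst_le)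
    moreover have "norm ?c \<le> norm (?b, ?c)" by (rule norm_snd_le)
    ultimately show "norm ?a \<le> \<eta>" "norm ?b \<le> \<eta>" "\<bar>?c\<bar> \<le> \<eta>" using n by auto
  qed
  have \<eta>: "0 \<le> \<eta>" using e(1) norm_ge_zero order_trans by blast
  have inner_le: "\<bar>a \<bullet> b\<bar> \<le> A * B" if "norm a \<le> A" "norm b \<le> B" for a b :: "real ^ 'd" and A B
    by (rule order_trans[OF Cauchy_Schwarz_ineq2 mult_mono])
      (use that norm_ge_zero order_trans in \<open>auto, blast\<close>)
  have qt: "\<bar>q t' x - q t x\<bar> \<le> (d\<^sup>2 + 2 * d) * \<eta>" if "norm x \<le> d" for x
  proof -
    have "q t' x - q t x = 2 * (x \<bullet> (sgn t - sgn t')) - (\<kappa> t - \<kappa> t') * (norm x)\<^sup>2"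
      by (simp add: q_def algebra_simps inner_diff_right)
    moreover have "\<bar>x \<bullet> (sgn t - sgn t')\<bar> \<le> d * \<eta>" by (rule inner_le[OF that e(2)])
    moreover have "\<bar>(\<kappa> t - \<kappa> t') * (norm x)\<^sup>2\<bar> \<le> \<eta> * d\<^sup>2"
      unfolding abs_mult using e(3) that \<eta> by (intro mult_mono) (auto intro: power_mono)
    ultimately have "\<bar>q t' x - q t x\<bar> \<le> 2 * (d * \<eta>) + \<eta> * d\<^sup>2" by linarith
    then show ?thesis by (simp add: algebra_simps)
  qed
  have "\<bar>q t' u - q t' u'\<bar> \<le> (2 * d + 2) * \<eta>"
  proof -
    have "q t' u - q t' u' = \<kappa> t' * ((norm u)\<^sup>2 - (norm u')\<^sup>2) - 2 * ((u - u') \<bullet> sgn t')"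
      by (simp add: q_def algebra_simps inner_diff_left)
    moreover have "\<bar>(u - u') \<bullet> sgn t'\<bar> \<le> \<eta> * 1" by (rule inner_le[OF e(1) norm_sgn_le])
    moreover have "\<bar>\<kappa> t' * ((norm u)\<^sup>2 - (norm u')\<^sup>2)\<bar> \<le> 1 * (2 * d * \<eta>)"
      unfolding abs_mult
    proof (intro mult_mono)
      have "\<bar>(norm u)\<^sup>2 - (norm u')\<^sup>2\<bar> = \<bar>norm u + norm u'\<bar> * \<bar>norm u - norm u'\<bar>"
        unfolding abs_mult[symmetric] by (simp add: power2_eq_square algebra_simps)
      also have "\<dots> \<le> (2 * d) * \<eta>"
        using nd norm_triangle_ineq3[of u u'] e(1) d by (intro mult_mono) auto
      finally show "\<bar>(norm u)\<^sup>2 - (norm u')\<^sup>2\<bar> \<le> 2 * d * \<eta>" .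
    qed (use \<kappa>[OF assms(2)] in auto)
    ultimately have "\<bar>q t' u - q t' u'\<bar> \<le> 2 * d * \<eta> + 2 * \<eta>" by linarith
    then show ?thesis by (simp add: algebra_simps)
  qed
  \<comment> \<open>Changing the centre costs d^2 + 2d, once at \<open>y\<close> and once at
    \<open>u\<close>, and moving \<open>u\<close> to \<open>u'\<close> costs 2d + 2; this is where
    the constant comes from.\<close>
  then have X: "\<bar>q t' y - q t' u'\<bar> \<le> (2 * d\<^sup>2 + 6 * d + 2) * \<eta>"
    using qt[OF nd(3)] qt[OF nd(1)] q0
    unfolding distrib_right by linarith
  define S where "S = norm (y - t') + norm (u' - t')"
  \<comment> \<open>Both distances are at least the norm of t' minus d, and that norm exceeds 2d.
    This cancels the factor in front of the difference of \<open>q\<close>.\<close>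
  have S: "norm t' \<le> S"
  proof -
    have "norm t' - norm y \<le> norm (y - t')" "norm t' - norm u' \<le> norm (u' - t')"
      using norm_triangle_ineq2[of t' y] norm_triangle_ineq2[of t' u'] by (simp_all add: norm_minus_commute)
    then show ?thesis using nd big[OF assms(2)] by (simp add: S_def)
  qed
  have "(norm (y - t') - norm (u' - t')) * S = (norm (y - t'))\<^sup>2 - (norm (u' - t'))\<^sup>2"
    by (simp add: S_def power2_eq_square algebra_simps)
  also have "\<dots> = norm t' * (q t' y - q t' u')"
    by (simp add: eq[OF assms(2)] algebra_simps)
  finally have "\<bar>norm (y - t') - norm (u' - t')\<bar> * S = norm t' * \<bar>q t' y - q t' u'\<bar>"
    using S norm_ge_zero[of t'] by (metis abs_mult abs_norm_cancel abs_of_nonneg order_trans)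
  also have "\<dots> \<le> S * \<bar>q t' y - q t' u'\<bar>" using S by (intro mult_right_mono) auto
  finally have "\<bar>norm (y - t') - norm (u' - t')\<bar> \<le> \<bar>q t' y - q t' u'\<bar>"
    using S big[OF assms(2)] d by (simp add: mult.commute[of _ S])
  then have "\<bar>norm (y - t') - norm (u' - t')\<bar> \<le> (2 * d\<^sup>2 + 6 * d + 2) * \<eta>" using X by linarith
  moreover have "y \<noteq> t'" using far[OF assms(5,2)] d by auto
  ultimately show ?thesis using same_distance_radial[of y t' u'] unfolding d_def by metis
qed

lemma far_centres_nonempty:
  fixes v :: "real ^ 'd::finite"
  assumes "norm v = 1" "\<delta> > 0"
  shows "far_centres \<delta> v \<noteq> {}"
proof -
  define d where "d = real CARD('d)"
  have d: "d \<ge> 1" by (simp add: d_def Suc_leI)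
  \<comment> \<open>3d + 1 leaves distance 2d + 1 after subtracting the norm of a point of the cube,
    and 2d / \<delta> keeps the error in direction below \<delta>.\<close>
  define s where "s = 3 * d + 1 + 2 * d / \<delta>"
  have s: "3 * d + 1 \<le> s" "2 * d / \<delta> \<le> s" "0 < s" using d assms(2) by (auto simp: s_def add_pos_nonneg)
  have "- (s *\<^sub>R v) \<in> far_centres \<delta> v"
    unfolding far_centres_def mem_Collect_eq
  proof (intro ballI conjI)
    fix x :: "real ^ 'd" assume "x \<in> unit_cube"
    then have nx: "norm x \<le> d" using unit_cube_norm by (auto simp: d_def)
    have "s - norm x \<le> norm (x + s *\<^sub>R v)"
      using norm_diff_ineq[of "s *\<^sub>R v" x] assms s by (simp add: add.commute)
    then show "2 * real CARD('d) + 1 \<le> norm (x - - (s *\<^sub>R v))"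
      using nx s(1) unfolding d_def by simp
    have "s *\<^sub>R v \<noteq> 0" using s assms by auto
    from norm_sgn_diff_le[OF this, of "x + s *\<^sub>R v"]
    have "norm (sgn (x + s *\<^sub>R v) - sgn (s *\<^sub>R v)) \<le> 2 * norm x / s" using assms s by simp
    also have "\<dots> \<le> 2 * d / s" using nx s by (simp add: divide_right_mono)
    also have "\<dots> \<le> \<delta>" using s assms by (simp add: field_simps)
    finally show "norm (sgn (x - - (s *\<^sub>R v)) - v) \<le> \<delta>"
      using s assms by (simp add: sgn_scaleR sgn_div_norm[of v])
  qed
  then show ?thesis by blast
qed

lemma closed_same_direction:
  fixes t :: "real ^ 'd::finite"
  assumes "t \<in> far_centres \<delta> v"
  shows "closed {y \<in> unit_cube. same_direction t u y}"
  unfolding same_direction_def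
proof (rule continuous_closed_preimage_constant)
  show "continuous_on unit_cube (\<lambda>y. sgn (y - t))"
  proof (intro continuous_intros ballI)
    fix x :: "real ^ 'd" assume "x \<in> unit_cube"
    then have "2 * real CARD('d) + 1 \<le> norm (x - t)" using assms by (auto simp: far_centres_def)
    then show "x - t \<noteq> 0" by auto
  qed
qed (simp add: compact_imp_closed compact_unit_cube)

lemma closed_same_distance: "closed {y \<in> unit_cube. same_distance t u y}"
  unfolding same_distance_def
  by (intro continuous_closed_preimage_constant continuous_intros compact_imp_closed compact_unit_cube)

lemma core_nonempty: "\<rho> > 0 \<Longrightarrow> (\<chi> i. 1/2) \<in> core \<rho>"
  by (simp add: core_def)

section \<open>From Condition A to an event of positive probability\<close>

context percolation
begin

text \<open>Nonemptiness of the limit set is recorded separately, so that \<open>Q\<close> yields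
  survival without reference to a centre.\<close>

definition fibre_event ::
  "(real ^ 'd \<Rightarrow> real ^ 'd \<Rightarrow> real ^ 'd \<Rightarrow> bool) \<Rightarrow> real ^ 'd \<Rightarrow> real \<Rightarrow> real \<Rightarrow> (('d word \<Rightarrow> bool) \<Rightarrow> bool) \<Rightarrow> bool"
  where "fibre_event rel v \<delta> \<rho> Q \<longleftrightarrow>
    0 < \<delta> \<and> 0 < \<rho> \<and> \<rho> < 1 \<and> determined (tree_words M) Q \<and> 0 < tree_prob Q \<and>
    (\<forall>\<xi>. Q \<xi> \<longrightarrow> limit_set M \<xi> \<noteq> {} \<and>
      (\<forall>t\<in>far_centres \<delta> v. \<forall>u\<in>core \<rho>. \<exists>y\<in>limit_set M \<xi>. rel t u y))"

definition hits_all :: "(real ^ 'd \<Rightarrow> real ^ 'd \<Rightarrow> real ^ 'd \<Rightarrow> bool) \<Rightarrow> real ^ 'd \<Rightarrow> bool"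
  where "hits_all rel v \<longleftrightarrow> (\<exists>\<delta> \<rho> Q. fibre_event rel v \<delta> \<rho> Q)"

text \<open>What rays and spheres have in common: closeness to flat fibres, and the fibre axioms.
  All is assumed for every \<delta>, because \<delta> is fixed only inside, from the gap between the
  cores and from \<open>r\<close>.\<close>

lemma hits_allI:
  fixes e :: "real ^ 'd \<Rightarrow> real ^ 'd \<Rightarrow> 'e::euclidean_space"
  assumes v: "norm v = 1" and \<rho>: "0 < \<rho>a" "\<rho>a < \<rho>" "\<rho> < 1" and r: "1 \<le> r"
    and branch: "\<And>u. u \<in> core \<rho> \<Longrightarrow>
      2 \<le> (\<Sum>A\<in>{A \<in> words M r. \<exists>y\<in>cube_map M A ` core \<rho>a. y - u \<in> W}. prod_list (map p A))"
    and approx: "\<And>\<delta> t u y. t \<in> far_centres \<delta> v \<Longrightarrow> u \<in> unit_cube \<Longrightarrow> y \<in> unit_cube \<Longrightarrow> y - u \<in> W \<Longrightarrow>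
      \<exists>y'. rel t u y' \<and> norm (y - y') \<le> real CARD('d) * \<delta>"
    and refl: "\<And>t u. rel t u u" and trans: "\<And>t u y z. rel t u y \<Longrightarrow> rel t y z \<Longrightarrow> rel t u z"
    and scaling: "\<And>A t u y. rel (uncube M A t) u y \<Longrightarrow> rel t (cube_map M A u) (cube_map M A y)"
    and lipschitz: "\<And>\<delta> t t' u u' y \<eta>. t \<in> far_centres \<delta> v \<Longrightarrow> t' \<in> far_centres \<delta> v \<Longrightarrow>
      u \<in> unit_cube \<Longrightarrow> u' \<in> unit_cube \<Longrightarrow> y \<in> unit_cube \<Longrightarrow> rel t u y \<Longrightarrow> norm (e t u - e t' u') \<le> \<eta> \<Longrightarrow>
      \<exists>y'. rel t' u' y' \<and> norm (y - y') \<le> L * \<eta>" "L > 0"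
    and bounded: "\<And>\<delta> t u. t \<in> far_centres \<delta> v \<Longrightarrow> u \<in> unit_cube \<Longrightarrow> norm (e t u) \<le> Bd" "0 \<le> Bd"
    and closed: "\<And>\<delta> t u. t \<in> far_centres \<delta> v \<Longrightarrow> closed {y \<in> unit_cube. rel t u y}"
  shows "hits_all rel v"
proof -
  \<comment> \<open>The gap is halved: from \<open>\<rho>a\<close> to \<open>\<rho>'\<close> it
    absorbs the bending of flat fibres, from \<open>\<rho>'\<close> to \<open>\<rho>\<close> the
    distance to the net. Accordingly d * \<delta> is the first margin at level r.\<close>
  define \<rho>' where "\<rho>' = (\<rho>a + \<rho>) / 2"
  define \<delta> where "\<delta> = (\<rho>' - \<rho>a) / 2 / real M ^ r / real CARD('d)"
  have \<rho>': "\<rho>a < \<rho>'" "\<rho>' < \<rho>" using \<rho> by (auto simp: \<rho>'_def)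
  have \<delta>: "\<delta> > 0" using \<rho>' M_ge_1 by (simp add: \<delta>_def)
  have core: "core \<rho> \<subseteq> (unit_cube :: (real ^ 'd) set)" by (rule core_subset_unit_cube[OF less_imp_le[OF \<rho>(3)]])
  have \<rho>0: "0 < \<rho>" "\<rho> < 1" using \<rho> by linarith+
  interpret percolation_fibres P M p c rel "far_centres \<delta> v" e \<rho>' \<rho> Bd L r
  proof
    show "\<rho>' < \<rho>" "\<rho> < 1" "1 \<le> r" "0 < L" "0 \<le> Bd" by fact+
    show "rel t u u" for t u by (rule refl)
    show "rel t u z" if "rel t u y" "rel t y z" for t u y z using trans that .
    show "uncube M A t \<in> far_centres \<delta> v" if "t \<in> far_centres \<delta> v" "A \<in> words M n" for t A n
      by (rule uncube_far_centres[OF that M_ge_1])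
    show "rel t (cube_map M A u) (cube_map M A y)" if "rel (uncube M A t) u y" for t A u y
      by (rule scaling[OF that])
    show "\<exists>y'. rel t' u' y' \<and> norm (y - y') \<le> L * \<eta>"
      if "t \<in> far_centres \<delta> v" "t' \<in> far_centres \<delta> v" "u \<in> core \<rho>" "u' \<in> core \<rho>" "y \<in> unit_cube"
        "rel t u y" "norm (e t u - e t' u') \<le> \<eta>" for t t' u u' y \<eta>
      using that core by (intro lipschitz(1)[of t \<delta> t' u u' y \<eta>]) auto
    show "norm (e t u) \<le> Bd" if "t \<in> far_centres \<delta> v" "u \<in> core \<rho>" for t u
      using that core by (intro bounded(1)[of t \<delta>]) auto
    show "closed {y \<in> unit_cube. rel t u y}" if "t \<in> far_centres \<delta> v" for t u by (rule closed[OF that])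
    fix t u :: "real ^ 'd" assume t: "t \<in> far_centres \<delta> v" and u: "u \<in> core \<rho>"
    have "2 \<le> (\<Sum>A\<in>{A \<in> words M r. \<exists>y\<in>cube_map M A ` core \<rho>a. y - u \<in> W}. prod_list (map p A))"
      by (rule branch[OF u])
    also have "\<dots> \<le> (\<Sum>A\<in>{A \<in> words M r. \<exists>y\<in>cube_map M A ` core \<rho>'. rel t u y}. prod_list (map p A))"
    proof (rule sum_mono2)
      show "{A \<in> words M r. \<exists>y\<in>cube_map M A ` core \<rho>a. y - u \<in> W} \<subseteq>
          {A \<in> words M r. \<exists>y\<in>cube_map M A ` core \<rho>'. rel t u y}"
      proof clarify
        fix A x assume A: "A \<in> words M r" and x: "x \<in> core \<rho>a" "cube_map M A x - u \<in> W"
        have "x \<in> unit_cube" using x(1) core_subset_unit_cube[of \<rho>a] \<rho> by auto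
        then have "cube_map M A x \<in> unit_cube" by (rule cube_map_in_unit_cube[OF A _ M_ge_1])
        then obtain y' where y': "rel t u y'" "norm (cube_map M A x - y') \<le> real CARD('d) * \<delta>"
          using approx[OF t _ _ x(2)] u core by blast
        have "real CARD('d) * \<delta> = (\<rho>' - \<rho>a) / 2 / real M ^ length A"
          using words_length[OF A] by (simp add: \<delta>_def)
        then have "y' \<in> cube_map M A ` core \<rho>'"
          using y'(2) by (intro cube_map_core_perturb[OF imageI[OF x(1)] _ M_ge_1]) simp
        then show "\<exists>y\<in>cube_map M A ` core \<rho>'. rel t u y" using y'(1) by blast
      qed
    qed (use prod_list_p_bounds in auto)
    finally show "2 \<le> (\<Sum>A\<in>{A \<in> words M r. \<exists>y\<in>cube_map M A ` core \<rho>'. rel t u y}. prod_list (map p A))" .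
  qed
  obtain Q where Q: "determined (tree_words M) Q" "0 < tree_prob Q"
    "\<And>\<xi> t u. Q \<xi> \<Longrightarrow> t \<in> far_centres \<delta> v \<Longrightarrow> u \<in> core \<rho> \<Longrightarrow> \<exists>y\<in>limit_set M \<xi>. rel t u y"
    using all_fibres_meet_limit_set by blast
  obtain t where t: "t \<in> far_centres \<delta> v" using far_centres_nonempty[OF v \<delta>] by blast
  have "limit_set M \<xi> \<noteq> {}" if "Q \<xi>" for \<xi>
    using Q(3)[OF that t core_nonempty[OF \<rho>0(1)]] by auto
  then show ?thesis
    unfolding hits_all_def fibre_event_def using \<delta> \<rho>0 Q
    by - (rule exI[of _ \<delta>], rule exI[of _ \<rho>], rule exI[of _ Q], simp)
qed

lemma hits_all_same_direction:
  fixes \<I> :: "(real ^ 'd) set \<Rightarrow> 'd set"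
  assumes d: "CARD('d) \<ge> 2" and v: "norm v = 1" "\<And>i. v $ i \<noteq> 0"
    and adm: "\<And>\<alpha>. orthonormal_set \<alpha> \<Longrightarrow> 1 \<le> card \<alpha> \<Longrightarrow> card \<alpha> \<le> CARD('d) - 1 \<Longrightarrow> admissible_coords \<alpha> (\<I> \<alpha>)"
    and A: "\<And>\<alpha>. orthonormal_set \<alpha> \<Longrightarrow> card \<alpha> = CARD('d) - 1 \<Longrightarrow> \<not> coordinate_plane \<alpha> \<Longrightarrow>
      condition_A M p \<alpha> (\<I> \<alpha>)"
  shows "hits_all same_direction v"
proof -
  have v0: "v \<noteq> 0" using v(1) by auto
  \<comment> \<open>Flat fibres are to be parallel to \<open>v\<close>, so the plane is the
    hyperplane orthogonal to \<open>v\<close>. Were it a coordinate plane, it would contain an axis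
    vector and some coordinate of \<open>v\<close> would vanish.\<close>
  obtain \<alpha> where \<alpha>: "pairwise orthogonal \<alpha>" "\<And>x. x \<in> \<alpha> \<Longrightarrow> norm x = 1"
      "card \<alpha> = dim {x. v \<bullet> x = 0}" "span \<alpha> = {x. v \<bullet> x = 0}"
    using orthonormal_basis_subspace[OF subspace_hyperplane[of v]] by metis
  have on: "orthonormal_set \<alpha>" using \<alpha> by (simp add: orthonormal_set_def)
  have card: "card \<alpha> = CARD('d) - 1" using \<alpha>(3) dim_hyperplane[OF v0] by simp
  have "\<not> coordinate_plane \<alpha>"
  proof
    assume "coordinate_plane \<alpha>"
    then obtain J where J: "card J = card \<alpha>" "span \<alpha> = coord_span J" by (auto simp: coordinate_plane_def)
    have "J \<noteq> {}" using J(1) card d by auto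
    then obtain i where "i \<in> J" by blast
    then have "axis i 1 \<in> span \<alpha>" unfolding J(2) coord_span_def by (intro span_base) auto
    then show False using v(2)[of i] \<alpha>(4) by (simp add: inner_axis)
  qed
  then have cA: "condition_A M p \<alpha> (\<I> \<alpha>)" by (rule A[OF on card])
  interpret transversal_plane \<alpha> "\<I> \<alpha>"
    using on adm[OF on] card d by unfold_locales auto
  have line: "\<exists>s. y = s *\<^sub>R v" if "y \<in> W" for y
  proof
    define z where "z = y - (y \<bullet> v) *\<^sub>R v"
    have vv: "v \<bullet> v = 1" using v(1) by (simp add: dot_square_norm)
    have vz: "v \<bullet> z = 0" using vv by (simp add: z_def inner_diff_right inner_commute)
    then have "z \<in> span \<alpha>" using \<alpha>(4) by simp
    then have zy: "z \<bullet> y = 0" using that unfolding orthogonal_comp_def orthogonal_def by blast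
    have "z \<bullet> z = z \<bullet> y - (y \<bullet> v) * (z \<bullet> v)"
      by (subst (2) z_def) (simp only: inner_diff_right inner_scaleR_right)
    then have "z = 0" using vz zy by (simp add: inner_commute[of z v])
    then show "y = (y \<bullet> v) *\<^sub>R v" by (simp add: z_def)
  qed
  obtain \<rho>a \<rho> r where \<rho>: "0 < \<rho>a" "\<rho>a < \<rho>" "\<rho> < 1" "1 \<le> r"
    "\<And>u. u \<in> core \<rho> \<Longrightarrow>
      2 \<le> (\<Sum>A\<in>{A \<in> words M r. \<exists>y\<in>cube_map M A ` core \<rho>a. y - u \<in> W}. prod_list (map p A))"
    by (rule condition_A_branching[OF cA M_ge_1 less_imp_le[OF conjunct1[OF p_bounds]]]) (assumption, rule that)
  show ?thesis
  proof (rule hits_allI[where e = "\<lambda>t u. (u, sgn (u - t))" and L = "1 + real CARD('d)"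
        and Bd = "real CARD('d) + 1"])
    show "norm v = 1" by fact
    show "0 < \<rho>a" "\<rho>a < \<rho>" "\<rho> < 1" "1 \<le> r" by fact+
    show "2 \<le> (\<Sum>A\<in>{A \<in> words M r. \<exists>y\<in>cube_map M A ` core \<rho>a. y - u \<in> W}. prod_list (map p A))"
      if "u \<in> core \<rho>" for u using \<rho>(5)[OF that] .
    show "\<exists>y'. same_direction t u y' \<and> norm (y - y') \<le> real CARD('d) * \<delta>"
      if "t \<in> far_centres \<delta> v" "u \<in> unit_cube" "y \<in> unit_cube" "y - u \<in> W" for \<delta> t u y
      using line[OF that(4)] same_direction_approx_line[OF that(1-3) v(1)] by blast
    show "norm (u, sgn (u - t)) \<le> real CARD('d) + 1" if "u \<in> unit_cube" for t u :: "real ^ 'd"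
      using norm_Pair_le[of u "sgn (u - t)"] unit_cube_norm[OF that] norm_sgn_le[of "u - t"] by linarith
  qed (use same_direction_cube_map[OF M_ge_1] same_direction_lipschitz closed_same_direction
      in \<open>auto simp: same_direction_def\<close>)
qed

lemma hits_all_same_distance:
  fixes \<I> :: "(real ^ 'd) set \<Rightarrow> 'd set"
  assumes d: "CARD('d) \<ge> 2" and v: "norm v = 1" "\<And>i. v $ i \<noteq> 0"
    and adm: "\<And>\<alpha>. orthonormal_set \<alpha> \<Longrightarrow> 1 \<le> card \<alpha> \<Longrightarrow> card \<alpha> \<le> CARD('d) - 1 \<Longrightarrow> admissible_coords \<alpha> (\<I> \<alpha>)"
    and A: "\<And>\<alpha>. orthonormal_set \<alpha> \<Longrightarrow> card \<alpha> = 1 \<Longrightarrow> \<not> coordinate_plane \<alpha> \<Longrightarrow>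
      condition_A M p \<alpha> (\<I> \<alpha>)"
  shows "hits_all same_distance v"
proof -
  \<comment> \<open>Flat fibres are now the hyperplanes orthogonal to \<open>v\<close>, which
    spheres with far centres in this direction approximate.\<close>
  define \<alpha> where "\<alpha> = {v}"
  have on: "orthonormal_set \<alpha>" using v by (simp add: orthonormal_set_def \<alpha>_def)
  have card: "card \<alpha> = 1" by (simp add: \<alpha>_def)
  have "\<not> coordinate_plane \<alpha>"
  proof
    assume "coordinate_plane \<alpha>"
    then obtain J where J: "card J = 1" "span \<alpha> = coord_span J" using card by (auto simp: coordinate_plane_def)
    have "J \<noteq> UNIV" using J(1) d by auto
    then obtain i where "i \<notin> J" by blast
    moreover have "v \<in> coord_span J" unfolding J(2)[symmetric] by (simp add: \<alpha>_def span_base)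
    ultimately show False using coord_span_nth v(2) by blast
  qed
  then have cA: "condition_A M p \<alpha> (\<I> \<alpha>)" by (rule A[OF on card])
  interpret transversal_plane \<alpha> "\<I> \<alpha>"
    using on adm[OF on] card d by unfold_locales auto
  have plane: "y \<bullet> v = 0" if "y \<in> W" for y
  proof -
    have "v \<in> span \<alpha>" by (simp add: \<alpha>_def span_base)
    then show ?thesis using that by (auto simp: orthogonal_comp_def orthogonal_def inner_commute)
  qed
  obtain \<rho>a \<rho> r where \<rho>: "0 < \<rho>a" "\<rho>a < \<rho>" "\<rho> < 1" "1 \<le> r"
    "\<And>u. u \<in> core \<rho> \<Longrightarrow>
      2 \<le> (\<Sum>A\<in>{A \<in> words M r. \<exists>y\<in>cube_map M A ` core \<rho>a. y - u \<in> W}. prod_list (map p A))"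
    by (rule condition_A_branching[OF cA M_ge_1 less_imp_le[OF conjunct1[OF p_bounds]]]) (assumption, rule that)
  show ?thesis
  proof (rule hits_allI[where e = "\<lambda>t u. (u, sgn t, 1 / norm t)"
        and L = "2 * (real CARD('d))\<^sup>2 + 6 * real CARD('d) + 2" and Bd = "real CARD('d) + 2"])
    show "norm v = 1" by fact
    show "0 < \<rho>a" "\<rho>a < \<rho>" "\<rho> < 1" "1 \<le> r" by fact+
    show "2 \<le> (\<Sum>A\<in>{A \<in> words M r. \<exists>y\<in>cube_map M A ` core \<rho>a. y - u \<in> W}. prod_list (map p A))"
      if "u \<in> core \<rho>" for u using \<rho>(5)[OF that] .
    show "\<exists>y'. same_distance t u y' \<and> norm (y - y') \<le> real CARD('d) * \<delta>"
      if "t \<in> far_centres \<delta> v" "u \<in> unit_cube" "y \<in> unit_cube" "y - u \<in> W" for \<delta> t u y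
      using plane[OF that(4)] same_distance_approx_plane[OF that(1-3)] by blast
    show "norm (u, sgn t, 1 / norm t) \<le> real CARD('d) + 2"
      if "t \<in> far_centres \<delta> v" "u \<in> unit_cube" for \<delta> and t u :: "real ^ 'd"
    proof -
      have "2 * real CARD('d) + 1 \<le> norm (0 - t)" using that(1) zero_in_unit_cube by (auto simp: far_centres_def)
      then have "1 / norm t \<le> 1" by (simp add: divide_le_eq)
      then show ?thesis
        using norm_Pair_le[of u "(sgn t, 1 / norm t)"] norm_Pair_le[of "sgn t" "1 / norm t"]
          unit_cube_norm[OF that(2)] norm_sgn_le[of t] by simp
    qed
    show "0 < 2 * (real CARD('d))\<^sup>2 + 6 * real CARD('d) + 2" by (simp add: add_nonneg_pos)
    show "closed {y \<in> unit_cube. same_distance t u y}" for t u :: "real ^ 'd" by (rule closed_same_distance)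
    show "\<exists>y'. same_distance t' u' y' \<and> norm (y - y') \<le> (2 * (real CARD('d))\<^sup>2 + 6 * real CARD('d) + 2) * \<eta>"
      if "t \<in> far_centres \<delta> v" "t' \<in> far_centres \<delta> v" "u \<in> unit_cube" "u' \<in> unit_cube" "y \<in> unit_cube"
        "same_distance t u y" "norm ((u, sgn t, 1 / norm t) - (u', sgn t', 1 / norm t')) \<le> \<eta>"
      for \<delta> \<eta> and t t' u u' y :: "real ^ 'd"
      by (rule same_distance_lipschitz[OF that])
  qed (use same_distance_cube_map[OF M_ge_1] in \<open>auto simp: same_distance_def\<close>)
qed

end

section \<open>Open sets of fibres meeting the percolation set\<close>

text \<open>The digit is chosen in each coordinate at the end of the unit interval away from \<open>s\<close>.\<close>

lemma subcube_avoiding_point: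
  fixes s :: "real ^ 'd::finite"
  assumes "M \<ge> 2"
  obtains C where "C \<in> digits M" "\<And>x i. x \<in> unit_cube \<Longrightarrow> cube_map M [C, C] x $ i \<noteq> s $ i"
proof
  define C :: "nat ^ 'd" where "C = (\<chi> i. if s $ i > 1/2 then 0 else M - 1)"
  show "C \<in> digits M" using assms by (simp add: digits_def C_def)
  fix x :: "real ^ 'd" and i assume x: "x \<in> unit_cube"
  define m where "m = real M"
  have m: "m \<ge> 2" using assms by (simp add: m_def)
  then have m4: "m\<^sup>2 \<ge> 4" using power_mono[of 2 m 2] by simp
  have x01: "0 \<le> x $ i" "x $ i \<le> 1" using x by (auto simp: unit_cube_def)
  \<comment> \<open>Two equal digits confine the coordinate to [0, 1/4] or to [3/4, 1] even for M =
    2; after a single digit the value 1/2 would remain possible in the second case.\<close>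
  have eq: "cube_map M [C, C] x $ i = x $ i / m\<^sup>2 + real (C $ i) / m + real (C $ i) / m\<^sup>2"
    by (simp add: cube_map_def m_def lessThan_Suc power2_eq_square)
  show "cube_map M [C, C] x $ i \<noteq> s $ i"
  proof (cases "s $ i > 1/2")
    case True
    then have "cube_map M [C, C] x $ i = x $ i / m\<^sup>2" unfolding eq by (simp add: C_def)
    also have "\<dots> \<le> 1 / m\<^sup>2" using x01 by (simp add: divide_right_mono)
    also have "\<dots> \<le> 1 / 4" using m4 by (intro divide_left_mono) auto
    finally show ?thesis using True by linarith
  next
    case False
    then have *: "real (C $ i) = m - 1" using assms by (simp add: C_def m_def of_nat_diff)
    then have "cube_map M [C, C] x $ i = x $ i / m\<^sup>2 + (1 - 1 / m\<^sup>2)"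
      unfolding eq * using m by (simp add: field_simps power2_eq_square)
    moreover have "0 \<le> x $ i / m\<^sup>2" using x01 by simp
    moreover have "1 / m\<^sup>2 \<le> 1 / 4" using m4 by (intro divide_left_mono) auto
    ultimately show ?thesis using False by linarith
  qed
qed

lemma limit_set_subset_unit_cube: "limit_set M \<xi> \<subseteq> unit_cube"
proof -
  have "(\<Union>A\<in>openings M \<xi> 0. cube M A) \<subseteq> unit_cube" by (auto simp: cube_def)
  then show ?thesis unfolding limit_set_def by blast
qed

lemma openings_appendI:
  assumes "A \<in> openings M \<xi> m" "B \<in> openings M (below \<xi> A) n"
  shows "A @ B \<in> openings M \<xi> (m + n)"
  using assms openings_append openings_subset by (metis subsetD)

lemma open_core_interior: "open {z :: real ^ 'd::finite. \<forall>i. \<bar>uncube M A z $ i - 1/2\<bar> < \<rho> / 2}"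
proof -
  have "{z :: real ^ 'd. \<forall>i. \<bar>uncube M A z $ i - 1/2\<bar> < \<rho> / 2} =
      (\<Inter>i. {z. \<bar>uncube M A z $ i - 1/2\<bar> < \<rho> / 2})" by auto
  also have "open \<dots>"
  proof (rule open_INT)
    show "\<forall>i\<in>UNIV. open {z :: real ^ 'd. \<bar>uncube M A z $ i - 1/2\<bar> < \<rho> / 2}"
    proof
      fix i :: 'd
      show "open {z :: real ^ 'd. \<bar>uncube M A z $ i - 1/2\<bar> < \<rho> / 2}"
        unfolding uncube_def by (intro open_Collect_less continuous_intros)
    qed
  qed simp
  finally show ?thesis .
qed

text \<open>Near \<open>x\<close> the directions to \<open>t\<close> hardly vary, while rescaling
  makes the distances large. The depth \<open>m\<close> is fixed ahead of \<open>A\<close> and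
  \<open>B\<close>, since the cube inside which the wanted event occurs is found only later and at
  an unknown depth.\<close>

lemma uncube_in_far_centres:
  fixes t :: "real ^ 'd::finite"
  assumes "M \<ge> 2" "x \<noteq> t" "0 < \<delta>" "norm (v - sgn (x - t)) \<le> \<delta> / 2"
  obtains m where "\<And>A n B. A \<in> words M m \<Longrightarrow> x \<in> cube M A \<Longrightarrow> B \<in> words M n \<Longrightarrow>
    uncube M (A @ B) t \<in> far_centres \<delta> v"
proof -
  define d where "d = real CARD('d)"
  have d: "d \<ge> 1" by (simp add: d_def Suc_leI)
  define D where "D = norm (x - t)"
  have D: "D > 0" using assms by (simp add: D_def)
  \<comment> \<open>The first bound leaves distance 2d + 1 after subtracting d for the diameter of
    the cube; the second grants \<delta>/2 to the variation of directions, the other half going to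
    the distance between \<open>v\<close> and the direction of \<open>x\<close>.\<close>
  obtain m where m: "max ((3 * d + 1) / D) (4 * d / (\<delta> * D)) < real M ^ m"
    using real_arch_pow[of "real M" "max ((3 * d + 1) / D) (4 * d / (\<delta> * D))"] assms(1) by auto
  have Mm: "real M ^ m > 0" using assms(1) by simp
  have m1: "3 * d + 1 \<le> real M ^ m * D" using m D by (simp add: field_simps)
  have m2: "2 * (d / real M ^ m) / D \<le> \<delta> / 2"
  proof -
    have "4 * d / (\<delta> * D) \<le> real M ^ m" using m by simp
    then have "4 * d \<le> real M ^ m * (\<delta> * D)" using D assms(3) by (simp add: divide_le_eq)
    then show ?thesis using D Mm by (simp add: field_simps)
  qed
  show thesis
  proof (rule that[of m])
    fix A B :: "'d word" and n
    assume A: "A \<in> words M m" "x \<in> cube M A" and B: "B \<in> words M n"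
    let ?F = "A @ B"
    have M1: "M \<ge> 1" using assms(1) by simp
    show "uncube M ?F t \<in> far_centres \<delta> v"
      unfolding far_centres_def mem_Collect_eq
    proof
      fix y :: "real ^ 'd" assume y: "y \<in> unit_cube"
      define z where "z = cube_map M ?F y"
      have FB: "cube_map M B y \<in> unit_cube" by (rule cube_map_in_unit_cube[OF B y M1])
      obtain x' where x': "x' \<in> unit_cube" "x = cube_map M A x'" using A(2) by (auto simp: cube_def)
      have "z - x = (1 / real M ^ m) *\<^sub>R (cube_map M B y - x')"
        using words_length[OF A(1)] by (simp add: z_def cube_map_append x'(2) cube_map_diff)
      then have zx: "norm (z - x) \<le> d / real M ^ m"
        using unit_cube_dist[OF FB x'(1)] Mm by (simp add: d_def divide_right_mono)
      have scale: "z - t = (1 / real M ^ length ?F) *\<^sub>R (y - uncube M ?F t)"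
        unfolding z_def by (rule diff_uncube[OF M1])
      have "norm (y - uncube M ?F t) = real M ^ length ?F * norm (z - t)"
        unfolding scale using assms(1) by simp
      also have "\<dots> \<ge> real M ^ m * norm (z - t)"
        using words_length[OF A(1)] M1 by (intro mult_right_mono power_increasing) auto
      finally have "real M ^ m * norm (z - t) \<le> norm (y - uncube M ?F t)" .
      moreover have "D - d / real M ^ m \<le> norm (z - t)"
        using norm_triangle_ineq2[of "x - t" "x - z"] zx by (simp add: D_def norm_minus_commute)
      then have "real M ^ m * (D - d / real M ^ m) \<le> real M ^ m * norm (z - t)"
        using Mm by (intro mult_left_mono) auto
      moreover have "real M ^ m * (D - d / real M ^ m) = real M ^ m * D - d"
        using Mm by (simp add: right_diff_distrib)
      ultimately have far: "2 * d + 1 \<le> norm (y - uncube M ?F t)" using m1 by linarith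
      have "sgn (z - t) = sgn (y - uncube M ?F t)"
        unfolding scale using assms(1) by (simp add: sgn_scaleR)
      moreover have "norm (sgn (z - t) - sgn (x - t)) \<le> 2 * norm (z - x) / D"
        using norm_sgn_diff_le[of "x - t" "z - t"] assms(2) by (simp add: D_def)
      moreover have "2 * norm (z - x) / D \<le> \<delta> / 2"
        using m2 zx D by (intro order_trans[OF divide_right_mono m2]) auto
      moreover have "norm (sgn (z - t) - v) \<le> norm (sgn (z - t) - sgn (x - t)) + norm (v - sgn (x - t))"
        using norm_triangle_ineq[of "sgn (z - t) - sgn (x - t)" "sgn (x - t) - v"]
        by (simp add: norm_minus_commute)
      ultimately have "norm (sgn (y - uncube M ?F t) - v) \<le> \<delta>" using assms(4) by simp
      with far show "2 * real CARD('d) + 1 \<le> norm (y - uncube M ?F t) \<and> norm (sgn (y - uncube M ?F t) - v) \<le> \<delta>"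
        by (simp add: d_def)
    qed
  qed
qed

context percolation
begin

text \<open>The null set must not depend on \<open>t\<close>. All random statements are therefore
  settled first, for all words and countably many directions; the argument for a given centre is
  then deterministic.\<close>

theorem open_set_of_fibres:
  fixes rel :: "real ^ 'd \<Rightarrow> real ^ 'd \<Rightarrow> real ^ 'd \<Rightarrow> bool"
  assumes hits: "\<And>v. norm v = 1 \<Longrightarrow> (\<And>i. v $ i \<noteq> 0) \<Longrightarrow> hits_all rel v"
    and scaling: "\<And>A t u y. rel (uncube M A t) u y \<Longrightarrow> rel t (cube_map M A u) (cube_map M A y)"
  shows "AE \<omega> in P. percolation_set M c \<omega> \<noteq> {} \<longrightarrow>
    (\<forall>t. \<exists>U. open U \<and> U \<noteq> {} \<and> t \<notin> U \<and> (\<forall>u\<in>U. \<exists>y\<in>percolation_set M c \<omega>. rel t u y))"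
proof -
  define V where "V = {v :: real ^ 'd. norm v = 1 \<and> (\<forall>i. v $ i \<noteq> 0)}"
  have "\<forall>v\<in>V. hits_all rel v" using hits by (simp add: V_def)
  then obtain \<delta> \<rho> Q where "\<And>v. v \<in> V \<Longrightarrow> fibre_event rel v (\<delta> v) (\<rho> v) (Q v)"
    unfolding hits_all_def by metis
  then have Q: "\<And>v. v \<in> V \<Longrightarrow> 0 < \<delta> v" "\<And>v. v \<in> V \<Longrightarrow> 0 < \<rho> v" "\<And>v. v \<in> V \<Longrightarrow> \<rho> v < 1"
    "\<And>v. v \<in> V \<Longrightarrow> determined (tree_words M) (Q v)" "\<And>v. v \<in> V \<Longrightarrow> 0 < tree_prob (Q v)"
    "\<And>v \<xi>. v \<in> V \<Longrightarrow> Q v \<xi> \<Longrightarrow> limit_set M \<xi> \<noteq> {}"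
    "\<And>v \<xi> t u. v \<in> V \<Longrightarrow> Q v \<xi> \<Longrightarrow> t \<in> far_centres (\<delta> v) v \<Longrightarrow> u \<in> core (\<rho> v) \<Longrightarrow>
      \<exists>y\<in>limit_set M \<xi>. rel t u y"
    by (simp_all add: fibre_event_def)
  \<comment> \<open>Almost sure statements combine only over countably many \<open>v\<close>; the
    radius \<delta>/2 is the accuracy that zooming in at a point requires.\<close>
  obtain V' where V': "countable V'" "V' \<subseteq> V" "(\<Union>v\<in>V'. ball v (\<delta> v / 2)) = (\<Union>v\<in>V. ball v (\<delta> v / 2))"
  proof -
    obtain F where F: "F \<subseteq> (\<lambda>v. ball v (\<delta> v / 2)) ` V" "countable F" "\<Union>F = \<Union>((\<lambda>v. ball v (\<delta> v / 2)) ` V)"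
      using Lindelof[of "(\<lambda>v. ball v (\<delta> v / 2)) ` V"] by auto
    then obtain V' where "countable V'" "V' \<subseteq> V" "F = (\<lambda>v. ball v (\<delta> v / 2)) ` V'"
      using countable_subset_image[of F "\<lambda>v. ball v (\<delta> v / 2)" V] by blast
    then show thesis using F(3) that[of V'] by simp
  qed
  \<comment> \<open>Any member of \<open>V\<close> would do. Its event gives survival positive
    probability, and later provides a point of the limit set inside a surviving cube.\<close>
  define w :: "real ^ 'd" where "w = sgn (\<chi> i. 1)"
  have "(\<chi> i. 1) \<noteq> (0 :: real ^ 'd)" by (simp add: vec_eq_iff)
  then have w: "w \<in> V" by (simp add: V_def w_def norm_sgn sgn_div_norm)
  have Qs: "survives M \<xi>" if "v \<in> V" "Q v \<xi>" for v \<xi>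
    by (rule limit_set_survives[OF Q(6)[OF that]])
  have spos: "0 < tree_prob (survives M)"
    using Q(5)[OF w] tree_prob_mono[OF determined_survives Qs[OF w]] by (rule less_le_trans)
  \<comment> \<open>Two full generations contain a surviving cube none of whose points shares a coordinate with \<open>t\<close>,
    so the percolation set is not contained in the axis-parallel lines through \<open>t\<close>.\<close>
  define H :: "('d word \<Rightarrow> bool) \<Rightarrow> bool" where "H = all_children M (all_children M (survives M))"
  have dH: "determined (tree_words M) H"
    unfolding H_def by (intro determined_all_children determined_survives)
  have pos: "0 < tree_prob (all_children M \<Phi>)"
    if "determined (tree_words M) \<Phi>" "0 < tree_prob \<Phi>" for \<Phi>
    unfolding tree_prob_all_children[OF that(1)] using p_bounds that(2) by (intro prod_pos) auto
  have Hpos: "0 < tree_prob H"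
    unfolding H_def by (intro pos determined_all_children determined_survives spos)
  have Hs: "survives M \<xi>" if "H \<xi>" for \<xi>
  proof -
    obtain C :: "nat ^ 'd" where C: "C \<in> digits M" using digits_nonempty[OF M_ge_1] by blast
    show ?thesis using that unfolding H_def by (meson C all_childrenD child_survives)
  qed
  let ?\<xi> = "\<lambda>\<omega> A. c A \<omega>"
  have "AE \<omega> in P. \<forall>v\<in>V'. \<forall>m. \<forall>B\<in>words M m. survives M (below (?\<xi> \<omega>) B) \<longrightarrow>
      (\<exists>n. \<exists>D\<in>openings M (below (?\<xi> \<omega>) B) n. Q v (below (?\<xi> \<omega>) (B @ D)))"
    using V' Q(4,5) Qs by (subst AE_ball_countable[OF V'(1)]) (blast intro: survival_reaches)
  moreover have "AE \<omega> in P. \<forall>m. \<forall>B\<in>words M m. survives M (below (?\<xi> \<omega>) B) \<longrightarrow>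
      (\<exists>n. \<exists>D\<in>openings M (below (?\<xi> \<omega>) B) n. H (below (?\<xi> \<omega>) (B @ D)))"
    by (rule survival_reaches[OF dH Hpos]) (rule Hs)
  moreover have "AE \<omega> in P. \<forall>m. \<forall>B\<in>words M m. survives M (below (?\<xi> \<omega>) B) \<longrightarrow>
      (\<exists>n. \<exists>D\<in>openings M (below (?\<xi> \<omega>) B) n. Q w (below (?\<xi> \<omega>) (B @ D)))"
    by (rule survival_reaches[OF Q(4)[OF w] Q(5)[OF w]]) (rule Qs[OF w])
  ultimately show ?thesis
  proof eventually_elim
    case (elim \<omega>)
    define \<xi> where "\<xi> = ?\<xi> \<omega>"
    note reach = elim[folded \<xi>_def]
    have E: "percolation_set M c \<omega> = limit_set M \<xi>"
      unfolding \<xi>_def by (rule percolation_set_limit_set[OF M_ge_1])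
    show ?case unfolding E
    proof (intro impI allI)
      fix t :: "real ^ 'd"
      assume "limit_set M \<xi> \<noteq> {}"
      then have "survives M (below \<xi> [])" using limit_set_survives by simp
      then obtain n D where D: "D \<in> openings M \<xi> n" "H (below \<xi> D)"
        using reach(2) by (metis append_Nil below_Nil singletonI words_0)
      \<comment> \<open>The digit depends on the centre rescaled along with \<open>D\<close>; this
        is why \<open>H\<close> keeps all children in two generations.\<close>
      obtain C where C: "C \<in> digits M"
        "\<And>x i. x \<in> unit_cube \<Longrightarrow> cube_map M [C, C] x $ i \<noteq> uncube M D t $ i"
        using subcube_avoiding_point[OF M_ge_2] by blast
      define B where "B = D @ [C] @ [C]"
      have "[C] \<in> openings M (below \<xi> D) (Suc 0)"
        "[C] \<in> openings M (below (below \<xi> D) [C]) (Suc 0)" and sB: "survives M (below \<xi> B)"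
        using D(2) all_childrenD[OF _ C(1)] unfolding H_def B_def by (metis below_below)+
      then have oB: "B \<in> openings M \<xi> (n + (Suc 0 + Suc 0))"
        unfolding B_def by (intro openings_appendI D(1))
      then obtain n' D' where D': "D' \<in> openings M (below \<xi> B) n'" "Q w (below \<xi> (B @ D'))"
        using reach(3) sB openings_subset by (metis subsetD)
      obtain x' where x': "x' \<in> limit_set M (below \<xi> (B @ D'))" using Q(6)[OF w D'(2)] by blast
      define x where "x = cube_map M (B @ D') x'"
      have xE: "x \<in> limit_set M \<xi>"
        unfolding x_def by (rule limit_set_cube_map[OF M_ge_1 openings_appendI[OF oB D'(1)] x'])
      have "(x - t) $ i \<noteq> 0" for i
      proof -
        define z where "z = cube_map M [C, C] (cube_map M D' x')"
        have "D' \<in> words M n'" using D'(1) openings_subset by blast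
        then have "cube_map M D' x' \<in> unit_cube"
          using x' limit_set_subset_unit_cube M_ge_1 by (intro cube_map_in_unit_cube) auto
        then have "(z - uncube M D t) $ i \<noteq> 0" using C(2) by (simp add: z_def)
        moreover have "x = cube_map M D z"
          by (simp add: x_def z_def B_def cube_map_append[of M D] cube_map_append[of M "[C, C]" D', simplified])
        then have "x - t = (1 / real M ^ length D) *\<^sub>R (z - uncube M D t)"
          using diff_uncube[OF M_ge_1] by simp
        ultimately show ?thesis using M_ge_2 by simp
      qed
      then have nz: "(x - t) $ i \<noteq> 0" for i .
      then have xt: "x \<noteq> t" by auto
      then have v1: "sgn (x - t) \<in> V" using nz by (simp add: V_def norm_sgn) (simp add: sgn_div_norm)
      have "sgn (x - t) \<in> (\<Union>v\<in>V. ball v (\<delta> v / 2))" using v1 Q(1)[OF v1] by (intro UN_I[OF v1]) simp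
      then obtain v where v: "v \<in> V'" "norm (v - sgn (x - t)) < \<delta> v / 2"
        unfolding V'(3)[symmetric] by (auto simp: dist_norm)
      then have vV: "v \<in> V" using V'(2) by blast
      obtain m where m: "\<And>A n B. A \<in> words M m \<Longrightarrow> x \<in> cube M A \<Longrightarrow> B \<in> words M n \<Longrightarrow>
          uncube M (A @ B) t \<in> far_centres (\<delta> v) v"
        using uncube_in_far_centres[OF M_ge_2 xt Q(1)[OF vV] less_imp_le[OF v(2)]] by metis
      obtain A where A: "A \<in> openings M \<xi> m" "x \<in> cube M A" "\<And>k. openings M (below \<xi> A) k \<noteq> {}"
        using limit_set_surviving_cube[OF M_ge_1 xE] by metis
      then have Aw: "A \<in> words M m" and "survives M (below \<xi> A)"
        using openings_subset[of M \<xi> m] by (auto simp: survives_def)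
      then obtain k G where G: "G \<in> openings M (below \<xi> A) k" "Q v (below \<xi> (A @ G))"
        using reach(1) v(1) by metis
      define F where "F = A @ G"
      have Gw: "G \<in> words M k" using G(1) openings_subset by blast
      have oF: "F \<in> openings M \<xi> (m + k)" unfolding F_def by (rule openings_appendI[OF A(1) G(1)])
      have tF: "uncube M F t \<in> far_centres (\<delta> v) v" unfolding F_def by (rule m[OF Aw A(2) Gw])
      \<comment> \<open>The open core of \<open>F\<close>. After rescaling, its points lie in the
        core to which \<open>Q v\<close> applies, with a centre that is far by the choice of
        \<open>m\<close>.\<close>
      define U where "U = {z. \<forall>i. \<bar>uncube M F z $ i - 1/2\<bar> < \<rho> v / 2}"
      have core: "uncube M F z \<in> core (\<rho> v)" if "z \<in> U" for z
        using that by (auto simp: U_def core_def intro: less_imp_le)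
      show "\<exists>U. open U \<and> U \<noteq> {} \<and> t \<notin> U \<and> (\<forall>u\<in>U. \<exists>y\<in>limit_set M \<xi>. rel t u y)"
      proof (intro exI[of _ U] conjI ballI)
        show "open U" unfolding U_def by (rule open_core_interior)
        have "cube_map M F (\<chi> i. 1/2) \<in> U" using M_ge_1 Q(2)[OF vV] by (simp add: U_def)
        then show "U \<noteq> {}" by blast
        \<comment> \<open>A far centre has positive distance from every point of the unit cube,
          which would include itself.\<close>
        show "t \<notin> U"
        proof
          assume "t \<in> U"
          then have "uncube M F t \<in> unit_cube" using core core_subset_unit_cube Q(3)[OF vV] less_imp_le by blast
          then have "2 * real CARD('d) + 1 \<le> norm (uncube M F t - uncube M F t)"
            using tF unfolding far_centres_def by blast
          then show False by simp
        qed
        fix u assume "u \<in> U"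
        then obtain y where y: "y \<in> limit_set M (below \<xi> F)" "rel (uncube M F t) (uncube M F u) y"
          using Q(7)[OF vV _ tF core] G(2) by (auto simp: F_def)
        then have "rel t u (cube_map M F y)" using scaling[OF y(2)] M_ge_1 by simp
        then show "\<exists>y\<in>limit_set M \<xi>. rel t u y" using limit_set_cube_map[OF M_ge_1 oF y(1)] by blast
      qed
    qed
  qed
qed

end

section \<open>Open sets of fibres as open sets of directions and of distances\<close>

lemma interior_radial_proj:
  fixes t :: "real ^ 'd::finite"
  assumes "open U" "U \<noteq> {}" "t \<notin> U" "\<And>u. u \<in> U \<Longrightarrow> \<exists>y\<in>E. same_direction t u y"
  shows "top_of_set (sphere 0 1) interior_of radial_proj t E \<noteq> {}"
proof -
  obtain u0 where u0: "u0 \<in> U" using assms(2) by blast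
  define s where "s = norm (u0 - t)"
  have s: "s > 0" using u0 assms(3) by (auto simp: s_def)
  \<comment> \<open>Only the direction of a point of \<open>U\<close> matters, so one sphere around
    \<open>t\<close> that meets \<open>U\<close> is enough; it is rescaled to the unit
    sphere.\<close>
  define X where "X = sphere 0 1 \<inter> (\<lambda>w. t + s *\<^sub>R w) -` U"
  have "open ((\<lambda>w. t + s *\<^sub>R w) -` U)"
    by (rule open_vimage[OF assms(1)]) (intro continuous_intros)
  then have "openin (top_of_set (sphere 0 1)) X" unfolding X_def by (rule openin_open_Int)
  moreover have "X \<subseteq> radial_proj t E"
  proof
    fix w assume w: "w \<in> X"
    then obtain y where y: "y \<in> E" "same_direction t (t + s *\<^sub>R w) y"
      using assms(4) by (auto simp: X_def)
    have "sgn (y - t) = w"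
      using y(2) w s by (simp add: same_direction_def sgn_scaleR X_def sgn_div_norm[of w])
    moreover from this have "y \<noteq> t" using w by (auto simp: X_def)
    ultimately show "w \<in> radial_proj t E"
      using y(1) by (auto simp: radial_proj_def sgn_div_norm)
  qed
  moreover have "sgn (u0 - t) \<in> X"
    using u0 s norm_scaleR_sgn[of "u0 - t"] by (auto simp: X_def s_def norm_sgn)
  ultimately show ?thesis using interior_of_maximal by blast
qed

lemma interior_coradial_proj:
  fixes t :: "real ^ 'd::finite"
  assumes "open U" "U \<noteq> {}" "t \<notin> U" "\<And>u. u \<in> U \<Longrightarrow> \<exists>y\<in>E. same_distance t u y"
  shows "top_of_set {0..} interior_of coradial_proj t E \<noteq> {}"
proof -
  obtain u0 where u0: "u0 \<in> U" using assms(2) by blast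
  define w where "w = sgn (u0 - t)"
  have w: "norm w = 1" using u0 assms(3) by (auto simp: w_def norm_sgn)
  \<comment> \<open>Only the distance matters here, so one ray from \<open>t\<close> that meets
    \<open>U\<close> is enough.\<close>
  define X where "X = {0..} \<inter> (\<lambda>s. t + s *\<^sub>R w) -` U"
  have "open ((\<lambda>s. t + s *\<^sub>R w) -` U)"
    by (rule open_vimage[OF assms(1)]) (intro continuous_intros)
  then have "openin (top_of_set {0..}) X" unfolding X_def by (rule openin_open_Int)
  moreover have "X \<subseteq> coradial_proj t E"
  proof
    fix s assume s: "s \<in> X"
    then obtain y where y: "y \<in> E" "same_distance t (t + s *\<^sub>R w) y"
      using assms(4) by (auto simp: X_def)
    then have "norm (y - t) = s" using w s by (simp add: same_distance_def X_def)
    then show "s \<in> coradial_proj t E" using y(1) by (auto simp: coradial_proj_def)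
  qed
  moreover have "norm (u0 - t) \<in> X"
    using u0 norm_scaleR_sgn[of "u0 - t"] by (auto simp: X_def w_def)
  ultimately show ?thesis using interior_of_maximal by blast
qed

theorem theorem1p4:
  fixes P :: "'w measure"
    and M :: nat
    and p :: "nat ^ 'd::finite \<Rightarrow> real"
    and c :: "'d word \<Rightarrow> 'w \<Rightarrow> bool"
    and \<I> :: "(real ^ 'd) set \<Rightarrow> 'd set"
  assumes "CARD('d) \<ge> 2"
    and "M \<ge> 2"
    and "\<forall>C\<in>digits M. 0 < p C \<and> p C < 1"
    and "percolation_choices P M p c"
    and "\<forall>\<alpha>. orthonormal_set \<alpha> \<and> 1 \<le> card \<alpha> \<and> card \<alpha> \<le> CARD('d) - 1
            \<longrightarrow> admissible_coords \<alpha> (\<I> \<alpha>)"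
  shows
    "((\<forall>\<alpha>. orthonormal_set \<alpha> \<and> card \<alpha> = CARD('d) - 1 \<and> \<not> coordinate_plane \<alpha>
          \<longrightarrow> condition_A M p \<alpha> (\<I> \<alpha>)) \<longrightarrow>
        (AE \<omega> in P. percolation_set M c \<omega> \<noteq> {} \<longrightarrow>
          (\<forall>t. top_of_set (sphere 0 1) interior_of radial_proj t (percolation_set M c \<omega>) \<noteq> {}))) \<and>
     ((\<forall>\<alpha>. orthonormal_set \<alpha> \<and> card \<alpha> = 1 \<and> \<not> coordinate_plane \<alpha>
          \<longrightarrow> condition_A M p \<alpha> (\<I> \<alpha>)) \<longrightarrow>
        (AE \<omega> in P. percolation_set M c \<omega> \<noteq> {} \<longrightarrow>
          (\<forall>t. top_of_set {0..} interior_of coradial_proj t (percolation_set M c \<omega>) \<noteq> {})))"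
proof -
  interpret prob_space P using assms(4) by (simp add: percolation_choices_def)
  interpret percolation P M p c
    using assms(2-4) by unfold_locales auto
  show ?thesis
  proof (intro conjI impI)
    assume A: "\<forall>\<alpha>. orthonormal_set \<alpha> \<and> card \<alpha> = CARD('d) - 1 \<and> \<not> coordinate_plane \<alpha>
      \<longrightarrow> condition_A M p \<alpha> (\<I> \<alpha>)"
    have "hits_all same_direction v" if "norm v = 1" "\<And>i. v $ i \<noteq> 0" for v
      by (rule hits_all_same_direction[OF assms(1) that, of \<I>]) (use assms(5) A in auto)
    then have "AE \<omega> in P. percolation_set M c \<omega> \<noteq> {} \<longrightarrow>
        (\<forall>t. \<exists>U. open U \<and> U \<noteq> {} \<and> t \<notin> U \<and> (\<forall>u\<in>U. \<exists>y\<in>percolation_set M c \<omega>. same_direction t u y))"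
      by (rule open_set_of_fibres) (use same_direction_cube_map[OF M_ge_1] in auto)
    then show "AE \<omega> in P. percolation_set M c \<omega> \<noteq> {} \<longrightarrow>
      (\<forall>t. top_of_set (sphere 0 1) interior_of radial_proj t (percolation_set M c \<omega>) \<noteq> {})"
      by eventually_elim (metis interior_radial_proj)
  next
    assume A: "\<forall>\<alpha>. orthonormal_set \<alpha> \<and> card \<alpha> = 1 \<and> \<not> coordinate_plane \<alpha>
      \<longrightarrow> condition_A M p \<alpha> (\<I> \<alpha>)"
    have "hits_all same_distance v" if "norm v = 1" "\<And>i. v $ i \<noteq> 0" for v
      by (rule hits_all_same_distance[OF assms(1) that, of \<I>]) (use assms(5) A in auto)
    then have "AE \<omega> in P. percolation_set M c \<omega> \<noteq> {} \<longrightarrow>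
        (\<forall>t. \<exists>U. open U \<and> U \<noteq> {} \<and> t \<notin> U \<and> (\<forall>u\<in>U. \<exists>y\<in>percolation_set M c \<omega>. same_distance t u y))"
      by (rule open_set_of_fibres) (use same_distance_cube_map[OF M_ge_1] in auto)
    then show "AE \<omega> in P. percolation_set M c \<omega> \<noteq> {} \<longrightarrow>
      (\<forall>t. top_of_set {0..} interior_of coradial_proj t (percolation_set M c \<omega>) \<noteq> {})"
      by eventually_elim (metis interior_coradial_proj)
  qed
qed

end
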